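(* Let $u$ be an inner function and let $A^u_\phi, A^u_\psi\in\mathcal{T}_u$ be truncated Toeplitz operators on $K^2_u$. Then the following are equivalent: (i) $A^u_\phi A^u_\psi=A^u_\psi A^u_\phi$. (ii) $A^u_\phi A^u_\psi-A^u_\psi A^u_\phi\in\mathcal{T}_u$. (iii) One of the following is true: (1) there exists $\alpha\in\hat{\mathbb{C}}$ such that $A^u_\phi$ and $A^u_\psi$ both belong to $\mathcal{B}^\alpha_u$; (2) the operators $I, A^u_\phi, A^u_\psi$ are not linearly independent.
   Context: $\mathbb{D}$ is the open unit disc, $\mathbb{T}$ the unit circle, $\hat{\mathbb{C}}=\mathbb{C}\cup\{\infty\}$. The Hardy space $H^2$ is viewed as a closed subspace of $L^2(\mathbb{T})$ via boundary values. For an inner function $u$, the model space is $K^2_u=H^2\ominus uH^2$, and $P_{K^2_u}$ is the orthogonal projection of $L^2(\mathbb{T})$ onto it. Truncated Toeplitz operators: $K^2_u\cap H^\infty$ is dense in $K^2_u$. If $\phi\in L^2(\mathbb{T})$ and the map $f\mapsto P_{K^2_u}(\phi f)$, defined on $K^2_u\cap H^\infty$, extends to a bounded operator on $K^2_u$, this extension is denoted $A^u_\phi$ and called the truncated Toeplitz operator with symbol $\phi$ (the symbol is not unique). $\mathcal{T}_u$ is the set of all (bounded) truncated Toeplitz operators on $K^2_u$; it is a linear subspace of the bounded operators on $K^2_u$. $S_u=A^u_z$ is the compression of multiplication by $z$. Conjugation: for $f\in K^2_u$, $\tilde f=u\bar z\bar f$ (on $\mathbb{T}$); this maps $K^2_u$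 bijectively to itself. Sedlock classes: for $\alpha\in\mathbb{C}$, $\mathcal{B}^\alpha_u$ is the set of operators in $\mathcal{T}_u$ that have a symbol of the form $\phi+\alpha\overline{S_u\tilde\phi}+c$ with $\phi\in K^2_u$ and $c\in\mathbb{C}$; $\mathcal{B}^\infty_u$ is the set of operators in $\mathcal{T}_u$ that have an antiholomorphic symbol (a symbol in $\overline{H^2}$). *)

theory Defs
  imports "HOL-Complex_Analysis.Complex_Analysis"
begin

definition circle_measure :: "complex measure" where
  "circle_measure =
     distr (uniform_measure lborel {0..2*pi}) (restrict_space borel (sphere 0 1)) cis"

definition sq_integrable :: "(complex \<Rightarrow> complex) \<Rightarrow> bool" where
  "sq_integrable f \<longleftrightarrow> f \<in> borel_measurable circle_measure \<and>
     integrable circle_measure (\<lambda>z. (cmod (f z))\<^sup>2)"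

lemma sq_integrable_zero: "sq_integrable (\<lambda>z. 0)"
  by (simp add: sq_integrable_def)

lemma sq_integrable_scale:
  assumes "sq_integrable f" shows "sq_integrable (\<lambda>z. c * f z)"
  using assms by (auto simp: sq_integrable_def norm_mult power_mult_distrib)

lemma sq_integrable_cnj:
  assumes "sq_integrable f" shows "sq_integrable (\<lambda>z. cnj (f z))"
proof -
  have "cnj \<in> borel_measurable borel"
    by (intro borel_measurable_continuous_onI continuous_intros)
  then show ?thesis
    using assms by (auto simp: sq_integrable_def intro: measurable_compose)
qed

lemma sq_integrable_add:
  assumes "sq_integrable f" "sq_integrable g" shows "sq_integrable (\<lambda>z. f z + g z)"
proof -
  have *: "(cmod (a + b))\<^sup>2 \<le> 2 * (cmod a)\<^sup>2 + 2 * (cmod b)\<^sup>2" for a b :: complex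
  proof -
    have "(cmod (a + b))\<^sup>2 \<le> (cmod a + cmod b)\<^sup>2"
      by (intro power_mono norm_triangle_ineq) auto
    also have "\<dots> \<le> 2 * (cmod a)\<^sup>2 + 2 * (cmod b)\<^sup>2"
      using sum_squares_bound[of "cmod a" "cmod b"] by (simp add: power2_sum)
    finally show ?thesis .
  qed
  have [measurable]: "f \<in> borel_measurable circle_measure" "g \<in> borel_measurable circle_measure"
    using assms by (auto simp: sq_integrable_def)
  have "integrable circle_measure (\<lambda>z. 2 * (cmod (f z))\<^sup>2 + 2 * (cmod (g z))\<^sup>2)"
    using assms by (auto simp: sq_integrable_def)
  then have "integrable circle_measure (\<lambda>z. (cmod (f z + g z))\<^sup>2)"
    by (rule Bochner_Integration.integrable_bound) (use * in auto)
  then show ?thesis by (simp add: sq_integrable_def)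
qed

lemma sq_integrable_mult_integrable:
  assumes "sq_integrable f" "sq_integrable g"
  shows "integrable circle_measure (\<lambda>z. f z * cnj (g z))"
proof -
  have [measurable]: "f \<in> borel_measurable circle_measure"
      "(\<lambda>z. cnj (g z)) \<in> borel_measurable circle_measure"
    using assms sq_integrable_cnj[of g] by (auto simp: sq_integrable_def)
  have *: "cmod a * cmod b \<le> (cmod a)\<^sup>2 + (cmod b)\<^sup>2" for a b :: complex
    using sum_squares_bound[of "cmod a" "cmod b"] zero_le_power2[of "cmod a"]
      zero_le_power2[of "cmod b"] mult_nonneg_nonneg[OF norm_ge_zero[of a] norm_ge_zero[of b]]
    by linarith
  have "integrable circle_measure (\<lambda>z. (cmod (f z))\<^sup>2 + (cmod (g z))\<^sup>2)"
    using assms by (auto simp: sq_integrable_def)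
  then show ?thesis
    by (rule Bochner_Integration.integrable_bound) (use * in \<open>auto simp: norm_mult\<close>)
qed

definition L2_rel :: "(complex \<Rightarrow> complex) \<Rightarrow> (complex \<Rightarrow> complex) \<Rightarrow> bool" where
  "L2_rel f g \<longleftrightarrow> sq_integrable f \<and> sq_integrable g \<and> (AE z in circle_measure. f z = g z)"

quotient_type L2 = "complex \<Rightarrow> complex" / partial: L2_rel
proof (rule part_equivpI)
  show "\<exists>f. L2_rel f f"
    by (rule exI[of _ "\<lambda>z. 0"]) (simp add: L2_rel_def sq_integrable_zero)
  show "symp L2_rel"
    by (auto simp: symp_def L2_rel_def elim: AE_mp)
  show "transp L2_rel"
    by (auto simp: transp_def L2_rel_def elim: AE_mp)
qed

text \<open>The class of a function on the circle; the junk value 0 is used for functions that are not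
  square integrable.\<close>

lift_definition to_L2 :: "(complex \<Rightarrow> complex) \<Rightarrow> L2" is
  "\<lambda>f. if sq_integrable f then f else (\<lambda>z. 0)"
  by (auto simp: L2_rel_def sq_integrable_zero)

lift_definition scaleC :: "complex \<Rightarrow> L2 \<Rightarrow> L2" (infixr \<open>*\<^sub>C\<close> 75) is "\<lambda>c f z. c * f z"
  by (auto simp: L2_rel_def sq_integrable_scale elim: AE_mp)

lift_definition conj_L2 :: "L2 \<Rightarrow> L2" is "\<lambda>f z. cnj (f z)"
  by (auto simp: L2_rel_def sq_integrable_cnj elim: AE_mp)

text \<open>Pointwise product, with junk value 0 when the product is not square integrable. It is only
  applied when one of the factors is essentially bounded.\<close>

lift_definition mult_L2 :: "L2 \<Rightarrow> L2 \<Rightarrow> L2" (infixl \<open>\<odot>\<close> 70) is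
  "\<lambda>f g. if sq_integrable (\<lambda>z. f z * g z) then (\<lambda>z. f z * g z) else (\<lambda>z. 0)"
proof -
  fix f f' g g' assume "L2_rel f f'" "L2_rel g g'"
  then have m: "f \<in> borel_measurable circle_measure" "f' \<in> borel_measurable circle_measure"
      "g \<in> borel_measurable circle_measure" "g' \<in> borel_measurable circle_measure"
    and ae: "AE z in circle_measure. f z * g z = f' z * g' z"
    by (auto simp: L2_rel_def sq_integrable_def elim: AE_mp)
  note [measurable] = m
  have "integrable circle_measure (\<lambda>z. (cmod (f z * g z))\<^sup>2) \<longleftrightarrow>
        integrable circle_measure (\<lambda>z. (cmod (f' z * g' z))\<^sup>2)"
    using ae by (intro integrable_cong_AE) (auto elim: AE_mp)
  then have "sq_integrable (\<lambda>z. f z * g z) \<longleftrightarrow> sq_integrable (\<lambda>z. f' z * g' z)"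
    by (simp add: sq_integrable_def)
  then show "L2_rel (if sq_integrable (\<lambda>z. f z * g z) then \<lambda>z. f z * g z else (\<lambda>z. 0))
                    (if sq_integrable (\<lambda>z. f' z * g' z) then \<lambda>z. f' z * g' z else (\<lambda>z. 0))"
    using ae by (auto simp: L2_rel_def sq_integrable_zero)
qed

lift_definition cinner_L2 :: "L2 \<Rightarrow> L2 \<Rightarrow> complex" is
  "\<lambda>f g. \<integral>z. f z * cnj (g z) \<partial>circle_measure"
proof -
  fix f f' g g' assume *: "L2_rel f f'" "L2_rel g g'"
  have "(\<lambda>z. f z * cnj (g z)) \<in> borel_measurable circle_measure"
       "(\<lambda>z. f' z * cnj (g' z)) \<in> borel_measurable circle_measure"
    using * by (auto simp: L2_rel_def intro!: borel_measurable_integrable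
        sq_integrable_mult_integrable)
  then show "(\<integral>z. f z * cnj (g z) \<partial>circle_measure) = (\<integral>z. f' z * cnj (g' z) \<partial>circle_measure)"
    using * by (intro integral_cong_AE) (auto simp: L2_rel_def elim: AE_mp)
qed

lift_definition unimodular_L2 :: "L2 \<Rightarrow> bool" is
  "\<lambda>f. AE z in circle_measure. cmod (f z) = 1"
  by (auto simp: L2_rel_def elim: AE_mp)

instantiation L2 :: real_vector
begin

lift_definition zero_L2 :: L2 is "\<lambda>z. 0"
  by (simp add: L2_rel_def sq_integrable_zero)

lift_definition plus_L2 :: "L2 \<Rightarrow> L2 \<Rightarrow> L2" is "\<lambda>f g z. f z + g z"
  by (auto simp: L2_rel_def sq_integrable_add elim: AE_mp)

definition scaleR_L2 :: "real \<Rightarrow> L2 \<Rightarrow> L2" where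
  "scaleR_L2 r f = complex_of_real r *\<^sub>C f"

definition uminus_L2 :: "L2 \<Rightarrow> L2" where
  "uminus_L2 f = (-1) *\<^sub>C f"

definition minus_L2 :: "L2 \<Rightarrow> L2 \<Rightarrow> L2" where
  "minus_L2 f g = f + (- g)" for f g :: L2

instance
proof
  fix x y z :: L2 and a b :: real
  show "x + y + z = x + (y + z)"
    by transfer (simp add: L2_rel_def sq_integrable_add add.assoc)
  show "x + y = y + x"
    by transfer (simp add: L2_rel_def sq_integrable_add add.commute)
  show "0 + x = x"
    by transfer (simp add: L2_rel_def)
  show "- x + x = 0"
    unfolding uminus_L2_def by transfer (simp add: L2_rel_def sq_integrable_zero)
  show "x - y = x + - y"
    by (simp add: minus_L2_def)
  show "a *\<^sub>R (x + y) = a *\<^sub>R x + a *\<^sub>R y"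
    unfolding scaleR_L2_def
    by transfer (simp add: L2_rel_def sq_integrable_add sq_integrable_scale distrib_left)
  show "(a + b) *\<^sub>R x = a *\<^sub>R x + b *\<^sub>R x"
    unfolding scaleR_L2_def
    by transfer (simp add: L2_rel_def sq_integrable_add sq_integrable_scale distrib_right)
  show "a *\<^sub>R b *\<^sub>R x = (a * b) *\<^sub>R x"
    unfolding scaleR_L2_def
    by transfer (simp add: L2_rel_def sq_integrable_scale mult.assoc)
  show "1 *\<^sub>R x = x"
    unfolding scaleR_L2_def by transfer (simp add: L2_rel_def)
qed

end

instantiation L2 :: real_inner
begin

definition inner_L2 :: "L2 \<Rightarrow> L2 \<Rightarrow> real" where
  "inner_L2 f g = Re (cinner_L2 f g)"

definition norm_L2 :: "L2 \<Rightarrow> real" where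
  "norm_L2 f = sqrt (inner f f)" for f :: L2

definition dist_L2 :: "L2 \<Rightarrow> L2 \<Rightarrow> real" where
  "dist_L2 f g = norm (f - g)" for f g :: L2

definition sgn_L2 :: "L2 \<Rightarrow> L2" where
  "sgn_L2 f = inverse (norm f) *\<^sub>R f" for f :: L2

definition uniformity_L2 :: "(L2 \<times> L2) filter" where
  "uniformity_L2 = (INF e\<in>{0<..}. principal {(x, y). dist x y < e})"

definition open_L2 :: "L2 set \<Rightarrow> bool" where
  "open_L2 U \<longleftrightarrow> (\<forall>x\<in>U. \<forall>\<^sub>F (x', y) in uniformity. x' = x \<longrightarrow> y \<in> U)" for U :: "L2 set"

instance
proof
  fix x y z :: L2 and r :: real
  show "dist x y = norm (x - y)" by (simp add: dist_L2_def)
  show "sgn x = x /\<^sub>R norm x" by (simp add: sgn_L2_def)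
  show "uniformity = (INF e\<in>{0<..}. principal {(x, y::L2). dist x y < e})"
    by (rule uniformity_L2_def)
  show "open U \<longleftrightarrow> (\<forall>x\<in>U. \<forall>\<^sub>F (x', y) in uniformity. x' = x \<longrightarrow> y \<in> U)" for U :: "L2 set"
    by (rule open_L2_def)
  show "inner x y = inner y x"
  proof -
    have "cinner_L2 y x = cnj (cinner_L2 x y)"
      by transfer (simp add: mult.commute flip: Bochner_Integration.integral_cnj)
    then show ?thesis by (simp add: inner_L2_def)
  qed
  show "inner (x + y) z = inner x z + inner y z"
  proof -
    have "cinner_L2 (x + y) z = cinner_L2 x z + cinner_L2 y z"
      by transfer
        (simp add: L2_rel_def distrib_right Bochner_Integration.integral_add
           sq_integrable_mult_integrable)
    then show ?thesis by (simp add: inner_L2_def)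
  qed
  show "inner (r *\<^sub>R x) y = r * inner x y"
  proof -
    have "cinner_L2 (r *\<^sub>R x) y = complex_of_real r * cinner_L2 x y"
      unfolding scaleR_L2_def by transfer (simp add: mult.assoc)
    then show ?thesis by (simp add: inner_L2_def)
  qed
  have sq: "f z * cnj (f z) = complex_of_real ((cmod (f z))\<^sup>2)" for f :: "complex \<Rightarrow> complex" and z
    by (simp only: complex_norm_square)
  have eq: "inner x x = (\<integral>z. (cmod (rep_L2 x z))\<^sup>2 \<partial>circle_measure)"
    unfolding inner_L2_def cinner_L2.rep_eq sq integral_complex_of_real by simp
  show "0 \<le> inner x x"
    unfolding eq by (rule integral_nonneg_AE) simp
  show "inner x x = 0 \<longleftrightarrow> x = 0"
  proof -
    have rel: "L2_rel (rep_L2 x) (rep_L2 x)"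
      using Quotient3_rep_reflp[OF Quotient3_L2] .
    have "inner x x = 0 \<longleftrightarrow> (AE z in circle_measure. (cmod (rep_L2 x z))\<^sup>2 = 0)"
      unfolding eq using rel
      by (intro integral_nonneg_eq_0_iff_AE) (auto simp: L2_rel_def sq_integrable_def)
    also have "\<dots> \<longleftrightarrow> L2_rel (rep_L2 x) (\<lambda>z. 0)"
      using rel by (simp add: L2_rel_def sq_integrable_zero)
    also have "\<dots> \<longleftrightarrow> x = 0"
      using Quotient3_rel[OF Quotient3_L2, of "rep_L2 x" "\<lambda>z. 0"] rel
      by (simp add: zero_L2.abs_eq Quotient3_abs_rep[OF Quotient3_L2] L2_rel_def sq_integrable_zero)
    finally show ?thesis .
  qed
  show "norm x = sqrt (inner x x)" by (rule norm_L2_def)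
qed

end

text \<open>Hardy spaces on the disc, identified with spaces of boundary functions. The boundary function
  of \<open>F\<close> is the limit in \<open>L\<^sup>2\<close> of the dilations \<open>z \<mapsto> F (r z)\<close> as \<open>r \<rightarrow> 1\<close>;
  for \<open>F\<close> in the Hardy space it agrees almost everywhere with the radial limit.\<close>

definition dilation :: "(complex \<Rightarrow> complex) \<Rightarrow> real \<Rightarrow> L2" where
  "dilation F r = to_L2 (\<lambda>z. F (complex_of_real r * z))"

definition has_boundary_values :: "(complex \<Rightarrow> complex) \<Rightarrow> L2 \<Rightarrow> bool" where
  "has_boundary_values F f \<longleftrightarrow> (dilation F \<longlongrightarrow> f) (at_left 1)"

definition H2 :: "L2 set" where
  "H2 = {f. \<exists>F. F holomorphic_on ball 0 1 \<and> (\<exists>C. \<forall>r\<in>{0..<1}. norm (dilation F r) \<le> C) \<and>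
            has_boundary_values F f}"

definition Hinf :: "L2 set" where
  "Hinf = {f. \<exists>F. F holomorphic_on ball 0 1 \<and> bounded (F ` ball 0 1) \<and>
              has_boundary_values F f}"

definition inner_function :: "L2 \<Rightarrow> bool" where
  "inner_function u \<longleftrightarrow> u \<in> Hinf \<and> unimodular_L2 u"

definition model_space :: "L2 \<Rightarrow> L2 set" where
  "model_space u = {f \<in> H2. \<forall>h\<in>H2. cinner_L2 f (u \<odot> h) = 0}"

text \<open>Well defined when \<open>S\<close> is a closed complex subspace.\<close>

definition orth_proj :: "L2 set \<Rightarrow> L2 \<Rightarrow> L2" where
  "orth_proj S f = (THE g. g \<in> S \<and> (\<forall>h\<in>S. cinner_L2 (f - g) h = 0))"

text \<open>Operators on a subspace \<open>S\<close> are functions on all of \<open>L\<^sup>2\<close> of which only the values on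
  \<open>S\<close> matter.\<close>

definition bounded_operator_on :: "L2 set \<Rightarrow> (L2 \<Rightarrow> L2) \<Rightarrow> bool" where
  "bounded_operator_on S A \<longleftrightarrow>
     (\<forall>f\<in>S. A f \<in> S) \<and>
     (\<forall>f\<in>S. \<forall>g\<in>S. A (f + g) = A f + A g) \<and>
     (\<forall>c. \<forall>f\<in>S. A (c *\<^sub>C f) = c *\<^sub>C A f) \<and>
     (\<exists>C. \<forall>f\<in>S. norm (A f) \<le> C * norm f)"

text \<open>\<open>A\<close> is the truncated Toeplitz operator with symbol \<open>\<phi>\<close>: the bounded extension of the
  densely defined map.\<close>

definition is_TTO :: "L2 \<Rightarrow> L2 \<Rightarrow> (L2 \<Rightarrow> L2) \<Rightarrow> bool" where
  "is_TTO u \<phi> A \<longleftrightarrow>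
     bounded_operator_on (model_space u) A \<and>
     (\<forall>f \<in> model_space u \<inter> Hinf. A f = orth_proj (model_space u) (\<phi> \<odot> f))"

definition TTO :: "L2 \<Rightarrow> (L2 \<Rightarrow> L2) set" where
  "TTO u = {A. \<exists>\<phi>. is_TTO u \<phi> A}"

definition circle_var :: L2 where
  "circle_var = to_L2 (\<lambda>z. z)"

definition compressed_shift :: "L2 \<Rightarrow> L2 \<Rightarrow> L2" where
  "compressed_shift u f = orth_proj (model_space u) (circle_var \<odot> f)"

definition model_conj :: "L2 \<Rightarrow> L2 \<Rightarrow> L2" where
  "model_conj u f = u \<odot> conj_L2 circle_var \<odot> conj_L2 f"

datatype ext_complex = Finite complex | Infinity

fun sedlock_class :: "L2 \<Rightarrow> ext_complex \<Rightarrow> (L2 \<Rightarrow> L2) set" where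
  "sedlock_class u (Finite \<alpha>) =
     {A \<in> TTO u. \<exists>\<phi>\<in>model_space u. \<exists>c.
        is_TTO u (\<phi> + \<alpha> *\<^sub>C conj_L2 (compressed_shift u (model_conj u \<phi>)) + to_L2 (\<lambda>_. c)) A}"
| "sedlock_class u Infinity = {A \<in> TTO u. \<exists>\<phi>\<in>H2. is_TTO u (conj_L2 \<phi>) A}"

end

theory Submission
  imports Defs
begin

text \<open>
  Write \<open>K\<close> for the model space, \<open>S\<close> for the compressed shift, \<open>C\<close> for the conjugation and \<open>k0\<close> for
  the reproducing kernel at the origin. By Sarason, a bounded operator \<open>T\<close> on \<open>K\<close> is a truncated
  Toeplitz operator iff \<open>T - S T S* = x \<otimes> k0 + k0 \<otimes> y\<close> with \<open>x, y \<in> K\<close>, and then \<open>x + conj y\<close> is a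
  symbol. Such operators satisfy \<open>C T C = T*\<close>, while a commutator \<open>T\<close> of two of them satisfies
  \<open>C T C = - T*\<close>; so a commutator in the class vanishes.

  If \<open>A\<close> and \<open>B\<close> have symbols \<open>x + conj y\<close> and \<open>v + conj w\<close>, then modulo \<open>K \<otimes> k0 + k0 \<otimes> K\<close>
  one computes \<open>AB - S AB S* = x \<otimes> w - Wy \<otimes> Wv\<close> with \<open>W = S C\<close>, which acts on the orthogonal
  complement of \<open>k0\<close> as an antiunitary involution. Hence \<open>A\<close> and \<open>B\<close> commute iff
  \<open>x \<cdot> Ww = v \<cdot> Wy\<close> in the symmetric square of \<open>K / k0\<close>. Unique factorisation into linear factors
  leaves the Sedlock classes (\<open>Wy = \<alpha> x\<close> and \<open>Ww = \<alpha> v\<close>, or \<open>x = v = 0\<close>) and linear dependence.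
\<close>

section \<open>Square integrable functions on the circle\<close>

text \<open>The delicate point is that symbols are merely square integrable, so a symbol times an
  element of the model space need not be square integrable. Products are therefore formed with an
  essentially bounded factor, on a dense set of bounded functions, and once the criterion for
  symbols is available only the pairs \<open>(x, y)\<close> are used. The Hardy spaces are given by
  dilations while the arguments need Fourier coefficients; hence the initial identification of
  \<open>H2\<close> with the functions without negative frequencies.

  Multiples of \<open>k0\<close> can be moved between \<open>x\<close> and \<open>y\<close>. Testing
  displacements on the complement of \<open>k0\<close> removes this ambiguity, and nothing is lost,
  since what that test does not see has again the form
  \<open>x \<otimes> k0 + k0 \<otimes> y\<close>.

  The displacement of a commutator is linear in one test vector and antilinear in the other.
  Substituting \<open>W h\<close> for \<open>h\<close> makes it antilinear in both, and the tensors
  become symmetric; this is why an antilinear \<open>W\<close> appears. The same \<open>W\<close>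
  enters the symbols of the Sedlock classes, so proportional factors in the symmetric square are
  exactly membership in a common class.\<close>

notation cinner_L2 (\<open>\<langle>_, _\<rangle>\<close>)

section \<open>Normalised arc length on the circle\<close>

lemma space_circle_measure [simp]: "space circle_measure = sphere 0 1"
  by (simp add: circle_measure_def space_restrict_space)

lemma sets_circle_measure: "sets circle_measure = sets (restrict_space borel (sphere 0 1))"
  by (simp add: circle_measure_def)

lemma cis_measurable_circle:
  "cis \<in> uniform_measure lborel {0..2*pi} \<rightarrow>\<^sub>M restrict_space borel (sphere 0 1)"
proof (rule measurable_restrict_space2)
  have "cis \<in> borel_measurable borel"
    by (intro borel_measurable_continuous_onI continuous_intros)
  then show "cis \<in> borel_measurable (uniform_measure lborel {0..2*pi})"
    by (simp add: uniform_measure_def)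
qed simp

lemma borel_measurable_circle:
  "f \<in> borel_measurable borel \<Longrightarrow> f \<in> borel_measurable circle_measure"
  unfolding measurable_cong_sets[OF sets_circle_measure refl] by (rule measurable_restrict_space1)

lemma AE_circle_norm: "AE z in circle_measure. cmod z = 1"
  by (rule AE_I2) simp

lemma emeasure_circle_space: "emeasure circle_measure (sphere 0 1) = 1"
proof -
  have "emeasure circle_measure (sphere 0 1) =
      emeasure (uniform_measure lborel {0..2*pi}) (cis -` sphere 0 1 \<inter> UNIV)"
    unfolding circle_measure_def
    by (subst emeasure_distr[OF cis_measurable_circle])
       (auto simp: sets_restrict_space space_restrict_space)
  also have "cis -` sphere 0 1 \<inter> UNIV = UNIV" by auto
  also have "emeasure (uniform_measure lborel {0..2*pi}) UNIV = 1"
    by (subst emeasure_uniform_measure) (auto simp: ennreal_divide_self)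
  finally show ?thesis .
qed

interpretation circle: finite_measure circle_measure
  by standard (simp add: emeasure_circle_space)

lemma measure_circle_space [simp]: "measure circle_measure (sphere 0 1) = 1"
  by (simp add: measure_def emeasure_circle_space)

lemma circle_integral_eq:
  fixes f :: "complex \<Rightarrow> complex"
  assumes [measurable]: "f \<in> borel_measurable circle_measure"
  shows "(\<integral>z. f z \<partial>circle_measure) = (LINT t:{0..2*pi}|lborel. f (cis t)) /\<^sub>R (2*pi)"
proof -
  have m: "f \<in> borel_measurable (restrict_space borel (sphere 0 1))"
    using assms unfolding measurable_cong_sets[OF sets_circle_measure refl] .
  have m': "(\<lambda>t. f (cis t)) \<in> borel_measurable lborel"
    using measurable_compose[OF cis_measurable_circle m] by simp
  have eq: "uniform_measure lborel {0..2*pi} =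
      density lborel (\<lambda>t. ennreal (indicator {0..2*pi} t / (2*pi)))"
    unfolding uniform_measure_def
    by (intro density_cong) (auto simp: indicator_def divide_ennreal simp flip: ennreal_1)
  have "(\<integral>z. f z \<partial>circle_measure) = (\<integral>t. f (cis t) \<partial>uniform_measure lborel {0..2*pi})"
    unfolding circle_measure_def by (rule integral_distr[OF cis_measurable_circle m])
  also have "\<dots> = (\<integral>t. (indicator {0..2*pi} t / (2*pi)) *\<^sub>R f (cis t) \<partial>lborel)"
    unfolding eq by (intro integral_density m') auto
  also have "\<dots> = (\<integral>t. (1/(2*pi)) *\<^sub>R (indicator {0..2*pi} t *\<^sub>R f (cis t)) \<partial>lborel)"
    by (intro Bochner_Integration.integral_cong) auto
  also have "\<dots> = (LINT t:{0..2*pi}|lborel. f (cis t)) /\<^sub>R (2*pi)"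
    unfolding set_lebesgue_integral_def
    by (simp only: Bochner_Integration.integral_scaleR_right inverse_eq_divide)
  finally show ?thesis .
qed

lemma sphere_power_int: "cmod z = 1 \<Longrightarrow> cnj (z powi n) = z powi (-n)"
  by (metis complex_cnj_power_int divide_conv_cnj mult_1 power_int_inverse power_int_minus
      inverse_eq_divide)

lemma borel_measurable_power_int: "(\<lambda>z. z powi n) \<in> borel_measurable circle_measure"
proof (rule borel_measurable_circle, cases "n \<ge> 0")
  case True
  then show "(\<lambda>z::complex. z powi n) \<in> borel_measurable borel"
    by (simp add: power_int_def)
next
  case False
  then show "(\<lambda>z::complex. z powi n) \<in> borel_measurable borel"
    by (simp add: power_int_def)
qed

text \<open>For \<open>n \<noteq> 0\<close> the primitive \<open>cis (n t) / (i n)\<close> takes the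
  same value at both ends of the period.\<close>

lemma circle_integral_power_int:
  "(\<integral>z. z powi n \<partial>circle_measure) = (if n = 0 then 1 else 0)"
proof (cases "n = 0")
  case True
  then show ?thesis by simp
next
  case False
  let ?F = "\<lambda>t. cis (of_int n * t) / (\<i> * of_int n)"
  have "(\<integral>z. z powi n \<partial>circle_measure) = (LINT t:{0..2*pi}|lborel. cis t powi n) /\<^sub>R (2*pi)"
    by (rule circle_integral_eq) (rule borel_measurable_power_int)
  also have "(LINT t:{0..2*pi}|lborel. cis t powi n) = (LINT t:{0..2*pi}|lborel. cis (of_int n * t))"
    by (simp add: cis_power_int mult.commute)
  also have "\<dots> = ?F (2*pi) - ?F 0"
    unfolding set_lebesgue_integral_def
  proof (rule integral_FTC_Icc)
    fix t :: real
    have "((\<lambda>z. exp (\<i> * of_int n * z) / (\<i> * of_int n)) has_field_derivative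
        exp (\<i> * of_int n * of_real t)) (at (of_real t))"
      using False by (auto intro!: derivative_eq_intros simp: field_simps)
    from has_vector_derivative_real_field[OF this] show "(?F has_vector_derivative cis (of_int n * t)) (at t within {0..2*pi})"
      by (simp add: cis_conv_exp mult.assoc)
  qed (auto intro!: continuous_intros)
  also have "\<dots> = 0"
  proof -
    have "cis (of_int n * (2*pi)) = 1"
      using cis_multiple_2pi[of "of_int n"] by (simp add: mult_ac)
    then show ?thesis by simp
  qed
  finally show ?thesis using False by simp
qed

section \<open>Calculus with representatives almost everywhere\<close>

lemma sq_integrable_rep [simp]: "sq_integrable (rep_L2 x)"
  using Quotient3_rep_reflp[OF Quotient3_L2, of x] by (simp add: L2_rel_def)

lemma measurable_rep [measurable, simp]: "rep_L2 x \<in> borel_measurable circle_measure"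
  using sq_integrable_rep[of x] by (simp add: sq_integrable_def)

lemma to_L2_rep [simp]: "to_L2 (rep_L2 x) = x"
  by (simp add: to_L2_def Quotient3_abs_rep[OF Quotient3_L2])

lemma rep_to_L2:
  assumes "sq_integrable f"
  shows "AE z in circle_measure. rep_L2 (to_L2 f) z = f z"
proof -
  have "L2_rel f f" using assms by (simp add: L2_rel_def)
  then have "L2_rel (rep_L2 (to_L2 f)) f"
    using rep_abs_rsp_left[OF Quotient3_L2, of f f] assms by (simp add: to_L2_def)
  then show ?thesis by (simp add: L2_rel_def)
qed

text \<open>Together with the \<open>rep_\<close> rules this reduces an algebraic identity between
  classes to a pointwise computation almost everywhere.\<close>

lemma L2_eqI:
  assumes "AE z in circle_measure. rep_L2 x z = rep_L2 y z" shows "x = y"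
proof -
  have "L2_rel (rep_L2 x) (rep_L2 y)" using assms by (simp add: L2_rel_def)
  then show ?thesis using Quotient3_rel_rep[OF Quotient3_L2] by blast
qed

lemma rep_add: "AE z in circle_measure. rep_L2 (x + y) z = rep_L2 x z + rep_L2 y z"
proof -
  have "x + y = to_L2 (\<lambda>z. rep_L2 x z + rep_L2 y z)"
    by (simp add: plus_L2_def to_L2_def sq_integrable_add)
  then show ?thesis using rep_to_L2 sq_integrable_add by simp
qed

lemma rep_scale: "AE z in circle_measure. rep_L2 (c *\<^sub>C x) z = c * rep_L2 x z"
proof -
  have "c *\<^sub>C x = to_L2 (\<lambda>z. c * rep_L2 x z)"
    by (simp add: scaleC_def to_L2_def sq_integrable_scale)
  then show ?thesis using rep_to_L2 sq_integrable_scale by simp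
qed

lemma rep_conj: "AE z in circle_measure. rep_L2 (conj_L2 x) z = cnj (rep_L2 x z)"
proof -
  have "conj_L2 x = to_L2 (\<lambda>z. cnj (rep_L2 x z))"
    by (simp add: conj_L2_def to_L2_def sq_integrable_cnj)
  then show ?thesis using rep_to_L2 sq_integrable_cnj by simp
qed

lemma uminus_L2: "- x = (-1) *\<^sub>C x" for x :: L2
  by (rule uminus_L2_def)

lemma rep_diff: "AE z in circle_measure. rep_L2 (x - y) z = rep_L2 x z - rep_L2 y z"
  using rep_add[of x "-y"] rep_scale[of "-1" y]
  unfolding diff_conv_add_uminus[of x y] uminus_L2 by eventually_elim simp

lemma rep_zero: "AE z in circle_measure. rep_L2 0 z = 0"
proof -
  have "(0::L2) = to_L2 (\<lambda>z. 0)" by (simp add: zero_L2_def to_L2_def)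
  then show ?thesis using rep_to_L2[OF sq_integrable_zero] by simp
qed

lemma cinner_rep: "\<langle>x, y\<rangle> = (\<integral>z. rep_L2 x z * cnj (rep_L2 y z) \<partial>circle_measure)"
  by (simp add: cinner_L2.rep_eq)

lemma measurable_cnj_rep [measurable, simp]:
  "(\<lambda>z. cnj (rep_L2 x z)) \<in> borel_measurable circle_measure"
  using sq_integrable_cnj[OF sq_integrable_rep[of x]] by (simp add: sq_integrable_def)

subsection \<open>Complex inner product\<close>

lemma cinner_add_left: "\<langle>x + y, z\<rangle> = \<langle>x, z\<rangle> + \<langle>y, z\<rangle>"
  by transfer (simp add: L2_rel_def distrib_right Bochner_Integration.integral_add
        sq_integrable_mult_integrable)

lemma cinner_scale_left: "\<langle>c *\<^sub>C x, y\<rangle> = c * \<langle>x, y\<rangle>"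
  by transfer (simp add: mult.assoc)

lemma cinner_commute: "cnj \<langle>x, y\<rangle> = \<langle>y, x\<rangle>"
  by transfer (simp add: mult.commute flip: Bochner_Integration.integral_cnj)

lemma cinner_add_right: "\<langle>x, y + z\<rangle> = \<langle>x, y\<rangle> + \<langle>x, z\<rangle>"
  by (metis cinner_commute cinner_add_left complex_cnj_add)

lemma cinner_scale_right: "\<langle>x, c *\<^sub>C y\<rangle> = cnj c * \<langle>x, y\<rangle>"
  by (metis cinner_commute cinner_scale_left complex_cnj_mult)

lemma cinner_minus_left: "\<langle>- x, y\<rangle> = - \<langle>x, y\<rangle>"
  by (simp add: uminus_L2 cinner_scale_left)

lemma cinner_minus_right: "\<langle>x, - y\<rangle> = - \<langle>x, y\<rangle>"
  by (simp add: uminus_L2 cinner_scale_right)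

lemma cinner_diff_left: "\<langle>x - y, z\<rangle> = \<langle>x, z\<rangle> - \<langle>y, z\<rangle>"
  by (simp only: diff_conv_add_uminus cinner_add_left cinner_minus_left)

lemma cinner_diff_right: "\<langle>x, y - z\<rangle> = \<langle>x, y\<rangle> - \<langle>x, z\<rangle>"
  by (simp only: diff_conv_add_uminus cinner_add_right cinner_minus_right)

lemma cinner_zero_left [simp]: "\<langle>0, x\<rangle> = 0"
  using cinner_diff_left[of 0 0 x] by simp

lemma cinner_zero_right [simp]: "\<langle>x, 0\<rangle> = 0"
  using cinner_diff_right[of x 0 0] by simp

lemmas cinner_simps = cinner_add_left cinner_add_right cinner_scale_left cinner_scale_right
  cinner_minus_left cinner_minus_right cinner_diff_left cinner_diff_right

lemma cinner_sum_left: "\<langle>\<Sum>i\<in>I. f i, y\<rangle> = (\<Sum>i\<in>I. \<langle>f i, y\<rangle>)"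
  by (induction I rule: infinite_finite_induct) (auto simp: cinner_add_left)

lemma cinner_same: "\<langle>x, x\<rangle> = of_real ((norm x)\<^sup>2)"
proof -
  have "Im \<langle>x, x\<rangle> = 0"
    using arg_cong[OF cinner_commute[of x x], of Im] by simp
  moreover have "Re \<langle>x, x\<rangle> = (norm x)\<^sup>2"
    by (simp add: power2_norm_eq_inner inner_L2_def)
  ultimately show ?thesis by (simp add: complex_eq_iff)
qed

lemma cinner_eq_zero_iff: "\<langle>x, x\<rangle> = 0 \<longleftrightarrow> x = 0"
  by (simp add: cinner_same)

lemma scaleC_algebra:
  shows scaleC_add_right: "c *\<^sub>C (x + y) = c *\<^sub>C x + c *\<^sub>C y"
    and scaleC_add_left: "(c + d) *\<^sub>C x = c *\<^sub>C x + d *\<^sub>C x"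
    and scaleC_scaleC: "c *\<^sub>C d *\<^sub>C x = (c * d) *\<^sub>C x"
    and scaleC_one [simp]: "1 *\<^sub>C x = x"
  by (transfer, simp add: L2_rel_def sq_integrable_add sq_integrable_scale algebra_simps)+

lemma scaleC_zero_left [simp]: "0 *\<^sub>C x = 0"
  using scaleC_add_left[of 0 0 x] by simp

lemma scaleC_zero_right [simp]: "c *\<^sub>C 0 = 0"
  using scaleC_add_right[of c 0 0] by simp

lemma scaleC_minus_left: "(- c) *\<^sub>C x = - (c *\<^sub>C x)"
  using scaleC_add_left[of c "-c" x] by (simp add: eq_neg_iff_add_eq_0 add.commute)

lemma scaleC_minus_right: "c *\<^sub>C (- x) = - (c *\<^sub>C x)"
  using scaleC_add_right[of c x "-x"] by (simp add: eq_neg_iff_add_eq_0 add.commute)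

lemma scaleC_diff_right: "c *\<^sub>C (x - y) = c *\<^sub>C x - c *\<^sub>C y"
  using scaleC_add_right[of c x "-y"] by (simp add: scaleC_minus_right)

lemma scaleC_diff_left: "(c - d) *\<^sub>C x = c *\<^sub>C x - d *\<^sub>C x"
  using scaleC_add_left[of c "-d" x] by (simp add: scaleC_minus_left)

lemmas scaleC_simps = scaleC_add_right scaleC_add_left scaleC_scaleC scaleC_minus_left
  scaleC_minus_right scaleC_diff_right scaleC_diff_left

lemma norm_scaleC: "norm (c *\<^sub>C x) = cmod c * norm x"
proof -
  have "complex_of_real ((norm (c *\<^sub>C x))\<^sup>2) = of_real ((cmod c * norm x)\<^sup>2)"
    unfolding cinner_same[symmetric] cinner_simps
    using complex_norm_square[of c] by (simp add: cinner_same power_mult_distrib mult.commute)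
  then show ?thesis
    by (metis abs_of_nonneg mult_nonneg_nonneg norm_ge_zero of_real_eq_iff power2_eq_iff_nonneg)
qed

text \<open>The real inner product is only the real part of the complex one. Rotating
  \<open>x\<close> by a unimodular constant makes the complex product real and non-negative, and the
  real inequality applies.\<close>

lemma cinner_Cauchy_Schwarz: "cmod \<langle>x, y\<rangle> \<le> norm x * norm y"
proof (cases "\<langle>x, y\<rangle> = 0")
  case False
  define c where "c = cnj (sgn \<langle>x, y\<rangle>)"
  have "c * \<langle>x, y\<rangle> = of_real (cmod \<langle>x, y\<rangle>)"
    using False unfolding c_def
    by (simp add: sgn_eq complex_norm_square[symmetric] mult.commute[of _ "\<langle>x, y\<rangle>"] power2_eq_square)
  then have "cmod \<langle>x, y\<rangle> = inner (c *\<^sub>C x) y"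
    by (simp add: inner_L2_def cinner_scale_left)
  also have "\<dots> \<le> norm (c *\<^sub>C x) * norm y"
    by (rule norm_cauchy_schwarz)
  also have "\<dots> = norm x * norm y"
    using False by (simp add: norm_scaleC c_def norm_sgn)
  finally show ?thesis .
qed simp

lemma bounded_bilinear_cinner: "bounded_bilinear (\<lambda>x y. \<langle>x, y\<rangle>)"
proof
  show "\<exists>K. \<forall>a b. norm \<langle>a, b\<rangle> \<le> norm a * norm b * K"
    by (rule exI[of _ 1]) (simp add: cinner_Cauchy_Schwarz)
qed (simp_all add: cinner_simps scaleR_L2_def scaleR_conv_of_real)

lemmas tendsto_cinner = bounded_bilinear.tendsto[OF bounded_bilinear_cinner]

lemma tendsto_scaleC:
  assumes "(f \<longlongrightarrow> a) F" shows "((\<lambda>t. c *\<^sub>C f t) \<longlongrightarrow> c *\<^sub>C a) F"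
proof -
  have "bounded_linear (\<lambda>x. c *\<^sub>C x)"
    by (rule bounded_linear_intro[of _ "cmod c"])
       (simp_all add: scaleC_simps scaleR_L2_def norm_scaleC mult.commute)
  from bounded_linear.tendsto[OF this assms] show ?thesis .
qed

lemma norm_square_add_orthogonal:
  assumes "\<langle>x, y\<rangle> = 0" shows "(norm (x + y))\<^sup>2 = (norm x)\<^sup>2 + (norm y)\<^sup>2"
proof -
  have "inner x y = 0" using assms by (simp add: inner_L2_def)
  then show ?thesis
    by (simp add: power2_norm_eq_inner inner_add_left inner_add_right inner_commute)
qed

subsection \<open>Products with essentially bounded functions\<close>

text \<open>The side condition under which \<open>mult_L2\<close> is the true product and not its
  default value 0; multiplication by such an element is a bounded operator.\<close>

definition bounded_L2 :: "L2 \<Rightarrow> bool" where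
  "bounded_L2 x \<longleftrightarrow> (\<exists>M. AE z in circle_measure. cmod (rep_L2 x z) \<le> M)"

lemma sq_integrable_bounded_mult:
  assumes "f \<in> borel_measurable circle_measure" "AE z in circle_measure. cmod (f z) \<le> M"
    and g: "sq_integrable g"
  shows "sq_integrable (\<lambda>z. f z * g z)"
proof -
  note [measurable] = assms(1)
  have [measurable]: "g \<in> borel_measurable circle_measure"
    using g by (simp add: sq_integrable_def)
  have "integrable circle_measure (\<lambda>z. M\<^sup>2 * (cmod (g z))\<^sup>2)"
    using g by (simp add: sq_integrable_def)
  then have "integrable circle_measure (\<lambda>z. (cmod (f z * g z))\<^sup>2)"
  proof (rule Bochner_Integration.integrable_bound)
    show "AE z in circle_measure. norm ((cmod (f z * g z))\<^sup>2) \<le> norm (M\<^sup>2 * (cmod (g z))\<^sup>2)"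
      using assms(2)
    proof eventually_elim
      fix z assume "cmod (f z) \<le> M"
      then have "(cmod (f z))\<^sup>2 \<le> M\<^sup>2" by (intro power_mono) auto
      then show "norm ((cmod (f z * g z))\<^sup>2) \<le> norm (M\<^sup>2 * (cmod (g z))\<^sup>2)"
        by (simp add: norm_mult power_mult_distrib mult_right_mono)
    qed
  qed measurable
  then show ?thesis by (simp add: sq_integrable_def)
qed

lemma sq_integrable_bounded:
  assumes "f \<in> borel_measurable circle_measure" "AE z in circle_measure. cmod (f z) \<le> M"
  shows "sq_integrable f"
proof -
  have "sq_integrable (\<lambda>z. 1)" by (simp add: sq_integrable_def)
  from sq_integrable_bounded_mult[OF assms this] show ?thesis by simp
qed

lemma mult_rep: "x \<odot> y = (if sq_integrable (\<lambda>z. rep_L2 x z * rep_L2 y z)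
    then to_L2 (\<lambda>z. rep_L2 x z * rep_L2 y z) else 0)"
  by (simp add: mult_L2_def to_L2_def zero_L2_def)

lemma mult_commute: "x \<odot> y = y \<odot> x"
  unfolding mult_rep by (simp add: mult.commute)

lemma rep_mult:
  assumes "bounded_L2 x \<or> bounded_L2 y"
  shows "AE z in circle_measure. rep_L2 (x \<odot> y) z = rep_L2 x z * rep_L2 y z"
proof -
  have *: "sq_integrable (\<lambda>z. rep_L2 x z * rep_L2 y z)" if "bounded_L2 x" for x y
    using that sq_integrable_bounded_mult[OF measurable_rep _ sq_integrable_rep]
    unfolding bounded_L2_def by blast
  have "sq_integrable (\<lambda>z. rep_L2 x z * rep_L2 y z)"
    using assms *[of x y] *[of y x] by (auto simp: mult.commute)
  then show ?thesis unfolding mult_rep using rep_to_L2 by simp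
qed

lemma bounded_L2_mult:
  assumes "bounded_L2 x" "bounded_L2 y" shows "bounded_L2 (x \<odot> y)"
proof -
  obtain M N where "AE z in circle_measure. cmod (rep_L2 x z) \<le> M"
    "AE z in circle_measure. cmod (rep_L2 y z) \<le> N"
    using assms unfolding bounded_L2_def by blast
  then have "AE z in circle_measure. cmod (rep_L2 (x \<odot> y) z) \<le> M * N"
    using rep_mult[OF disjI1[OF assms(1)], of y]
  proof eventually_elim
    case (elim z)
    then show ?case
      using mult_mono[of "cmod (rep_L2 x z)" M "cmod (rep_L2 y z)" N]
        norm_ge_zero[of "rep_L2 x z"] norm_ge_zero[of "rep_L2 y z"]
      by (simp add: norm_mult)
  qed
  then show ?thesis unfolding bounded_L2_def by blast
qed

lemma bounded_L2_add:
  assumes "bounded_L2 x" "bounded_L2 y" shows "bounded_L2 (x + y)"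
proof -
  obtain M N where "AE z in circle_measure. cmod (rep_L2 x z) \<le> M"
    "AE z in circle_measure. cmod (rep_L2 y z) \<le> N"
    using assms unfolding bounded_L2_def by blast
  then have "AE z in circle_measure. cmod (rep_L2 (x + y) z) \<le> M + N"
    using rep_add[of x y] by eventually_elim (simp add: norm_triangle_le)
  then show ?thesis unfolding bounded_L2_def by blast
qed

lemma bounded_L2_scale:
  assumes "bounded_L2 x" shows "bounded_L2 (c *\<^sub>C x)"
proof -
  obtain M where "AE z in circle_measure. cmod (rep_L2 x z) \<le> M"
    using assms unfolding bounded_L2_def by blast
  then have "AE z in circle_measure. cmod (rep_L2 (c *\<^sub>C x) z) \<le> cmod c * M"
    using rep_scale[of c x] by eventually_elim (simp add: norm_mult mult_left_mono)
  then show ?thesis unfolding bounded_L2_def by blast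
qed

lemma bounded_L2_minus: "bounded_L2 x \<Longrightarrow> bounded_L2 (- x)"
  by (simp add: uminus_L2 bounded_L2_scale)

lemma bounded_L2_diff: "bounded_L2 x \<Longrightarrow> bounded_L2 y \<Longrightarrow> bounded_L2 (x - y)"
  using bounded_L2_add[of x "- y"] by (simp add: bounded_L2_minus)

lemma bounded_L2_conj:
  assumes "bounded_L2 x" shows "bounded_L2 (conj_L2 x)"
proof -
  obtain M where "AE z in circle_measure. cmod (rep_L2 x z) \<le> M"
    using assms unfolding bounded_L2_def by blast
  then have "AE z in circle_measure. cmod (rep_L2 (conj_L2 x) z) \<le> M"
    using rep_conj[of x] by eventually_elim simp
  then show ?thesis unfolding bounded_L2_def by blast
qed

lemma bounded_L2_zero: "bounded_L2 0"
proof -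
  have "AE z in circle_measure. cmod (rep_L2 0 z) \<le> 0"
    using rep_zero by eventually_elim simp
  then show ?thesis unfolding bounded_L2_def by blast
qed

lemma bounded_L2_sum: "(\<And>i. i \<in> I \<Longrightarrow> bounded_L2 (f i)) \<Longrightarrow> bounded_L2 (\<Sum>i\<in>I. f i)"
  by (induction I rule: infinite_finite_induct) (auto simp: bounded_L2_add bounded_L2_zero)

lemmas bounded_L2_intros = bounded_L2_mult bounded_L2_add bounded_L2_scale bounded_L2_minus
  bounded_L2_diff bounded_L2_conj bounded_L2_zero bounded_L2_sum

lemma mult_add_right:
  assumes "bounded_L2 x \<or> (bounded_L2 y \<and> bounded_L2 z)"
  shows "x \<odot> (y + z) = x \<odot> y + x \<odot> z"
proof -
  have "bounded_L2 x \<or> bounded_L2 (y + z)" "bounded_L2 x \<or> bounded_L2 y"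
    "bounded_L2 x \<or> bounded_L2 z"
    using assms bounded_L2_add by blast+
  note this[THEN rep_mult]
  then show ?thesis
    using rep_add[of y z] rep_add[of "x \<odot> y" "x \<odot> z"]
    by (intro L2_eqI, eventually_elim) (simp add: algebra_simps)
qed

lemma mult_add_left:
  assumes "bounded_L2 x \<or> (bounded_L2 y \<and> bounded_L2 z)"
  shows "(y + z) \<odot> x = y \<odot> x + z \<odot> x"
  using mult_add_right[OF assms] by (simp add: mult_commute)

lemma mult_scale_right:
  assumes "bounded_L2 x \<or> bounded_L2 y"
  shows "x \<odot> (c *\<^sub>C y) = c *\<^sub>C (x \<odot> y)"
proof -
  have "bounded_L2 x \<or> bounded_L2 (c *\<^sub>C y)"
    using assms bounded_L2_scale by blast
  then have "AE z in circle_measure. rep_L2 (x \<odot> (c *\<^sub>C y)) z = rep_L2 x z * rep_L2 (c *\<^sub>C y) z"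
    by (rule rep_mult)
  then show ?thesis
    using rep_mult[OF assms] rep_scale[of c "x \<odot> y"] rep_scale[of c y]
    by (intro L2_eqI, eventually_elim) simp
qed

lemma mult_scale_left:
  assumes "bounded_L2 x \<or> bounded_L2 y"
  shows "(c *\<^sub>C y) \<odot> x = c *\<^sub>C (y \<odot> x)"
  using mult_scale_right[OF assms] by (simp add: mult_commute)

lemma mult_diff_right:
  assumes "bounded_L2 x \<or> (bounded_L2 y \<and> bounded_L2 z)"
  shows "x \<odot> (y - z) = x \<odot> y - x \<odot> z"
proof -
  have "x \<odot> (- z) = - (x \<odot> z)"
    using assms unfolding uminus_L2 by (intro mult_scale_right) blast
  moreover have "x \<odot> (y + - z) = x \<odot> y + x \<odot> (- z)"
    using assms bounded_L2_minus by (intro mult_add_right) blast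
  ultimately show ?thesis by simp
qed

lemma mult_diff_left:
  assumes "bounded_L2 x \<or> (bounded_L2 y \<and> bounded_L2 z)"
  shows "(y - z) \<odot> x = y \<odot> x - z \<odot> x"
  using mult_diff_right[OF assms] by (simp add: mult_commute)

text \<open>Two bounded factors guarantee that both intermediate products are genuine. With only
  one, an inner product of two unbounded factors could collapse to 0 on one side.\<close>

lemma mult_assoc:
  assumes "bounded_L2 x \<and> bounded_L2 y \<or> bounded_L2 y \<and> bounded_L2 z \<or> bounded_L2 x \<and> bounded_L2 z"
  shows "(x \<odot> y) \<odot> z = x \<odot> (y \<odot> z)"
proof -
  have "bounded_L2 x \<or> bounded_L2 y" "bounded_L2 y \<or> bounded_L2 z"
    "bounded_L2 (x \<odot> y) \<or> bounded_L2 z" "bounded_L2 x \<or> bounded_L2 (y \<odot> z)"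
    using assms bounded_L2_mult by blast+
  note this[THEN rep_mult]
  then show ?thesis
    by (intro L2_eqI, eventually_elim) (simp add: algebra_simps)
qed

section \<open>Pointwise conjugation and estimates for products\<close>

lemma conj_conj [simp]: "conj_L2 (conj_L2 x) = x"
  using rep_conj[of x] rep_conj[of "conj_L2 x"] by (intro L2_eqI, eventually_elim) simp

lemma conj_add: "conj_L2 (x + y) = conj_L2 x + conj_L2 y"
  using rep_conj[of x] rep_conj[of y] rep_conj[of "x + y"] rep_add[of x y]
    rep_add[of "conj_L2 x" "conj_L2 y"] by (intro L2_eqI, eventually_elim) simp

lemma conj_scale: "conj_L2 (c *\<^sub>C x) = cnj c *\<^sub>C conj_L2 x"
  using rep_conj[of x] rep_conj[of "c *\<^sub>C x"] rep_scale[of c x]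
    rep_scale[of "cnj c" "conj_L2 x"] by (intro L2_eqI, eventually_elim) simp

lemma conj_minus: "conj_L2 (- x) = - conj_L2 x"
  by (simp add: uminus_L2 conj_scale)

lemma conj_diff: "conj_L2 (x - y) = conj_L2 x - conj_L2 y"
  using conj_add[of x "- y"] by (simp add: conj_minus)

lemma conj_zero [simp]: "conj_L2 0 = 0"
  using conj_diff[of 0 0] by simp

lemma conj_mult:
  assumes "bounded_L2 x \<or> bounded_L2 y"
  shows "conj_L2 (x \<odot> y) = conj_L2 x \<odot> conj_L2 y"
proof -
  have "bounded_L2 (conj_L2 x) \<or> bounded_L2 (conj_L2 y)"
    using assms bounded_L2_conj by blast
  from rep_mult[OF this] show ?thesis
    using rep_conj[of x] rep_conj[of y] rep_conj[of "x \<odot> y"] rep_mult[OF assms]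
    by (intro L2_eqI, eventually_elim) simp
qed

lemma cinner_conj_conj: "\<langle>conj_L2 x, conj_L2 y\<rangle> = \<langle>y, x\<rangle>"
proof -
  have "AE z in circle_measure. rep_L2 (conj_L2 x) z * cnj (rep_L2 (conj_L2 y) z) =
      rep_L2 y z * cnj (rep_L2 x z)"
    using rep_conj[of x] rep_conj[of y] by eventually_elim simp
  then show ?thesis unfolding cinner_rep by (intro integral_cong_AE) measurable
qed

lemma norm_conj [simp]: "norm (conj_L2 x) = norm x"
  by (simp add: norm_eq_sqrt_inner inner_L2_def cinner_conj_conj)

lemma cinner_mult_left:
  assumes "bounded_L2 x \<or> bounded_L2 y" "bounded_L2 x \<or> bounded_L2 z"
  shows "\<langle>x \<odot> y, z\<rangle> = \<langle>y, conj_L2 x \<odot> z\<rangle>"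
proof -
  have b: "bounded_L2 (conj_L2 x) \<or> bounded_L2 z"
    using assms bounded_L2_conj by blast
  have "AE w in circle_measure. rep_L2 (x \<odot> y) w * cnj (rep_L2 z w) =
      rep_L2 y w * cnj (rep_L2 (conj_L2 x \<odot> z) w)"
    using rep_conj[of x] rep_mult[OF assms(1)] rep_mult[OF b] by eventually_elim simp
  then show ?thesis unfolding cinner_rep by (intro integral_cong_AE) measurable
qed

lemma norm_square_integral: "(norm x)\<^sup>2 = (\<integral>z. (cmod (rep_L2 x z))\<^sup>2 \<partial>circle_measure)"
proof -
  have "complex_of_real ((norm x)\<^sup>2) = (\<integral>z. complex_of_real ((cmod (rep_L2 x z))\<^sup>2) \<partial>circle_measure)"
    unfolding cinner_same[symmetric] cinner_rep by (simp only: complex_norm_square)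
  then show ?thesis by (simp only: integral_complex_of_real of_real_eq_iff)
qed

lemma integrable_rep_square: "integrable circle_measure (\<lambda>z. (cmod (rep_L2 x z))\<^sup>2)"
  using sq_integrable_rep[of x] unfolding sq_integrable_def by blast

lemma norm_mono_AE:
  assumes "0 \<le> M" "AE z in circle_measure. cmod (rep_L2 x z) \<le> M * cmod (rep_L2 y z)"
  shows "norm x \<le> M * norm y"
proof -
  have "(norm x)\<^sup>2 \<le> (\<integral>z. M\<^sup>2 * (cmod (rep_L2 y z))\<^sup>2 \<partial>circle_measure)"
    unfolding norm_square_integral
  proof (intro integral_mono_AE integrable_rep_square integrable_mult_right)
    show "AE z in circle_measure. (cmod (rep_L2 x z))\<^sup>2 \<le> M\<^sup>2 * (cmod (rep_L2 y z))\<^sup>2"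
      using assms(2)
    proof eventually_elim
      case (elim z)
      then have "(cmod (rep_L2 x z))\<^sup>2 \<le> (M * cmod (rep_L2 y z))\<^sup>2" by (intro power_mono) auto
      then show ?case by (simp add: power_mult_distrib)
    qed
  qed
  also have "\<dots> = (M * norm y)\<^sup>2"
    by (simp add: norm_square_integral power_mult_distrib)
  finally show ?thesis by (rule power2_le_imp_le) (use assms(1) in simp)
qed

lemma bounded_linear_mult:
  assumes "bounded_L2 x" shows "bounded_linear (\<lambda>y. x \<odot> y)"
proof -
  obtain M where M: "AE z in circle_measure. cmod (rep_L2 x z) \<le> M"
    using assms unfolding bounded_L2_def by blast
  have "norm (x \<odot> y) \<le> norm y * max 0 M" for y
  proof -
    have "AE z in circle_measure. cmod (rep_L2 (x \<odot> y) z) \<le> max 0 M * cmod (rep_L2 y z)"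
      using M rep_mult[OF disjI1[OF assms], of y]
      by eventually_elim (auto simp: norm_mult intro!: mult_right_mono)
    then show ?thesis by (subst mult.commute) (intro norm_mono_AE, auto)
  qed
  then show ?thesis
    by (intro bounded_linear_intro)
       (auto simp: mult_add_right mult_scale_right assms scaleR_L2_def)
qed

lemmas tendsto_mult_L2 = bounded_linear.tendsto[OF bounded_linear_mult]

lemma bounded_linear_conj: "bounded_linear conj_L2"
  by (rule bounded_linear_intro[of _ 1]) (auto simp: conj_add conj_scale scaleR_L2_def)

lemmas tendsto_conj_L2 = bounded_linear.tendsto[OF bounded_linear_conj]

subsection \<open>The trigonometric system\<close>

definition trig :: "int \<Rightarrow> L2" where
  "trig n = to_L2 (\<lambda>z. z powi n)"

definition coeff_L2 :: "L2 \<Rightarrow> int \<Rightarrow> complex" where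
  "coeff_L2 f n = \<langle>f, trig n\<rangle>"

lemma sq_integrable_powi: "sq_integrable (\<lambda>z. z powi n)"
proof (rule sq_integrable_bounded[OF borel_measurable_power_int])
  show "AE z in circle_measure. cmod (z powi n) \<le> 1"
    using AE_circle_norm by eventually_elim (simp add: norm_power_int)
qed

lemma rep_trig: "AE z in circle_measure. rep_L2 (trig n) z = z powi n"
  unfolding trig_def by (rule rep_to_L2[OF sq_integrable_powi])

lemma bounded_L2_trig [simp]: "bounded_L2 (trig n)"
proof -
  have "AE z in circle_measure. cmod (rep_L2 (trig n) z) \<le> 1"
    using AE_circle_norm rep_trig[of n] by eventually_elim (simp add: norm_power_int)
  then show ?thesis unfolding bounded_L2_def by blast
qed

lemma conj_trig: "conj_L2 (trig n) = trig (- n)"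
  using AE_circle_norm rep_trig[of n] rep_trig[of "- n"] rep_conj[of "trig n"]
  by (intro L2_eqI, eventually_elim) (simp add: sphere_power_int del: complex_cnj_power_int)

lemma mult_trig_trig: "trig m \<odot> trig n = trig (m + n)"
  using AE_circle_norm rep_trig[of n] rep_trig[of m] rep_trig[of "m + n"]
    rep_mult[OF disjI1[OF bounded_L2_trig], of m "trig n"]
proof (intro L2_eqI, eventually_elim)
  case (elim z)
  then have "z \<noteq> 0" by auto
  with elim show ?case by (simp add: power_int_add)
qed

lemma mult_trig_0 [simp]: "trig 0 \<odot> x = x" "x \<odot> trig 0 = x"
proof -
  show "trig 0 \<odot> x = x"
    using rep_trig[of 0] rep_mult[OF disjI1[OF bounded_L2_trig], of 0 x]
    by (intro L2_eqI, eventually_elim) simp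
  then show "x \<odot> trig 0 = x" by (simp add: mult_commute)
qed

lemma mult_trig_mult_trig: "trig m \<odot> (trig n \<odot> x) = trig (m + n) \<odot> x"
  by (simp add: mult_assoc[symmetric] mult_trig_trig)

lemma cinner_trig_trig: "\<langle>trig m, trig n\<rangle> = (if m = n then 1 else 0)"
proof -
  have "\<langle>trig m, trig n\<rangle> = (\<integral>z. z powi (m - n) \<partial>circle_measure)"
    unfolding cinner_rep
  proof (rule integral_cong_AE)
    show "(\<lambda>z. z powi (m - n)) \<in> borel_measurable circle_measure"
      by (rule borel_measurable_power_int)
    show "AE z in circle_measure. rep_L2 (trig m) z * cnj (rep_L2 (trig n) z) = z powi (m - n)"
      using AE_circle_norm rep_trig[of n] rep_trig[of m]
    proof eventually_elim
      case (elim z)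
      then have "z \<noteq> 0" by auto
      with elim show ?case
        by (simp add: sphere_power_int power_int_add[symmetric] del: complex_cnj_power_int)
    qed
  qed measurable
  then show ?thesis by (simp add: circle_integral_power_int)
qed

lemma coeff_trig: "coeff_L2 (trig m) n = (if m = n then 1 else 0)"
  by (simp add: coeff_L2_def cinner_trig_trig)

lemma coeff_add: "coeff_L2 (f + g) n = coeff_L2 f n + coeff_L2 g n"
  and coeff_diff: "coeff_L2 (f - g) n = coeff_L2 f n - coeff_L2 g n"
  and coeff_scale: "coeff_L2 (c *\<^sub>C f) n = c * coeff_L2 f n"
  and coeff_minus: "coeff_L2 (- f) n = - coeff_L2 f n"
  and coeff_zero: "coeff_L2 0 n = 0"
  by (simp_all add: coeff_L2_def cinner_simps)

lemmas coeff_simps = coeff_add coeff_diff coeff_scale coeff_minus coeff_zero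

lemma coeff_sum: "coeff_L2 (\<Sum>i\<in>I. f i) n = (\<Sum>i\<in>I. coeff_L2 (f i) n)"
  by (simp add: coeff_L2_def cinner_sum_left)

lemma coeff_conj: "coeff_L2 (conj_L2 f) n = cnj (coeff_L2 f (- n))"
  using cinner_conj_conj[of f "trig (- n)"] cinner_commute[of f "trig (- n)"]
  by (simp add: coeff_L2_def conj_trig)

lemma coeff_mult_trig: "coeff_L2 (trig m \<odot> f) n = coeff_L2 f (n - m)"
  by (simp add: coeff_L2_def cinner_mult_left conj_trig mult_trig_trig)

lemma tendsto_coeff: "(f \<longlongrightarrow> a) F \<Longrightarrow> ((\<lambda>t. coeff_L2 (f t) n) \<longlongrightarrow> coeff_L2 a n) F"
  unfolding coeff_L2_def by (intro tendsto_cinner tendsto_const)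

lemma norm_trig [simp]: "norm (trig n) = 1"
  using cinner_trig_trig[of n n] by (simp add: norm_eq_sqrt_inner inner_L2_def)

lemma circle_var_trig: "circle_var = trig 1"
  by (simp add: circle_var_def trig_def)

subsection \<open>Completeness\<close>

text \<open>Integrate \<open>|f| \<le> t / 2 + |f|^2 / (2 t)\<close>, an instance of the
  arithmetic-geometric mean inequality, over a space of total mass one.\<close>

lemma integral_norm_rep_le:
  assumes "norm x \<le> t" "t > 0"
  shows "integrable circle_measure (\<lambda>z. cmod (rep_L2 x z))"
    and "(\<integral>z. cmod (rep_L2 x z) \<partial>circle_measure) \<le> t"
proof -
  have le: "cmod (rep_L2 x z) \<le> t / 2 + (cmod (rep_L2 x z))\<^sup>2 / (2 * t)" for z
    using sum_squares_bound[of t "cmod (rep_L2 x z)"] \<open>t > 0\<close>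
    by (simp add: field_simps power2_eq_square)
  have int: "integrable circle_measure (\<lambda>z. t / 2 + (cmod (rep_L2 x z))\<^sup>2 / (2 * t))"
    using integrable_rep_square[of x] by auto
  then show i: "integrable circle_measure (\<lambda>z. cmod (rep_L2 x z))"
    by (rule Bochner_Integration.integrable_bound) (use le \<open>t > 0\<close> in auto)
  have "(\<integral>z. cmod (rep_L2 x z) \<partial>circle_measure) \<le>
      (\<integral>z. t / 2 + (cmod (rep_L2 x z))\<^sup>2 / (2 * t) \<partial>circle_measure)"
    by (intro integral_mono int i le)
  also have "\<dots> = t / 2 + (norm x)\<^sup>2 / (2 * t)"
    using integrable_rep_square[of x] by (simp add: norm_square_integral)
  also have "\<dots> \<le> t / 2 + t\<^sup>2 / (2 * t)"
    using assms by (intro add_left_mono divide_right_mono power_mono) auto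
  finally show "(\<integral>z. cmod (rep_L2 x z) \<partial>circle_measure) \<le> t"
    using assms by (simp add: power2_eq_square)
qed

text \<open>The increments have summable \<open>L^1\<close> norms, so by monotone convergence their
  moduli have a finite sum almost everywhere.\<close>

lemma AE_convergent_rep:
  fixes X :: "nat \<Rightarrow> L2"
  assumes "\<And>k. norm (X (Suc k) - X k) \<le> (1/2) ^ k"
  shows "AE z in circle_measure. convergent (\<lambda>k. rep_L2 (X k) z)"
proof -
  define d where "d k = X (Suc k) - X k" for k
  have "(\<integral>\<^sup>+z. (\<Sum>k. ennreal (cmod (rep_L2 (d k) z))) \<partial>circle_measure)
      = (\<Sum>k. \<integral>\<^sup>+z. ennreal (cmod (rep_L2 (d k) z)) \<partial>circle_measure)"
    by (intro nn_integral_suminf) measurable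
  also have "\<dots> \<le> (\<Sum>k. ennreal ((1/2) ^ k))"
  proof (intro suminf_le allI summableI)
    fix k
    have "norm (d k) \<le> (1/2) ^ k" using assms by (simp add: d_def)
    from integral_norm_rep_le[OF this]
    show "(\<integral>\<^sup>+z. ennreal (cmod (rep_L2 (d k) z)) \<partial>circle_measure) \<le> ennreal ((1/2) ^ k)"
      by (subst nn_integral_eq_integral) (auto intro!: ennreal_leI)
  qed
  also have "\<dots> = ennreal (\<Sum>k. (1/2) ^ k)"
    by (intro suminf_ennreal2) (auto intro: summable_geometric)
  also have "\<dots> < \<infinity>" by simp
  finally have "AE z in circle_measure. (\<Sum>k. ennreal (cmod (rep_L2 (d k) z))) \<noteq> \<infinity>"
    by (intro nn_integral_PInf_AE) auto
  moreover have "AE z in circle_measure. \<forall>k. rep_L2 (d k) z = rep_L2 (X (Suc k)) z - rep_L2 (X k) z"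
    unfolding AE_all_countable d_def using rep_diff by blast
  ultimately show ?thesis
  proof eventually_elim
    case (elim z)
    then have "summable (\<lambda>k. cmod (rep_L2 (d k) z))"
      by (intro summable_suminf_not_top) auto
    then have "summable (\<lambda>k. rep_L2 (d k) z)" by (rule summable_norm_cancel)
    then have "summable (\<lambda>k. rep_L2 (X (Suc k)) z - rep_L2 (X k) z)" using elim by simp
    then have "convergent (\<lambda>n. \<Sum>k<n. rep_L2 (X (Suc k)) z - rep_L2 (X k) z)"
      by (simp add: summable_iff_convergent)
    then have "convergent (\<lambda>n. rep_L2 (X n) z - rep_L2 (X 0) z)"
      by (simp only: sum_lessThan_telescope[of "\<lambda>k. rep_L2 (X k) z"])
    from convergent_add[OF this convergent_const[of "rep_L2 (X 0) z"]] show ?case by simp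
  qed
qed

text \<open>The Riesz-Fischer argument: the limit almost everywhere is the candidate, and Fatou's
  lemma shows both that it is square integrable and that the convergence holds in norm.\<close>

lemma L2_convergent_of_fast_Cauchy:
  fixes X :: "nat \<Rightarrow> L2"
  assumes fast: "\<And>k. norm (X (Suc k) - X k) \<le> (1/2) ^ k" and "Cauchy X"
  shows "convergent X"
proof -
  define g where "g z = lim (\<lambda>k. rep_L2 (X k) z)" for z
  have [measurable]: "g \<in> borel_measurable circle_measure"
    unfolding g_def by measurable
  have conv: "AE z in circle_measure. (\<lambda>k. rep_L2 (X k) z) \<longlonglongrightarrow> g z"
    using AE_convergent_rep[OF fast] unfolding g_def
    by eventually_elim (simp add: convergent_LIMSEQ_iff)
  have fatou: "(\<integral>\<^sup>+z. ennreal ((cmod (g z - rep_L2 (X m) z))\<^sup>2) \<partial>circle_measure) \<le> ennreal (e\<^sup>2)"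
    if m: "\<forall>n\<ge>m. norm (X n - X m) \<le> e" "e \<ge> 0" for m e
  proof -
    have "AE z in circle_measure. ennreal ((cmod (g z - rep_L2 (X m) z))\<^sup>2) =
        liminf (\<lambda>n. ennreal ((cmod (rep_L2 (X n - X m) z))\<^sup>2))"
    proof -
      have "AE z in circle_measure. \<forall>n. rep_L2 (X n - X m) z = rep_L2 (X n) z - rep_L2 (X m) z"
        unfolding AE_all_countable using rep_diff by blast
      with conv show ?thesis
      proof eventually_elim
        case (elim z)
        have "(\<lambda>n. ennreal ((cmod (rep_L2 (X n) z - rep_L2 (X m) z))\<^sup>2)) \<longlonglongrightarrow>
            ennreal ((cmod (g z - rep_L2 (X m) z))\<^sup>2)"
          by (intro tendsto_intros elim)
        from lim_imp_Liminf[OF _ this] show ?case using elim by simp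
      qed
    qed
    then have "(\<integral>\<^sup>+z. ennreal ((cmod (g z - rep_L2 (X m) z))\<^sup>2) \<partial>circle_measure) =
        (\<integral>\<^sup>+z. liminf (\<lambda>n. ennreal ((cmod (rep_L2 (X n - X m) z))\<^sup>2)) \<partial>circle_measure)"
      by (rule nn_integral_cong_AE)
    also have "\<dots> \<le> liminf (\<lambda>n. \<integral>\<^sup>+z. ennreal ((cmod (rep_L2 (X n - X m) z))\<^sup>2) \<partial>circle_measure)"
      by (intro nn_integral_liminf) measurable
    also have "\<dots> = liminf (\<lambda>n. ennreal ((norm (X n - X m))\<^sup>2))"
      by (subst nn_integral_eq_integral) (auto simp: integrable_rep_square norm_square_integral)
    also have "\<dots> \<le> ennreal (e\<^sup>2)"
    proof (rule Liminf_le)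
      show "\<forall>\<^sub>F n in sequentially. ennreal ((norm (X n - X m))\<^sup>2) \<le> ennreal (e\<^sup>2)"
        using m by (intro eventually_sequentiallyI[of m] ennreal_leI power_mono) auto
    qed simp
    finally show ?thesis .
  qed
  have ev: "\<exists>M. \<forall>m\<ge>M. \<forall>n\<ge>m. norm (X n - X m) \<le> e" if "e > 0" for e
    using CauchyD[OF \<open>Cauchy X\<close> that] by (meson less_imp_le order_trans)
  have diff: "sq_integrable (\<lambda>z. g z - rep_L2 (X m) z)" if "\<forall>n\<ge>m. norm (X n - X m) \<le> e" "e \<ge> 0" for m e
    unfolding sq_integrable_def
    using fatou[OF that] by (intro conjI integrableI_nonneg) (auto simp: top_unique less_top[symmetric])
  obtain m where m: "\<forall>n\<ge>m. norm (X n - X m) \<le> 1" using ev[of 1] by auto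
  have g: "sq_integrable g"
    using sq_integrable_add[OF diff[OF m] sq_integrable_rep[of "X m"]] by simp
  have "X \<longlonglongrightarrow> to_L2 g"
  proof (rule LIMSEQ_I)
    fix r :: real assume "r > 0"
    then obtain M where M: "\<forall>m\<ge>M. \<forall>n\<ge>m. norm (X n - X m) \<le> r / 2" using ev[of "r/2"] by auto
    have "norm (X m - to_L2 g) < r" if "m \<ge> M" for m
    proof -
      have "AE z in circle_measure. rep_L2 (to_L2 g - X m) z = g z - rep_L2 (X m) z"
        using rep_diff[of "to_L2 g" "X m"] rep_to_L2[OF g] by eventually_elim simp
      then have "(\<integral>\<^sup>+z. ennreal ((cmod (rep_L2 (to_L2 g - X m) z))\<^sup>2) \<partial>circle_measure) =
          (\<integral>\<^sup>+z. ennreal ((cmod (g z - rep_L2 (X m) z))\<^sup>2) \<partial>circle_measure)"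
        by (intro nn_integral_cong_AE) auto
      also have "\<dots> \<le> ennreal ((r/2)\<^sup>2)"
        using M that \<open>r > 0\<close> by (intro fatou) auto
      finally have "ennreal ((norm (to_L2 g - X m))\<^sup>2) \<le> ennreal ((r/2)\<^sup>2)"
        by (subst (asm) nn_integral_eq_integral) (auto simp: integrable_rep_square norm_square_integral)
      then have "(norm (to_L2 g - X m))\<^sup>2 \<le> (r/2)\<^sup>2"
        by (subst (asm) ennreal_le_iff) auto
      then have "norm (to_L2 g - X m) \<le> r / 2"
        by (rule power2_le_imp_le) (use \<open>r > 0\<close> in auto)
      then show ?thesis using \<open>r > 0\<close> by (simp add: norm_minus_commute)
    qed
    then show "\<exists>no. \<forall>n\<ge>no. norm (X n - to_L2 g) < r" by blast
  qed
  then show ?thesis by (rule convergentI)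
qed

lemma Cauchy_fast_subseq:
  fixes X :: "nat \<Rightarrow> 'a::real_normed_vector"
  assumes "Cauchy X"
  obtains r where "strict_mono r" "\<And>k. norm (X (r (Suc k)) - X (r k)) \<le> (1/2) ^ k"
proof -
  have "\<exists>M. \<forall>m\<ge>M. \<forall>n\<ge>M. norm (X m - X n) < (1/2) ^ k" for k
    using CauchyD[OF assms, of "(1/2)^k"] by simp
  then obtain M where M: "\<And>k m n. m \<ge> M k \<Longrightarrow> n \<ge> M k \<Longrightarrow> norm (X m - X n) < (1/2) ^ k"
    by metis
  \<comment> \<open>The summand \<open>k\<close> makes \<open>r\<close> strictly increasing, and the
    partial sum dominates \<open>M k\<close>.\<close>
  define r where "r k = k + (\<Sum>j\<le>k. M j)" for k
  have "strict_mono r" by (rule strict_monoI_Suc) (simp add: r_def)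
  moreover have "norm (X (r (Suc k)) - X (r k)) \<le> (1/2) ^ k" for k
  proof -
    have "M k \<le> (\<Sum>j\<le>k. M j)" by (rule member_le_sum) auto
    then have "M k \<le> r k" "M k \<le> r (Suc k)" by (auto simp: r_def)
    then show ?thesis using M[of k "r (Suc k)" "r k"] by simp
  qed
  ultimately show ?thesis using that by blast
qed

lemma L2_complete:
  fixes X :: "nat \<Rightarrow> L2"
  assumes "Cauchy X" shows "convergent X"
proof -
  obtain r where r: "strict_mono r" "\<And>k. norm (X (r (Suc k)) - X (r k)) \<le> (1/2) ^ k"
    using Cauchy_fast_subseq[OF assms] by blast
  have "convergent (X \<circ> r)"
    using r by (intro L2_convergent_of_fast_Cauchy Cauchy_subseq_Cauchy assms) auto
  then show ?thesis
    using Cauchy_converges_subseq[OF assms r(1)] unfolding convergent_def by auto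
qed

subsection \<open>Completeness of the trigonometric system\<close>

text \<open>Both rules compare functions on the circle only, so that \<open>cnj z\<close> counts as
  \<open>z powi -1\<close> and real polynomials in the real and imaginary parts of \<open>z\<close>
  qualify.\<close>

inductive trig_poly :: "(complex \<Rightarrow> complex) \<Rightarrow> bool" where
  monom: "(\<And>z. cmod z = 1 \<Longrightarrow> p z = c * z powi n) \<Longrightarrow> trig_poly p"
| add: "trig_poly p \<Longrightarrow> trig_poly q \<Longrightarrow> (\<And>z. cmod z = 1 \<Longrightarrow> r z = p z + q z) \<Longrightarrow> trig_poly r"

lemma trig_poly_monom_mult:
  assumes "trig_poly q" "\<And>z. cmod z = 1 \<Longrightarrow> r z = c * z powi n * q z"
  shows "trig_poly r"
  using assms
proof (induction arbitrary: r)
  case (monom p d m)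
  show ?case
  proof (rule trig_poly.monom[of _ "c * d" "n + m"])
    fix z :: complex assume z: "cmod z = 1"
    then have "z \<noteq> 0" by auto
    then show "r z = c * d * z powi (n + m)" using z monom by (simp add: power_int_add)
  qed
next
  case (add p q s)
  show ?case
    by (rule trig_poly.add[OF add.IH(1)[OF refl] add.IH(2)[OF refl]])
       (simp add: add.prems add.hyps algebra_simps)
qed

lemma trig_poly_mult:
  assumes "trig_poly p" "trig_poly q" "\<And>z. cmod z = 1 \<Longrightarrow> r z = p z * q z"
  shows "trig_poly r"
  using assms
proof (induction arbitrary: r)
  case (monom p c n)
  then show ?case using trig_poly_monom_mult[of q r c n] by simp
next
  case (add p p' s)
  show ?case
    by (rule trig_poly.add[OF add.IH(1)[OF add.prems(1) refl] add.IH(2)[OF add.prems(1) refl]])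
       (simp add: add.prems add.hyps algebra_simps)
qed

lemma trig_poly_of_real_polynomial_function:
  assumes "real_polynomial_function p"
  shows "trig_poly (\<lambda>z. complex_of_real (p z))"
  using assms
proof induction
  case (linear f)
  then interpret bounded_linear f .
  have f: "f z = Re z * f 1 + Im z * f \<i>" for z
  proof -
    have "z = Re z *\<^sub>R 1 + Im z *\<^sub>R \<i>" by (simp add: complex_eq_iff)
    then have "f z = f (Re z *\<^sub>R 1 + Im z *\<^sub>R \<i>)" by (rule arg_cong)
    then show ?thesis by (simp only: add scaleR real_scaleR_def)
  qed
  \<comment> \<open>These come from \<open>Re z = (z + 1/z) / 2\<close> and
    \<open>Im z = (z - 1/z) / (2 i)\<close> on the circle, inserted into
    \<open>f z = Re z * f 1 + Im z * f i\<close>.\<close>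
  let ?a = "(f 1 - \<i> * f \<i>) / 2" and ?b = "(f 1 + \<i> * f \<i>) / 2"
  show ?case
  proof (rule trig_poly.add[OF trig_poly.monom[OF refl, of ?a 1] trig_poly.monom[OF refl, of ?b "-1"]])
    fix z :: complex assume "cmod z = 1"
    then have "z powi - 1 = cnj z" using sphere_power_int[of z 1] by simp
    then have "?a * z powi 1 + ?b * z powi - 1 = f 1 / 2 * (z + cnj z) - \<i> * f \<i> / 2 * (z - cnj z)"
      by (simp add: algebra_simps diff_divide_distrib add_divide_distrib)
    also have "\<dots> = complex_of_real (Re z * f 1 + Im z * f \<i>)"
      unfolding complex_add_cnj complex_diff_cnj by (simp add: mult_ac)
    finally show "complex_of_real (f z) = ?a * z powi 1 + ?b * z powi - 1"
      by (simp only: f[symmetric])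
  qed
next
  case (const c)
  show ?case by (rule trig_poly.monom[of _ "of_real c" 0]) simp
next
  case (add f g)
  then show ?case by (auto intro: trig_poly.add)
next
  case (mult f g)
  then show ?case by (auto intro: trig_poly_mult)
qed

lemma trig_poly_orthogonal:
  assumes "trig_poly p" "\<And>n. coeff_L2 f n = 0"
  shows "integrable circle_measure (\<lambda>z. rep_L2 f z * cnj (p z)) \<and>
     (\<integral>z. rep_L2 f z * cnj (p z) \<partial>circle_measure) = 0"
  using assms(1)
proof induction
  case (monom p c n)
  have ae: "AE z in circle_measure. rep_L2 f z * cnj (rep_L2 (c *\<^sub>C trig n) z) =
      rep_L2 f z * cnj (c * z powi n)"
    using rep_trig[of n] rep_scale[of c "trig n"] by eventually_elim simp
  have sq: "sq_integrable (\<lambda>z. c * z powi n)"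
    by (intro sq_integrable_scale sq_integrable_powi)
  have i: "integrable circle_measure (\<lambda>z. rep_L2 f z * cnj (c * z powi n))"
    by (intro sq_integrable_mult_integrable sq sq_integrable_rep)
  have "(\<integral>z. rep_L2 f z * cnj (c * z powi n) \<partial>circle_measure) = \<langle>f, c *\<^sub>C trig n\<rangle>"
    unfolding cinner_rep using ae i
    by (intro integral_cong_AE borel_measurable_integrable[OF i]) auto
  also have "\<dots> = 0" using assms(2)[of n] by (simp add: cinner_simps coeff_L2_def)
  finally have 0: "(\<integral>z. rep_L2 f z * cnj (c * z powi n) \<partial>circle_measure) = 0" .
  have "integrable circle_measure (\<lambda>z. rep_L2 f z * cnj (p z)) \<longleftrightarrow>
      integrable circle_measure (\<lambda>z. rep_L2 f z * cnj (c * z powi n))"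
    using monom by (intro Bochner_Integration.integrable_cong) auto
  moreover have "(\<integral>z. rep_L2 f z * cnj (p z) \<partial>circle_measure) =
      (\<integral>z. rep_L2 f z * cnj (c * z powi n) \<partial>circle_measure)"
    using monom by (intro Bochner_Integration.integral_cong) auto
  ultimately show ?case using i 0 by simp
next
  case (add p q r)
  have "integrable circle_measure (\<lambda>z. rep_L2 f z * cnj (r z)) \<longleftrightarrow>
      integrable circle_measure (\<lambda>z. rep_L2 f z * cnj (p z) + rep_L2 f z * cnj (q z))"
    using add.hyps by (intro Bochner_Integration.integrable_cong) (auto simp: algebra_simps)
  moreover have "(\<integral>z. rep_L2 f z * cnj (r z) \<partial>circle_measure) =
      (\<integral>z. rep_L2 f z * cnj (p z) + rep_L2 f z * cnj (q z) \<partial>circle_measure)"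
    using add.hyps by (intro Bochner_Integration.integral_cong) (auto simp: algebra_simps)
  ultimately show ?case using add.IH by simp
qed

lemma integrable_norm_rep: "integrable circle_measure (\<lambda>z. cmod (rep_L2 x z))"
  using integral_norm_rep_le(1)[of x "norm x + 1"] by (simp add: add_nonneg_pos)

lemma integrable_rep: "integrable circle_measure (rep_L2 x)"
  by (rule Bochner_Integration.integrable_bound[OF integrable_norm_rep[of x]]) auto

text \<open>By Stone-Weierstrass \<open>g\<close> is uniformly close on the circle to a real
  polynomial, whose integral against \<open>f\<close> vanishes; the error is at most the uniform
  distance times the \<open>L^1\<close> norm of \<open>f\<close>.\<close>

lemma continuous_orthogonal:
  fixes g :: "complex \<Rightarrow> real"
  assumes coeff: "\<And>n. coeff_L2 f n = 0" and g: "continuous_on UNIV g"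
  shows "(\<integral>z. g z *\<^sub>R rep_L2 f z \<partial>circle_measure) = 0"
proof -
  define I where "I = (\<integral>z. cmod (rep_L2 f z) \<partial>circle_measure)"
  have I: "I \<ge> 0" unfolding I_def by (rule integral_nonneg_AE) simp
  have gm [measurable]: "g \<in> borel_measurable circle_measure"
    by (intro borel_measurable_circle borel_measurable_continuous_onI g)
  have "cmod (\<integral>z. g z *\<^sub>R rep_L2 f z \<partial>circle_measure) \<le> 0 + e" if "e > 0" for e
  proof -
    \<comment> \<open>The summand 1 keeps the quotient meaningful when \<open>I = 0\<close>.\<close>
    define d where "d = e / (I + 1)"
    have d: "d > 0" "d * I \<le> e" using that I by (auto simp: d_def field_simps)
    have "continuous_on (sphere 0 1) g" using g continuous_on_subset by blast
    then obtain p where p: "real_polynomial_function p" "\<And>z. z \<in> sphere 0 1 \<Longrightarrow> \<bar>g z - p z\<bar> < d"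
      using Stone_Weierstrass_real_polynomial_function[OF compact_sphere _ d(1)] by blast
    have orth: "integrable circle_measure (\<lambda>z. p z *\<^sub>R rep_L2 f z)"
      "(\<integral>z. p z *\<^sub>R rep_L2 f z \<partial>circle_measure) = 0"
      using trig_poly_orthogonal[OF trig_poly_of_real_polynomial_function[OF p(1)], of f] coeff
      by (simp_all add: scaleR_conv_of_real mult.commute)
    have [measurable]: "p \<in> borel_measurable circle_measure"
      using p(1) by (intro borel_measurable_circle borel_measurable_continuous_onI
          continuous_on_polymonial_function) (simp add: real_polynomial_function_eq)
    have bnd: "AE z in circle_measure. norm ((g z - p z) *\<^sub>R rep_L2 f z) \<le> d * cmod (rep_L2 f z)"
      using p(2) by (intro AE_I2) (auto intro!: mult_right_mono less_imp_le[OF p(2)])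
    have i: "integrable circle_measure (\<lambda>z. d * cmod (rep_L2 f z))"
      using integrable_norm_rep by simp
    have i1: "integrable circle_measure (\<lambda>z. (g z - p z) *\<^sub>R rep_L2 f z)"
    proof (rule Bochner_Integration.integrable_bound[OF i])
      show "AE z in circle_measure. norm ((g z - p z) *\<^sub>R rep_L2 f z) \<le> norm (d * cmod (rep_L2 f z))"
        using bnd d(1) by simp
    qed measurable
    have "(\<integral>z. g z *\<^sub>R rep_L2 f z \<partial>circle_measure) =
        (\<integral>z. (g z - p z) *\<^sub>R rep_L2 f z + p z *\<^sub>R rep_L2 f z \<partial>circle_measure)"
      by (simp add: algebra_simps)
    also have "\<dots> = (\<integral>z. (g z - p z) *\<^sub>R rep_L2 f z \<partial>circle_measure)"
      using i1 orth by simp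
    also have "cmod \<dots> \<le> (\<integral>z. d * cmod (rep_L2 f z) \<partial>circle_measure)"
      by (rule Bochner_Integration.integral_norm_bound_integral[OF i1 i]) (auto intro!: mult_right_mono less_imp_le[OF p(2)])
    also have "\<dots> = d * I" by (simp add: I_def)
    finally show ?thesis using d by simp
  qed
  then have "cmod (\<integral>z. g z *\<^sub>R rep_L2 f z \<partial>circle_measure) \<le> 0" by (rule field_le_epsilon)
  then show ?thesis by simp
qed

text \<open>Testing on the set where \<open>f\<close> is positive gives a non-negative integrand
  with integral zero.\<close>

lemma set_integral_zero_imp_AE_le:
  fixes f :: "'a \<Rightarrow> real"
  assumes "integrable M f" "\<And>A. A \<in> sets M \<Longrightarrow> (\<integral>x. indicator A x * f x \<partial>M) = 0"
  shows "AE x in M. f x \<le> 0"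
proof -
  have [measurable]: "f \<in> borel_measurable M" using assms(1) by auto
  define A where "A = {x \<in> space M. f x > 0}"
  have A [measurable]: "A \<in> sets M" unfolding A_def by measurable
  have i: "integrable M (\<lambda>x. indicator A x * f x)"
    using integrable_mult_indicator[OF A assms(1)] by simp
  have "AE x in M. indicator A x * f x = 0"
    using integral_nonneg_eq_0_iff_AE[OF i] assms(2)[OF A] by (auto simp: A_def indicator_def)
  moreover have "AE x in M. x \<in> space M" by simp
  ultimately show ?thesis
    by eventually_elim (auto simp: A_def indicator_def split: if_splits)
qed

lemma set_integral_zero_imp_AE_zero:
  fixes f :: "'a \<Rightarrow> complex"
  assumes int: "integrable M f" and "\<And>A. A \<in> sets M \<Longrightarrow> (\<integral>x. indicator A x *\<^sub>R f x \<partial>M) = 0"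
  shows "AE x in M. f x = 0"
proof -
  have ind: "integrable M (\<lambda>x. indicator A x *\<^sub>R f x)" if "A \<in> sets M" for A
    using that int by (rule integrable_mult_indicator)
  have "AE x in M. s * Re (f x) \<le> 0" for s
  proof (rule set_integral_zero_imp_AE_le)
    fix A assume "A \<in> sets M"
    then have "(\<integral>x. Re (indicator A x *\<^sub>R f x) \<partial>M) = 0"
      using integral_Re[OF ind] assms(2) by simp
    then show "(\<integral>x. indicator A x * (s * Re (f x)) \<partial>M) = 0"
      by (simp add: mult.left_commute)
  qed (use int in auto)
  from this[of 1] this[of "-1"]
  have re: "AE x in M. Re (f x) = 0" by eventually_elim simp
  have "AE x in M. s * Im (f x) \<le> 0" for s
  proof (rule set_integral_zero_imp_AE_le)
    fix A assume "A \<in> sets M"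
    then have "(\<integral>x. Im (indicator A x *\<^sub>R f x) \<partial>M) = 0"
      using integral_Im[OF ind] assms(2) by simp
    then show "(\<integral>x. indicator A x * (s * Im (f x)) \<partial>M) = 0"
      by (simp add: mult.left_commute)
  qed (use int in auto)
  from this[of 1] this[of "-1"]
  have "AE x in M. Im (f x) = 0" by eventually_elim simp
  with re show ?thesis by eventually_elim (simp add: complex_eq_iff)
qed

text \<open>The indicator of a non-empty closed set is the pointwise limit of the continuous
  functions \<open>max 0 (1 - n * infdist z A)\<close>, which are bounded by 1, so dominated
  convergence applies.\<close>

lemma closed_set_integral_zero:
  assumes coeff: "\<And>n. coeff_L2 f n = 0" and A: "closed A"
  shows "(\<integral>z. indicator A z *\<^sub>R rep_L2 f z \<partial>circle_measure) = 0"
proof (cases "A = {}")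
  case False
  define g where "g n z = max 0 (1 - real n * infdist z A)" for n z
  have cont: "continuous_on UNIV (g n)" for n
    unfolding g_def by (intro continuous_intros)
  have gm [measurable]: "g n \<in> borel_measurable circle_measure" for n
    by (intro borel_measurable_circle borel_measurable_continuous_onI cont)
  have Am: "(indicator A :: complex \<Rightarrow> real) \<in> borel_measurable circle_measure"
    using A by (intro borel_measurable_circle borel_measurable_indicator) auto
  have lim: "(\<lambda>n. g n z) \<longlonglongrightarrow> indicator A z" for z
  proof (cases "z \<in> A")
    case True
    then show ?thesis by (simp add: g_def)
  next
    case notin: False
    then have pos: "infdist z A > 0"
      using A False by (metis in_closed_iff_infdist_zero infdist_nonneg order_le_less)
    obtain N where N: "real N * infdist z A > 1" using reals_Archimedean3[OF pos] by blast
    have "g n z = 0" if "n \<ge> N" for n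
    proof -
      have "real N * infdist z A \<le> real n * infdist z A"
        using that pos by (intro mult_right_mono) auto
      with N show ?thesis by (simp add: g_def)
    qed
    then show ?thesis
      using notin by (auto intro!: tendsto_eventually eventually_sequentiallyI)
  qed
  have "(\<lambda>n. \<integral>z. g n z *\<^sub>R rep_L2 f z \<partial>circle_measure) \<longlonglongrightarrow>
      (\<integral>z. indicator A z *\<^sub>R rep_L2 f z \<partial>circle_measure)"
  proof (rule integral_dominated_convergence)
    show "integrable circle_measure (\<lambda>z. cmod (rep_L2 f z))" by (rule integrable_norm_rep)
    show "AE z in circle_measure. (\<lambda>n. g n z *\<^sub>R rep_L2 f z) \<longlonglongrightarrow> indicator A z *\<^sub>R rep_L2 f z"
      by (intro AE_I2 tendsto_intros lim)
    show "AE z in circle_measure. norm (g n z *\<^sub>R rep_L2 f z) \<le> cmod (rep_L2 f z)" for n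
      by (intro AE_I2) (auto simp: g_def infdist_nonneg intro!: mult_left_le_one_le)
  qed (use Am in auto)
  moreover have "(\<integral>z. g n z *\<^sub>R rep_L2 f z \<partial>circle_measure) = 0" for n
    by (rule continuous_orthogonal[OF coeff cont])
  ultimately show ?thesis using LIMSEQ_unique[OF _ tendsto_const] by simp
qed simp

text \<open>Closed sets are stable under intersection and generate the Borel sets, so it suffices to
  pass to complements and to disjoint countable unions.\<close>

lemma borel_set_integral_zero:
  assumes coeff: "\<And>n. coeff_L2 f n = 0" and A: "A \<in> sets borel"
  shows "(\<integral>z. indicator A z *\<^sub>R rep_L2 f z \<partial>circle_measure) = 0"
proof -
  have meas: "A \<inter> sphere 0 1 \<in> sets circle_measure" if "A \<in> sets borel" for A
    using that by (auto simp: sets_circle_measure sets_restrict_space)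
  have ind: "integrable circle_measure (\<lambda>z. indicator A z *\<^sub>R rep_L2 f z)" if "A \<in> sets borel" for A
  proof -
    have "integrable circle_measure (\<lambda>z. indicator (A \<inter> sphere 0 1) z *\<^sub>R rep_L2 f z)"
      by (rule integrable_mult_indicator[OF meas[OF that] integrable_rep])
    then show ?thesis
      by (subst (asm) Bochner_Integration.integrable_cong[OF refl]) (auto simp: indicator_def)
  qed
  have "Int_stable (Collect closed :: complex set set)" by (auto simp: Int_stable_def)
  moreover have "Collect closed \<subseteq> Pow (UNIV :: complex set)" by simp
  moreover have "A \<in> sigma_sets UNIV (Collect closed)"
    using A by (simp add: borel_eq_closed)
  ultimately show ?thesis
  proof (induction rule: sigma_sets_induct_disjoint)
    case (basic A)
    then show ?case using closed_set_integral_zero[OF coeff] by simp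
  next
    case empty
    then show ?case by simp
  next
    case (compl A)
    then have "A \<in> sets borel" by (simp add: borel_eq_closed)
    moreover have "(\<integral>z. indicator UNIV z *\<^sub>R rep_L2 f z \<partial>circle_measure) = 0"
      by (rule closed_set_integral_zero[OF coeff]) simp
    moreover have "(\<integral>z. indicator (UNIV - A) z *\<^sub>R rep_L2 f z \<partial>circle_measure) =
        (\<integral>z. indicator UNIV z *\<^sub>R rep_L2 f z - indicator A z *\<^sub>R rep_L2 f z \<partial>circle_measure)"
      by (intro Bochner_Integration.integral_cong) (auto simp: indicator_def)
    ultimately show ?case
      using ind[of A] integrable_rep[of f] compl by simp
  next
    case (union A)
    have Ab: "A i \<in> sets borel" for i using union(2) by (auto simp: borel_eq_closed)
    have eq: "(LINT z:(B \<inter> sphere 0 1)|circle_measure. rep_L2 f z) =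
        (\<integral>z. indicator B z *\<^sub>R rep_L2 f z \<partial>circle_measure)" for B
      unfolding set_lebesgue_integral_def
      by (intro Bochner_Integration.integral_cong) (auto simp: indicator_def)
    have "(LINT z:(\<Union>i. A i \<inter> sphere 0 1)|circle_measure. rep_L2 f z) =
        (\<Sum>i. LINT z:(A i \<inter> sphere 0 1)|circle_measure. rep_L2 f z)"
    proof (rule lebesgue_integral_countable_add)
      show "A i \<inter> sphere 0 1 \<in> sets circle_measure" for i by (rule meas[OF Ab])
      show "i \<noteq> j \<Longrightarrow> A i \<inter> sphere 0 1 \<inter> (A j \<inter> sphere 0 1) = {}" for i j
        using union(1) by (auto simp: disjoint_family_on_def)
      show "set_integrable circle_measure (\<Union>i. A i \<inter> sphere 0 1) (rep_L2 f)"
        unfolding set_integrable_def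
        by (intro integrable_mult_indicator integrable_rep sets.countable_UN) (use meas[OF Ab] in auto)
    qed
    also have "\<dots> = 0" using union(3) by (simp add: eq)
    finally show ?case using eq[of "\<Union>i. A i"] by simp
  qed
qed

theorem trig_complete:
  assumes "\<And>n. coeff_L2 f n = 0" shows "f = 0"
proof -
  have "AE z in circle_measure. rep_L2 f z = 0"
  proof (rule set_integral_zero_imp_AE_zero[OF integrable_rep])
    fix A assume "A \<in> sets circle_measure"
    then obtain B where B: "B \<in> sets borel" "A = sphere 0 1 \<inter> B"
      by (auto simp: sets_circle_measure sets_restrict_space)
    have "(\<integral>z. indicator A z *\<^sub>R rep_L2 f z \<partial>circle_measure) =
        (\<integral>z. indicator B z *\<^sub>R rep_L2 f z \<partial>circle_measure)"
      by (intro Bochner_Integration.integral_cong) (auto simp: B indicator_def)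
    then show "(\<integral>z. indicator A z *\<^sub>R rep_L2 f z \<partial>circle_measure) = 0"
      using borel_set_integral_zero[OF assms B(1)] by simp
  qed
  then show ?thesis
    using rep_zero by (intro L2_eqI, eventually_elim) simp
qed

lemma coeff_eqI:
  assumes "\<And>n. coeff_L2 f n = coeff_L2 g n" shows "f = g"
  using trig_complete[of "f - g"] assms by (simp add: coeff_diff)

subsection \<open>The Riesz projection\<close>

text \<open>Only the non-negative frequencies are summed: the limit is not \<open>f\<close> but its
  analytic part.\<close>

definition psum :: "L2 \<Rightarrow> nat \<Rightarrow> L2" where
  "psum f N = (\<Sum>k<N. coeff_L2 f (int k) *\<^sub>C trig (int k))"

lemma norm_trig_sum:
  assumes "finite I"
  shows "(norm (\<Sum>k\<in>I. c k *\<^sub>C trig (int k)))\<^sup>2 = (\<Sum>k\<in>I. (cmod (c k))\<^sup>2)"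
  using assms
proof (induction I rule: finite_induct)
  case (insert m I)
  have "\<langle>\<Sum>k\<in>I. c k *\<^sub>C trig (int k), c m *\<^sub>C trig (int m)\<rangle> = 0"
    unfolding cinner_sum_left
    by (intro sum.neutral ballI) (use insert in \<open>auto simp: cinner_simps cinner_trig_trig\<close>)
  then have "\<langle>c m *\<^sub>C trig (int m), \<Sum>k\<in>I. c k *\<^sub>C trig (int k)\<rangle> = 0"
    by (metis cinner_commute complex_cnj_zero)
  from norm_square_add_orthogonal[OF this] show ?case
    using insert by (simp add: norm_scaleC)
qed simp

lemma coeff_psum: "coeff_L2 (psum f N) n = (if 0 \<le> n \<and> n < int N then coeff_L2 f n else 0)"
proof (cases "0 \<le> n \<and> n < int N")
  case True
  then obtain m where m: "n = int m" "m < N" by (metis nat_0_le of_nat_less_iff)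
  have "coeff_L2 (psum f N) n = (\<Sum>k<N. if k = m then coeff_L2 f (int k) else 0)"
    unfolding psum_def coeff_sum by (intro sum.cong) (auto simp: coeff_simps coeff_trig m)
  then show ?thesis using m by simp
next
  case False
  then show ?thesis
    unfolding psum_def coeff_sum by (intro trans[OF sum.neutral]) (auto simp: coeff_simps coeff_trig)
qed

lemma Bessel_psum: "(\<Sum>k<N. (cmod (coeff_L2 f (int k)))\<^sup>2) \<le> (norm f)\<^sup>2"
proof -
  have "\<langle>psum f N, f - psum f N\<rangle> = 0"
    unfolding psum_def[of f N, THEN arg_cong, of "\<lambda>x. \<langle>x, f - psum f N\<rangle>"] cinner_sum_left
  proof (intro sum.neutral ballI)
    fix k assume k: "k \<in> {..<N}"
    have "coeff_L2 (f - psum f N) (int k) = 0"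
      using k by (simp add: coeff_diff coeff_psum)
    then have "\<langle>trig (int k), f - psum f N\<rangle> = 0"
      by (metis cinner_commute coeff_L2_def complex_cnj_zero)
    then show "\<langle>coeff_L2 f (int k) *\<^sub>C trig (int k), f - psum f N\<rangle> = 0"
      by (simp add: cinner_scale_left)
  qed
  from norm_square_add_orthogonal[OF this]
  have "(norm (psum f N))\<^sup>2 \<le> (norm f)\<^sup>2" by simp
  then show ?thesis by (simp add: psum_def norm_trig_sum)
qed

lemma convergent_psum: "convergent (psum f)"
proof (rule L2_complete, rule CauchyI)
  fix e :: real assume e: "e > 0"
  have s: "summable (\<lambda>k. (cmod (coeff_L2 f (int k)))\<^sup>2)"
    using Bessel_psum[of f] by (intro summableI_nonneg_bounded) auto
  obtain M where M: "\<And>m n. m \<ge> M \<Longrightarrow> norm (\<Sum>k=m..<n. (cmod (coeff_L2 f (int k)))\<^sup>2) < e\<^sup>2"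
    using s[unfolded summable_Cauchy] e by (meson zero_less_power)
  have *: "norm (psum f n - psum f m) < e" if "M \<le> m" "m \<le> n" for m n
  proof -
    have "psum f n - psum f m = (\<Sum>k=m..<n. coeff_L2 f (int k) *\<^sub>C trig (int k))"
      unfolding psum_def lessThan_atLeast0 using that by (subst sum_diff_nat_ivl) auto
    then have "(norm (psum f n - psum f m))\<^sup>2 = (\<Sum>k=m..<n. (cmod (coeff_L2 f (int k)))\<^sup>2)"
      by (simp add: norm_trig_sum)
    also have "\<dots> < e\<^sup>2" using M[of m n] that by (simp add: sum_nonneg)
    finally show ?thesis by (rule power2_less_imp_less) (use e in simp)
  qed
  show "\<exists>M. \<forall>m\<ge>M. \<forall>n\<ge>M. norm (psum f m - psum f n) < e"
  proof (intro exI[of _ M] allI impI)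
    fix m n assume "M \<le> m" "M \<le> n"
    then show "norm (psum f m - psum f n) < e"
      using *[of m n] *[of n m] by (cases "m \<le> n") (auto simp: norm_minus_commute)
  qed
qed

definition riesz :: "L2 \<Rightarrow> L2" where
  "riesz f = lim (psum f)"

lemma psum_tendsto_riesz: "psum f \<longlonglongrightarrow> riesz f"
  unfolding riesz_def using convergent_psum by (simp add: convergent_LIMSEQ_iff)

lemma coeff_riesz: "coeff_L2 (riesz f) n = (if n \<ge> 0 then coeff_L2 f n else 0)"
proof -
  have lim: "(\<lambda>N. coeff_L2 (psum f N) n) \<longlonglongrightarrow> coeff_L2 (riesz f) n"
    by (intro tendsto_coeff psum_tendsto_riesz)
  have ev: "\<forall>\<^sub>F N in sequentially. coeff_L2 (psum f N) n = (if n \<ge> 0 then coeff_L2 f n else 0)"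
    by (rule eventually_sequentiallyI[of "nat n + 1"]) (auto simp: coeff_psum)
  show ?thesis by (rule LIMSEQ_unique[OF lim tendsto_eventually[OF ev]])
qed

text \<open>The Fourier description of the Hardy space, which replaces \<open>H2\<close> from
  \<open>H2_eq\<close> on.\<close>

definition analytic_L2 :: "L2 set" where
  "analytic_L2 = {f. \<forall>n<0. coeff_L2 f n = 0}"

lemma riesz_analytic [simp]: "riesz f \<in> analytic_L2"
  by (simp add: analytic_L2_def coeff_riesz)

lemma psum_tendsto:
  assumes "f \<in> analytic_L2" shows "psum f \<longlonglongrightarrow> f"
proof -
  have "riesz f = f" using assms by (intro coeff_eqI) (auto simp: coeff_riesz analytic_L2_def)
  then show ?thesis using psum_tendsto_riesz[of f] by simp
qed

section \<open>Hardy spaces\<close>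

subsection \<open>Dilations and boundary values\<close>

lemma eventually_at_left_1: "\<forall>\<^sub>F r in at_left (1::real). 0 < r \<and> r < 1"
  using eventually_at_left_real[of 0 1] by simp

context
  fixes F :: "complex \<Rightarrow> complex" and r :: real
  assumes F: "F holomorphic_on ball 0 1" and r: "0 \<le> r" "r < 1"
begin

lemma continuous_on_dilation: "continuous_on (sphere 0 1) (\<lambda>z. F (of_real r * z))"
proof (rule continuous_on_compose2[OF holomorphic_on_imp_continuous_on[OF F]])
  show "(\<lambda>z. complex_of_real r * z) ` sphere 0 1 \<subseteq> ball 0 1"
    using r by (auto simp: norm_mult)
qed (intro continuous_intros)

lemma measurable_dilation: "(\<lambda>z. F (of_real r * z)) \<in> borel_measurable circle_measure"
  unfolding measurable_cong_sets[OF sets_circle_measure refl]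
  by (rule borel_measurable_continuous_on_restrict[OF continuous_on_dilation])

lemma sq_integrable_dilation: "sq_integrable (\<lambda>z. F (of_real r * z))"
proof -
  have "bounded ((\<lambda>z. F (of_real r * z)) ` sphere 0 1)"
    by (intro compact_imp_bounded compact_continuous_image continuous_on_dilation) auto
  then obtain M where "\<forall>z\<in>sphere 0 1. cmod (F (of_real r * z)) \<le> M"
    by (auto simp: bounded_iff)
  then show ?thesis
    by (intro sq_integrable_bounded[OF measurable_dilation, of M] AE_I2) simp
qed

lemma rep_dilation: "AE z in circle_measure. rep_L2 (dilation F r) z = F (of_real r * z)"
  unfolding dilation_def by (rule rep_to_L2[OF sq_integrable_dilation])

text \<open>On the circle of radius \<open>r < 1\<close> the power series converges absolutely and
  uniformly, so it may be integrated term by term against \<open>z powi n\<close>.\<close>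

lemma coeff_dilation:
  assumes a: "\<And>w. w \<in> ball 0 1 \<Longrightarrow> (\<lambda>k. a k * w ^ k) sums F w"
  shows "coeff_L2 (dilation F r) n = (if n \<ge> 0 then of_real r ^ nat n * a (nat n) else 0)"
proof -
  define g where "g k z = a k * (of_real r * z) ^ k * cnj (z powi n)" for k z
  have g: "cmod (g k z) = cmod (a k * of_real r ^ k)" if "cmod z = 1" for k z
    using that by (simp add: g_def norm_mult norm_power norm_power_int)
  have sm: "summable (\<lambda>k. cmod (a k * of_real r ^ k))"
  proof (rule powser_insidea)
    \<comment> \<open>The point \<open>(1 + r) / 2\<close> lies strictly between \<open>r\<close>
      and 1, and convergence there gives absolute convergence at \<open>r\<close>.\<close>
    show "summable (\<lambda>k. a k * of_real ((1 + r) / 2) ^ k)"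
      using a[of "of_real ((1 + r) / 2)"] r by (intro sums_summable) (auto simp del: of_real_divide of_real_add)
  qed (use r in \<open>auto simp del: of_real_divide of_real_add\<close>)
  have gk: "g k z = (a k * of_real r ^ k) * z powi (int k - n)" if "cmod z = 1" for k z
  proof -
    have "z \<noteq> 0" using that by auto
    then show ?thesis
      using that by (simp add: g_def sphere_power_int power_int_add power_mult_distrib power_int_diff
        power_int_minus divide_inverse del: complex_cnj_power_int)
  qed
  have int: "integrable circle_measure (g k)" for k
  proof -
    have "integrable circle_measure (\<lambda>z. (a k * of_real r ^ k) * z powi (int k - n))"
    proof (rule integrable_mult_right)
      have "integrable circle_measure (\<lambda>z. (z powi (int k - n)) * cnj 1)"
        by (intro sq_integrable_mult_integrable sq_integrable_powi) (simp add: sq_integrable_def)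
      then show "integrable circle_measure (\<lambda>z. z powi (int k - n))" by simp
    qed
    then show ?thesis
      by (subst Bochner_Integration.integrable_cong[OF refl]) (auto simp: gk)
  qed
  have intg: "(\<integral>z. g k z \<partial>circle_measure) = (if n = int k then a k * of_real r ^ k else 0)" for k
  proof -
    have "(\<integral>z. g k z \<partial>circle_measure) = (\<integral>z. (a k * of_real r ^ k) * z powi (int k - n) \<partial>circle_measure)"
      by (intro Bochner_Integration.integral_cong) (auto simp: gk)
    then show ?thesis by (simp add: circle_integral_power_int)
  qed
  have "coeff_L2 (dilation F r) n = (\<integral>z. F (of_real r * z) * cnj (z powi n) \<partial>circle_measure)"
    unfolding coeff_L2_def cinner_rep
  proof (rule integral_cong_AE)
    show "AE z in circle_measure. rep_L2 (dilation F r) z * cnj (rep_L2 (trig n) z) =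
        F (of_real r * z) * cnj (z powi n)"
      using rep_dilation rep_trig[of n] by eventually_elim simp
    show "(\<lambda>z. F (of_real r * z) * cnj (z powi n)) \<in> borel_measurable circle_measure"
      by (intro borel_measurable_integrable sq_integrable_mult_integrable sq_integrable_dilation
          sq_integrable_powi)
  qed measurable
  also have "\<dots> = (\<integral>z. (\<Sum>k. g k z) \<partial>circle_measure)"
  proof (intro Bochner_Integration.integral_cong refl)
    fix z assume "z \<in> space circle_measure"
    then have "of_real r * z \<in> ball 0 1" using r by (simp add: norm_mult)
    from sums_mult2[OF a[OF this], of "cnj (z powi n)"]
    show "F (of_real r * z) * cnj (z powi n) = (\<Sum>k. g k z)"
      by (simp add: g_def sums_iff)
  qed
  also have "\<dots> = (\<Sum>k. \<integral>z. g k z \<partial>circle_measure)"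
  proof (rule integral_suminf[OF int])
    show "AE z in circle_measure. summable (\<lambda>k. norm (g k z))"
      using sm by (intro AE_I2) (simp add: g)
    have "(\<integral>z. norm (g k z) \<partial>circle_measure) = (\<integral>z. cmod (a k * of_real r ^ k) \<partial>circle_measure)" for k
      by (intro Bochner_Integration.integral_cong) (auto simp: g)
    then show "summable (\<lambda>k. \<integral>z. norm (g k z) \<partial>circle_measure)"
      using sm by simp
  qed
  also have "\<dots> = (if n \<ge> 0 then of_real r ^ nat n * a (nat n) else 0)"
  proof (cases "n \<ge> 0")
    case True
    then have "(\<lambda>k. \<integral>z. g k z \<partial>circle_measure) =
        (\<lambda>k. if k = nat n then a k * of_real r ^ k else 0)"
      by (auto simp: intg)
    then show ?thesis
      using True sums_single[of "nat n" "\<lambda>k. a k * of_real r ^ k"] by (simp add: sums_iff mult.commute)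
  next
    case False
    then have "(\<lambda>k. \<integral>z. g k z \<partial>circle_measure) = (\<lambda>k. 0)"
      by (auto simp: intg)
    then show ?thesis using False by simp
  qed
  finally show ?thesis .
qed

end

lemma holomorphic_sums:
  assumes "F holomorphic_on ball 0 1" "w \<in> ball 0 1"
  shows "(\<lambda>k. (deriv ^^ k) F 0 / fact k * w ^ k) sums F w"
  using holomorphic_power_series[OF assms] by simp

lemma boundary_values_analytic:
  assumes F: "F holomorphic_on ball 0 1" and f: "has_boundary_values F f"
  shows "f \<in> analytic_L2" and "coeff_L2 f 0 = F 0"
proof -
  have lim: "((\<lambda>r. coeff_L2 (dilation F r) n) \<longlongrightarrow> coeff_L2 f n) (at_left 1)" for n
    using f unfolding has_boundary_values_def by (intro tendsto_coeff)
  have c: "coeff_L2 (dilation F r) n =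
      (if n \<ge> 0 then of_real r ^ nat n * ((deriv ^^ nat n) F 0 / fact (nat n)) else 0)"
    if "0 < r \<and> r < 1" for r n
    using that by (intro coeff_dilation[OF F] holomorphic_sums[OF F]) auto
  have "coeff_L2 f n = 0" if "n < 0" for n
  proof -
    have "((\<lambda>r. coeff_L2 (dilation F r) n) \<longlongrightarrow> 0) (at_left 1)"
      by (rule tendsto_eventually, rule eventually_mono[OF eventually_at_left_1])
         (use that in \<open>simp add: c\<close>)
    with lim[of n] show ?thesis by (rule tendsto_unique[rotated]) simp
  qed
  then show "f \<in> analytic_L2" by (simp add: analytic_L2_def)
  have "((\<lambda>r. coeff_L2 (dilation F r) 0) \<longlongrightarrow> F 0) (at_left 1)"
    by (rule tendsto_eventually, rule eventually_mono[OF eventually_at_left_1]) (simp add: c)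
  with lim[of 0] show "coeff_L2 f 0 = F 0" by (rule tendsto_unique[rotated]) simp
qed

lemma norm_square_le_coeff:
  assumes "g \<in> analytic_L2" "\<And>N. (\<Sum>k<N. (cmod (coeff_L2 g (int k)))\<^sup>2) \<le> B"
  shows "(norm g)\<^sup>2 \<le> B"
proof (rule LIMSEQ_le_const2)
  show "(\<lambda>N. (norm (psum g N))\<^sup>2) \<longlonglongrightarrow> (norm g)\<^sup>2"
    by (intro tendsto_intros psum_tendsto assms)
  show "\<exists>N. \<forall>n\<ge>N. (norm (psum g n))\<^sup>2 \<le> B"
    using assms(2) by (auto simp: psum_def norm_trig_sum)
qed

lemma analytic_add: "f \<in> analytic_L2 \<Longrightarrow> g \<in> analytic_L2 \<Longrightarrow> f + g \<in> analytic_L2"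
  and analytic_diff: "f \<in> analytic_L2 \<Longrightarrow> g \<in> analytic_L2 \<Longrightarrow> f - g \<in> analytic_L2"
  and analytic_scale: "f \<in> analytic_L2 \<Longrightarrow> c *\<^sub>C f \<in> analytic_L2"
  and analytic_zero: "0 \<in> analytic_L2"
  by (simp_all add: analytic_L2_def coeff_simps)

lemma analytic_trig: "n \<ge> 0 \<Longrightarrow> trig n \<in> analytic_L2"
  by (simp add: analytic_L2_def coeff_trig)

text \<open>The power series with the Fourier coefficients of \<open>f\<close> has dilations whose
  coefficients are multiplied by \<open>r ^ k\<close>. Hence their norms are at most that of
  \<open>f\<close>. For the convergence, the tail beyond a suitable \<open>N\<close> is small
  uniformly in \<open>r\<close>, while the finitely many remaining terms tend to 0 as
  \<open>r\<close> tends to 1.\<close>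

lemma analytic_imp_H2:
  assumes f: "f \<in> analytic_L2" shows "f \<in> H2"
proof -
  define c where "c k = coeff_L2 f (int k)" for k
  define F where "F w = (\<Sum>k. c k * w ^ k)" for w
  have c: "cmod (c k) \<le> norm f" for k
    using cinner_Cauchy_Schwarz[of f "trig (int k)"] by (simp add: c_def coeff_L2_def)
  have sums: "(\<lambda>k. c k * w ^ k) sums F w" if "w \<in> ball 0 1" for w
  proof -
    have "summable (\<lambda>k. norm f * cmod w ^ k)"
      using that by (intro summable_mult summable_geometric) simp
    then have "summable (\<lambda>k. c k * w ^ k)"
      by (rule summable_comparison_test') (auto simp: norm_mult norm_power intro!: mult_right_mono c)
    then show ?thesis by (simp add: F_def summable_sums)
  qed
  have F: "F holomorphic_on ball 0 1"
    by (rule power_series_holomorphic[of 0 1 c]) (use sums in simp)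
  have cd: "coeff_L2 (dilation F r) n = (if n \<ge> 0 then of_real r ^ nat n * c (nat n) else 0)"
    if "0 \<le> r" "r < 1" for r n
    using that by (intro coeff_dilation[OF F] sums)
  have an: "dilation F r \<in> analytic_L2" if "0 \<le> r" "r < 1" for r
    using that by (simp add: analytic_L2_def cd)
  have s: "summable (\<lambda>k. (cmod (c k))\<^sup>2)"
    using Bessel_psum[of f] unfolding c_def by (intro summableI_nonneg_bounded) auto
  have bound: "norm (dilation F r) \<le> norm f" if "0 \<le> r" "r < 1" for r
  proof (rule power2_le_imp_le, rule norm_square_le_coeff[OF an[OF that]])
    fix N
    have "(\<Sum>k<N. (cmod (coeff_L2 (dilation F r) (int k)))\<^sup>2) \<le> (\<Sum>k<N. (cmod (c k))\<^sup>2)"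
    proof (intro sum_mono power_mono)
      fix k
      show "cmod (coeff_L2 (dilation F r) (int k)) \<le> cmod (c k)"
        using that by (simp add: cd norm_mult norm_power mult_left_le_one_le power_le_one)
    qed simp
    also have "\<dots> \<le> (norm f)\<^sup>2" using Bessel_psum[of f N] by (simp add: c_def)
    finally show "(\<Sum>k<N. (cmod (coeff_L2 (dilation F r) (int k)))\<^sup>2) \<le> (norm f)\<^sup>2" .
  qed simp
  have "(dilation F \<longlongrightarrow> f) (at_left 1)"
  proof (rule tendstoI)
    fix e :: real assume e: "e > 0"
    then obtain N where "norm (\<Sum>i. (cmod (c (i + N)))\<^sup>2) < e\<^sup>2 / 2"
      using suminf_exist_split[OF _ s, of "e\<^sup>2/2"] by (auto simp del: real_norm_def)
    then have N: "(\<Sum>i. (cmod (c (i + N)))\<^sup>2) < e\<^sup>2 / 2" by simp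
    have tail: "(\<Sum>k\<in>{N..<M}. (cmod (c k))\<^sup>2) \<le> (\<Sum>i. (cmod (c (i + N)))\<^sup>2)" for M
    proof -
      have "(\<Sum>k\<in>{N..<M}. (cmod (c k))\<^sup>2) \<le> (\<Sum>i<M. (cmod (c (i + N)))\<^sup>2)"
      proof (rule sum_le_included[where i = "\<lambda>i. i + N"])
        show "\<forall>k\<in>{N..<M}. \<exists>i\<in>{..<M}. i + N = k \<and> (cmod (c k))\<^sup>2 \<le> (cmod (c (i + N)))\<^sup>2"
        proof
          fix k assume "k \<in> {N..<M}"
          then show "\<exists>i\<in>{..<M}. i + N = k \<and> (cmod (c k))\<^sup>2 \<le> (cmod (c (i + N)))\<^sup>2"
            by (intro bexI[of _ "k - N"]) auto
        qed
      qed auto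
      also have "\<dots> \<le> (\<Sum>i. (cmod (c (i + N)))\<^sup>2)"
        by (intro sum_le_suminf summable_ignore_initial_segment s) auto
      finally show ?thesis .
    qed
    define q where "q r = (\<Sum>k<N. ((1 - r ^ k) * cmod (c k))\<^sup>2)" for r :: real
    have "(q \<longlongrightarrow> (\<Sum>k<N. ((1 - 1 ^ k) * cmod (c k))\<^sup>2)) (at_left 1)"
      unfolding q_def by (intro tendsto_intros)
    then have "(q \<longlongrightarrow> 0) (at_left 1)" by simp
    then have "\<forall>\<^sub>F r in at_left 1. q r < e\<^sup>2 / 2"
      by (rule order_tendstoD) (use e in simp)
    with eventually_at_left_1
    show "\<forall>\<^sub>F r in at_left 1. dist (dilation F r) f < e"
    proof eventually_elim
      case (elim r)
      then have r: "0 \<le> r" "r < 1" by auto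
      have ck: "cmod (coeff_L2 (dilation F r - f) (int k)) = (1 - r ^ k) * cmod (c k)" for k
      proof -
        have "coeff_L2 (dilation F r - f) (int k) = of_real (r ^ k - 1) * c k"
          using r by (simp add: coeff_diff cd) (simp add: c_def algebra_simps)
        also have "cmod \<dots> = \<bar>r ^ k - 1\<bar> * cmod (c k)" by (simp only: norm_mult norm_of_real)
        also have "\<bar>r ^ k - 1\<bar> = 1 - r ^ k" using power_le_one[of r k] r by simp
        finally show ?thesis .
      qed
      have "(norm (dilation F r - f))\<^sup>2 \<le> q r + (\<Sum>i. (cmod (c (i + N)))\<^sup>2)"
      proof (rule norm_square_le_coeff[OF analytic_diff[OF an[OF r] f]])
        fix M
        have "(\<Sum>k<M. (cmod (coeff_L2 (dilation F r - f) (int k)))\<^sup>2) \<le>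
            (\<Sum>k\<in>{..<N} \<union> {N..<M}. (cmod (coeff_L2 (dilation F r - f) (int k)))\<^sup>2)"
          by (intro sum_mono2) auto
        also have "\<dots> = q r + (\<Sum>k\<in>{N..<M}. ((1 - r ^ k) * cmod (c k))\<^sup>2)"
          unfolding q_def ck by (intro sum.union_disjoint) auto
        also have "(\<Sum>k\<in>{N..<M}. ((1 - r ^ k) * cmod (c k))\<^sup>2) \<le> (\<Sum>k\<in>{N..<M}. (cmod (c k))\<^sup>2)"
          using r by (intro sum_mono power_mono) (auto simp: mult_left_le_one_le power_le_one)
        finally show "(\<Sum>k<M. (cmod (coeff_L2 (dilation F r - f) (int k)))\<^sup>2) \<le>
            q r + (\<Sum>i. (cmod (c (i + N)))\<^sup>2)"
          using tail[of M] by linarith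
      qed
      also have "\<dots> < e\<^sup>2" using elim N by linarith
      finally have "norm (dilation F r - f) < e" by (rule power2_less_imp_less) (use e in simp)
      then show ?case by (simp add: dist_norm)
    qed
  qed
  then show ?thesis
    unfolding H2_def has_boundary_values_def using F bound by (auto intro!: exI[of _ F] exI[of _ "norm f"])
qed

theorem H2_eq: "H2 = analytic_L2"
  using analytic_imp_H2 boundary_values_analytic(1) unfolding H2_def by blast

lemma Hinf_analytic: "f \<in> Hinf \<Longrightarrow> f \<in> analytic_L2"
  using boundary_values_analytic(1) unfolding Hinf_def by blast

lemma Hinf_bounded:
  assumes "f \<in> Hinf" shows "bounded_L2 f"
proof -
  obtain F M where F: "F holomorphic_on ball 0 1" "\<And>w. w \<in> ball 0 1 \<Longrightarrow> cmod (F w) \<le> M"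
    and lim: "(dilation F \<longlongrightarrow> f) (at_left 1)"
    using assms unfolding Hinf_def has_boundary_values_def bounded_iff by blast
  \<comment> \<open>The excess of \<open>|f|\<close> over the bound \<open>M\<close> of
    \<open>F\<close>. Pointwise it is at most the distance from \<open>F (r z)\<close> to
    \<open>f z\<close>, so its norm is below the norm of \<open>dilation F r - f\<close> for every
    \<open>r\<close> and must vanish.\<close>
  define h where "h z = complex_of_real (max 0 (cmod (rep_L2 f z) - M))" for z
  have hm: "h \<in> borel_measurable circle_measure" unfolding h_def by measurable
  have sq: "sq_integrable h"
  proof -
    have "integrable circle_measure (\<lambda>z. 2 * (cmod (rep_L2 f z))\<^sup>2 + 2 * M\<^sup>2)"
      using integrable_rep_square[of f] by auto
    then have "integrable circle_measure (\<lambda>z. (cmod (h z))\<^sup>2)"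
    proof (rule Bochner_Integration.integrable_bound)
      have "(cmod (h z))\<^sup>2 \<le> 2 * (cmod (rep_L2 f z))\<^sup>2 + 2 * M\<^sup>2" for z
      proof -
        have "(cmod (h z))\<^sup>2 \<le> (cmod (rep_L2 f z) - M)\<^sup>2"
          by (auto simp: h_def max_def)
        also have "\<dots> \<le> 2 * (cmod (rep_L2 f z))\<^sup>2 + 2 * M\<^sup>2"
          using zero_le_power2[of "cmod (rep_L2 f z) + M"]
          by (simp add: power2_diff power2_sum)
        finally show ?thesis .
      qed
      then show "AE z in circle_measure. norm ((cmod (h z))\<^sup>2) \<le>
          norm (2 * (cmod (rep_L2 f z))\<^sup>2 + 2 * M\<^sup>2)" by auto
    qed (use hm in measurable)
    then show ?thesis using hm by (simp add: sq_integrable_def)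
  qed
  have "norm (to_L2 h) \<le> norm (dilation F r - f)" if r: "0 < r" "r < 1" for r
  proof -
    have "AE z in circle_measure. cmod (rep_L2 (to_L2 h) z) \<le> 1 * cmod (rep_L2 (dilation F r - f) z)"
      using rep_to_L2[OF sq] rep_diff[of "dilation F r" f] rep_dilation[OF F(1) less_imp_le[OF r(1)] r(2)] AE_circle_norm
    proof eventually_elim
      case (elim z)
      have "cmod (F (of_real r * z)) \<le> M" using elim r by (intro F(2)) (simp add: norm_mult)
      moreover have "cmod (rep_L2 f z) - cmod (F (of_real r * z)) \<le> cmod (F (of_real r * z) - rep_L2 f z)"
        by (metis norm_minus_commute norm_triangle_ineq2)
      ultimately show ?case using elim r by (simp add: h_def)
    qed
    then show ?thesis using norm_mono_AE[of 1] by simp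
  qed
  then have "\<forall>\<^sub>F r in at_left 1. norm (to_L2 h) \<le> norm (dilation F r - f)"
    using eventually_at_left_1 by (auto elim: eventually_mono)
  moreover have "((\<lambda>r. norm (dilation F r - f)) \<longlongrightarrow> 0) (at_left 1)"
    using lim by (simp add: LIM_zero tendsto_norm_zero)
  ultimately have "norm (to_L2 h) \<le> 0"
    by (intro tendsto_le[OF _ _ tendsto_const]) (auto simp: trivial_limit_at_left_real)
  then have "to_L2 h = 0" by simp
  then have "AE z in circle_measure. cmod (rep_L2 f z) \<le> M"
    using rep_to_L2[OF sq] rep_zero by (auto simp: h_def elim!: AE_mp split: if_splits)
  then show ?thesis unfolding bounded_L2_def by blast
qed

subsection \<open>Closure properties of bounded analytic functions\<close>

lemma HinfE:
  assumes "f \<in> Hinf"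
  obtains F where "F holomorphic_on ball 0 1" "bounded (F ` ball 0 1)"
    "(dilation F \<longlongrightarrow> f) (at_left 1)" "coeff_L2 f 0 = F 0"
  using assms boundary_values_analytic(2) unfolding Hinf_def has_boundary_values_def by blast

lemma HinfI:
  assumes "F holomorphic_on ball 0 1" "bounded (F ` ball 0 1)"
    "(D \<longlongrightarrow> f) (at_left 1)"
    "\<And>r. 0 < r \<Longrightarrow> r < 1 \<Longrightarrow> dilation F r = D r"
  shows "f \<in> Hinf"
proof -
  have "(dilation F \<longlongrightarrow> f) (at_left 1)"
  proof (rule Lim_transform_eventually[OF assms(3)])
    show "\<forall>\<^sub>F r in at_left 1. D r = dilation F r"
      using eventually_at_left_1 by eventually_elim (use assms(4) in auto)
  qed
  with assms show ?thesis unfolding Hinf_def has_boundary_values_def by blast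
qed

lemma Hinf_add:
  assumes "f \<in> Hinf" "g \<in> Hinf" shows "f + g \<in> Hinf"
proof -
  obtain F where F: "F holomorphic_on ball 0 1" "bounded (F ` ball 0 1)"
    "(dilation F \<longlongrightarrow> f) (at_left 1)" using HinfE[OF assms(1)] by blast
  obtain G where G: "G holomorphic_on ball 0 1" "bounded (G ` ball 0 1)"
    "(dilation G \<longlongrightarrow> g) (at_left 1)" using HinfE[OF assms(2)] by blast
  have h: "(\<lambda>w. F w + G w) holomorphic_on ball 0 1" by (intro holomorphic_intros F G)
  show ?thesis
  proof (rule HinfI[OF h bounded_plus_comp[OF F(2) G(2)] tendsto_add[OF F(3) G(3)]])
    fix r :: real assume r: "0 < r" "r < 1"
    show "dilation (\<lambda>w. F w + G w) r = dilation F r + dilation G r"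
      using rep_dilation[OF h less_imp_le[OF r(1)] r(2)] rep_dilation[OF F(1) less_imp_le[OF r(1)] r(2)] rep_dilation[OF G(1) less_imp_le[OF r(1)] r(2)]
        rep_add[of "dilation F r" "dilation G r"]
      by (intro L2_eqI, eventually_elim) simp
  qed
qed

lemma Hinf_scale:
  assumes "f \<in> Hinf" shows "c *\<^sub>C f \<in> Hinf"
proof -
  obtain F where F: "F holomorphic_on ball 0 1" "bounded (F ` ball 0 1)"
    "(dilation F \<longlongrightarrow> f) (at_left 1)" using HinfE[OF assms(1)] by blast
  have h: "(\<lambda>w. c * F w) holomorphic_on ball 0 1" by (intro holomorphic_intros F)
  have b: "bounded ((\<lambda>w. c * F w) ` ball 0 1)"
    using bounded_linear_image[OF F(2) bounded_linear_mult_right[of c]]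
    by (simp add: image_image)
  show ?thesis
  proof (rule HinfI[OF h b tendsto_scaleC[OF F(3)]])
    fix r :: real assume r: "0 < r" "r < 1"
    show "dilation (\<lambda>w. c * F w) r = c *\<^sub>C dilation F r"
      using rep_dilation[OF h less_imp_le[OF r(1)] r(2)] rep_dilation[OF F(1) less_imp_le[OF r(1)] r(2)] rep_scale[of c "dilation F r"]
      by (intro L2_eqI, eventually_elim) simp
  qed
qed

lemma Hinf_diff: "f \<in> Hinf \<Longrightarrow> g \<in> Hinf \<Longrightarrow> f - g \<in> Hinf"
  using Hinf_add[of f "(-1) *\<^sub>C g"] Hinf_scale[of g "-1"] by (simp add: uminus_L2[symmetric])

lemma Hinf_one: "trig 0 \<in> Hinf"
proof (rule HinfI[of "\<lambda>_. 1" "\<lambda>_. trig 0"])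
  show "dilation (\<lambda>_. 1) r = trig 0" for r by (simp add: dilation_def trig_def)
qed (auto intro: finite_imp_bounded finite_subset[of _ "{1}"])

lemma Hinf_shift:
  assumes "f \<in> Hinf" shows "trig 1 \<odot> f \<in> Hinf"
proof -
  obtain F where F: "F holomorphic_on ball 0 1" "bounded (F ` ball 0 1)"
    "(dilation F \<longlongrightarrow> f) (at_left 1)" using HinfE[OF assms(1)] by blast
  have h: "(\<lambda>w. w * F w) holomorphic_on ball 0 1" by (intro holomorphic_intros F)
  obtain M where M: "\<And>w. w \<in> ball 0 1 \<Longrightarrow> cmod (F w) \<le> M"
    using F(2) unfolding bounded_iff by blast
  have "cmod (w * F w) \<le> M" if "w \<in> ball 0 1" for w
    using M[OF that] that mult_left_le_one_le[of "cmod (F w)" "cmod w"] by (simp add: norm_mult)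
  then have b: "bounded ((\<lambda>w. w * F w) ` ball 0 1)" unfolding bounded_iff by blast
  have lim: "((\<lambda>r. r *\<^sub>R (trig 1 \<odot> dilation F r)) \<longlongrightarrow> 1 *\<^sub>R (trig 1 \<odot> f)) (at_left 1)"
    by (intro tendsto_intros tendsto_mult_L2 F) simp
  show ?thesis
  proof (rule HinfI[OF h b lim[unfolded scaleR_one]])
    fix r :: real assume r: "0 < r" "r < 1"
    show "dilation (\<lambda>w. w * F w) r = r *\<^sub>R (trig 1 \<odot> dilation F r)"
      using rep_dilation[OF h less_imp_le[OF r(1)] r(2)] rep_dilation[OF F(1) less_imp_le[OF r(1)] r(2)] rep_trig[of 1]
        rep_mult[OF disjI1[OF bounded_L2_trig], of 1 "dilation F r"]
        rep_scale[of "of_real r" "trig 1 \<odot> dilation F r"]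
      unfolding scaleR_L2_def
      by (intro L2_eqI, eventually_elim) simp
  qed
qed

text \<open>The extension to the disc is the difference quotient of \<open>F\<close> at 0, whose
  singularity is removable. It is bounded on the closed disc of radius 1/2 by compactness, and
  outside it because the denominator is at least 1/2.\<close>

lemma Hinf_backward_shift:
  assumes "f \<in> Hinf"
  shows "trig (- 1) \<odot> (f - coeff_L2 f 0 *\<^sub>C trig 0) \<in> Hinf"
proof -
  obtain F where F: "F holomorphic_on ball 0 1" "bounded (F ` ball 0 1)"
    "(dilation F \<longlongrightarrow> f) (at_left 1)" "coeff_L2 f 0 = F 0"
    using HinfE[OF assms(1)] by blast
  define G where "G z = (if z = 0 then deriv F 0 else (F z - F 0) / (z - 0))" for z
  have h: "G holomorphic_on ball 0 1"
    unfolding G_def by (rule pole_lemma_open[OF F(1)]) simp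
  obtain M where M: "\<And>w. w \<in> ball 0 1 \<Longrightarrow> cmod (F w) \<le> M"
    using F(2) unfolding bounded_iff by blast
  have "compact (G ` cball 0 (1/2))"
    by (intro compact_continuous_image continuous_on_subset[OF holomorphic_on_imp_continuous_on[OF h]]) auto
  then have "bounded (G ` cball 0 (1/2))" by (rule compact_imp_bounded)
  then obtain N where N: "\<And>w. w \<in> cball 0 (1/2) \<Longrightarrow> cmod (G w) \<le> N"
    unfolding bounded_iff by blast
  have "cmod (G w) \<le> max N (4 * M)" if w: "w \<in> ball 0 1" for w
  proof (cases "w \<in> cball 0 (1/2)")
    case True
    then show ?thesis using N by (simp add: le_max_iff_disj)
  next
    case False
    then have w2: "cmod w \<ge> 1/2" by simp
    have "cmod (F w - F 0) \<le> M + M"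
      using M[OF w] M[of 0] by (intro norm_triangle_le_diff) auto
    moreover have "4 * M * cmod w \<ge> 4 * M * (1/2)"
      using w2 M[of 0] norm_ge_zero[of "F 0"] by (intro mult_left_mono) (auto simp del: norm_ge_zero)
    ultimately have "cmod (F w - F 0) / cmod w \<le> 4 * M"
      using w2 by (subst pos_divide_le_eq) linarith+
    moreover have "cmod (G w) = cmod (F w - F 0) / cmod w"
      using w2 by (auto simp: G_def norm_divide)
    ultimately show ?thesis by simp
  qed
  then have b: "bounded (G ` ball 0 1)" unfolding bounded_iff by blast
  have lim: "((\<lambda>r. inverse r *\<^sub>R (trig (- 1) \<odot> (dilation F r - F 0 *\<^sub>C trig 0)))
      \<longlongrightarrow> inverse 1 *\<^sub>R (trig (- 1) \<odot> (f - F 0 *\<^sub>C trig 0))) (at_left 1)"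
    by (intro tendsto_intros tendsto_mult_L2 F) simp_all
  show ?thesis unfolding F(4)
  proof (rule HinfI[OF h b lim[unfolded inverse_1 scaleR_one]])
    fix r :: real assume r: "0 < r" "r < 1"
    let ?d = "dilation F r - F 0 *\<^sub>C trig 0"
    show "dilation G r = inverse r *\<^sub>R (trig (- 1) \<odot> ?d)"
      using rep_dilation[OF h less_imp_le[OF r(1)] r(2)] rep_dilation[OF F(1) less_imp_le[OF r(1)] r(2)]
        rep_trig[of "- 1"] rep_trig[of 0]
        rep_mult[OF disjI1[OF bounded_L2_trig], of "- 1" ?d]
        rep_scale[of "of_real (inverse r)" "trig (- 1) \<odot> ?d"] rep_diff[of "dilation F r" "F 0 *\<^sub>C trig 0"]
        rep_scale[of "F 0" "trig 0"] AE_circle_norm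
      unfolding scaleR_L2_def
    proof (intro L2_eqI, eventually_elim)
      case (elim z)
      then have "z \<noteq> 0" by auto
      then have "rep_L2 (dilation G r) z = (F (of_real r * z) - F 0) / (of_real r * z)"
        using elim(10) r by (simp add: G_def)
      moreover have "rep_L2 (of_real (inverse r) *\<^sub>C (trig (- 1) \<odot> ?d)) z =
          of_real (inverse r) * (z powi - 1 * (F (of_real r * z) - F 0))"
        unfolding elim(11-17) by simp
      ultimately show ?case by (simp add: divide_inverse power_int_minus mult_ac)
    qed
  qed
qed

subsection \<open>Orthogonality to analytic functions\<close>

lemma cinner_analytic_zero:
  assumes "g \<in> analytic_L2" "\<And>n. n \<ge> 0 \<Longrightarrow> coeff_L2 x n = 0"
  shows "\<langle>x, g\<rangle> = 0" "\<langle>g, x\<rangle> = 0"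
proof -
  have "\<langle>psum g N, x\<rangle> = 0" for N
    unfolding psum_def cinner_sum_left
  proof (intro sum.neutral ballI)
    fix k
    have "\<langle>trig (int k), x\<rangle> = 0"
      using assms(2)[of "int k"] by (metis cinner_commute coeff_L2_def complex_cnj_zero of_nat_0_le_iff)
    then show "\<langle>coeff_L2 g (int k) *\<^sub>C trig (int k), x\<rangle> = 0" by (simp add: cinner_simps)
  qed
  moreover have "(\<lambda>N. \<langle>psum g N, x\<rangle>) \<longlonglongrightarrow> \<langle>g, x\<rangle>"
    by (intro tendsto_cinner psum_tendsto assms tendsto_const)
  ultimately show "\<langle>g, x\<rangle> = 0" using LIMSEQ_unique[OF _ tendsto_const] by simp
  then show "\<langle>x, g\<rangle> = 0" by (metis cinner_commute complex_cnj_zero)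
qed

text \<open>For \<open>n < 0\<close> move \<open>f\<close> to the other side of the inner product:
  \<open>conj_L2 f \<odot> trig n\<close> has negative frequencies only and is orthogonal to the
  analytic \<open>h\<close>.\<close>

lemma analytic_mult:
  assumes f: "f \<in> analytic_L2" "bounded_L2 f" and h: "h \<in> analytic_L2"
  shows "f \<odot> h \<in> analytic_L2" "h \<odot> f \<in> analytic_L2"
proof -
  have "coeff_L2 (f \<odot> h) n = 0" if "n < 0" for n
  proof -
    have "\<langle>h, conj_L2 f \<odot> trig n\<rangle> = 0"
    proof (rule cinner_analytic_zero(2)[OF h])
      fix k :: int assume "k \<ge> 0"
      have "coeff_L2 (conj_L2 f \<odot> trig n) k = coeff_L2 (trig n \<odot> conj_L2 f) k"
        by (simp add: mult_commute)
      also have "\<dots> = cnj (coeff_L2 f (n - k))" by (simp add: coeff_mult_trig coeff_conj)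
      finally show "coeff_L2 (conj_L2 f \<odot> trig n) k = 0"
        using f \<open>k \<ge> 0\<close> that by (simp add: analytic_L2_def)
    qed
    then show ?thesis by (simp add: coeff_L2_def cinner_mult_left f)
  qed
  then show "f \<odot> h \<in> analytic_L2" by (simp add: analytic_L2_def)
  then show "h \<odot> f \<in> analytic_L2" by (simp add: mult_commute)
qed

lemma analytic_shift: "f \<in> analytic_L2 \<Longrightarrow> trig 1 \<odot> f \<in> analytic_L2"
  by (simp add: analytic_mult analytic_trig)

lemma coeff_mult_conj:
  assumes "bounded_L2 f \<or> bounded_L2 g"
  shows "coeff_L2 (conj_L2 f \<odot> g) 0 = \<langle>g, f\<rangle>"
proof -
  have "bounded_L2 (conj_L2 f) \<or> bounded_L2 g" using assms bounded_L2_conj by blast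
  then show ?thesis by (simp add: coeff_L2_def cinner_mult_left)
qed

lemma to_L2_const: "to_L2 (\<lambda>_. c) = c *\<^sub>C trig 0"
proof -
  have "sq_integrable (\<lambda>_. c)" by (simp add: sq_integrable_def)
  from rep_to_L2[OF this] show ?thesis
    using rep_trig[of 0] rep_scale[of c "trig 0"] by (intro L2_eqI, eventually_elim) simp
qed

section \<open>The model space of an inner function\<close>

locale model =
  fixes u :: L2
  assumes inner: "inner_function u"
begin

abbreviation K :: "L2 set" where "K \<equiv> model_space u"
abbreviation P :: "L2 \<Rightarrow> L2" where "P \<equiv> orth_proj (model_space u)"
abbreviation C :: "L2 \<Rightarrow> L2" where "C \<equiv> model_conj u"
abbreviation S :: "L2 \<Rightarrow> L2" where "S \<equiv> compressed_shift u"
text \<open>This is the adjoint of \<open>S\<close> (\<open>cinner_S\<close>) and at the same time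
  the backward shift (\<open>R_eq\<close>).\<close>

abbreviation R :: "L2 \<Rightarrow> L2" where "R f \<equiv> C (S (C f))"

lemma u_Hinf: "u \<in> Hinf" and u_bounded [simp]: "bounded_L2 u" and u_analytic: "u \<in> analytic_L2"
  using inner Hinf_bounded Hinf_analytic by (auto simp: inner_function_def)

lemma cu_bounded [simp]: "bounded_L2 (conj_L2 u)"
  by (simp add: bounded_L2_conj)

lemma AE_u: "AE z in circle_measure. cmod (rep_L2 u z) = 1"
  using inner by (simp add: inner_function_def unimodular_L2.rep_eq)

lemma conj_u_mult_u: "conj_L2 u \<odot> u = trig 0"
  using AE_u rep_conj[of u] rep_mult[OF disjI1[OF cu_bounded], of u] rep_trig[of 0]
proof (intro L2_eqI, eventually_elim)
  case (elim z)
  then show ?case using complex_norm_square[of "rep_L2 u z"] by (simp add: mult.commute)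
qed

lemma conj_u_cancel [simp]: "conj_L2 u \<odot> (u \<odot> f) = f" "u \<odot> (conj_L2 u \<odot> f) = f"
  using conj_u_mult_u by (simp_all add: mult_assoc[symmetric] mult_commute[of u "conj_L2 u"])

lemma cinner_u: "\<langle>f, u \<odot> h\<rangle> = \<langle>conj_L2 u \<odot> f, h\<rangle>" "\<langle>u \<odot> h, f\<rangle> = \<langle>h, conj_L2 u \<odot> f\<rangle>"
  by (simp_all add: cinner_mult_left)

text \<open>As \<open>u\<close> is unimodular, orthogonality of \<open>f\<close> to
  \<open>u \<odot> h\<close> is orthogonality of \<open>conj_L2 u \<odot> f\<close> to
  \<open>h\<close>. This turns membership into two conditions on Fourier coefficients.\<close>

lemma K_iff: "f \<in> K \<longleftrightarrow> f \<in> analytic_L2 \<and> (\<forall>n\<ge>0. coeff_L2 (conj_L2 u \<odot> f) n = 0)"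
proof -
  have "(\<forall>h\<in>analytic_L2. \<langle>conj_L2 u \<odot> f, h\<rangle> = 0) \<longleftrightarrow> (\<forall>n\<ge>0. coeff_L2 (conj_L2 u \<odot> f) n = 0)"
    using cinner_analytic_zero(1) analytic_trig unfolding coeff_L2_def by blast
  then show ?thesis by (simp add: model_space_def H2_eq cinner_u)
qed

lemma K_analytic: "f \<in> K \<Longrightarrow> f \<in> analytic_L2"
  by (simp add: K_iff)

lemma K_orth: "f \<in> K \<Longrightarrow> h \<in> analytic_L2 \<Longrightarrow> \<langle>f, u \<odot> h\<rangle> = 0"
  by (simp add: model_space_def H2_eq)

lemma K_orth': "f \<in> K \<Longrightarrow> h \<in> analytic_L2 \<Longrightarrow> \<langle>u \<odot> h, f\<rangle> = 0"
  using K_orth by (metis cinner_commute complex_cnj_zero)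

lemma K_orth_u: "f \<in> K \<Longrightarrow> \<langle>f, u\<rangle> = 0" "f \<in> K \<Longrightarrow> \<langle>u, f\<rangle> = 0"
  using K_orth[of f "trig 0"] K_orth'[of f "trig 0"] by (simp_all add: analytic_trig)

lemma K_add: "f \<in> K \<Longrightarrow> g \<in> K \<Longrightarrow> f + g \<in> K"
  and K_diff: "f \<in> K \<Longrightarrow> g \<in> K \<Longrightarrow> f - g \<in> K"
  and K_scale: "f \<in> K \<Longrightarrow> c *\<^sub>C f \<in> K"
  and K_zero: "0 \<in> K"
  by (simp_all add: model_space_def H2_eq cinner_simps analytic_add analytic_diff analytic_scale analytic_zero)

lemma K_minus: "f \<in> K \<Longrightarrow> - f \<in> K"
  using K_diff[OF K_zero] by simp

lemmas K_intros = K_add K_diff K_scale K_zero K_minus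

lemma K_eqI:
  assumes "f \<in> K" "g \<in> K" "\<And>h. h \<in> K \<Longrightarrow> \<langle>f, h\<rangle> = \<langle>g, h\<rangle>" shows "f = g"
proof -
  have "\<langle>f - g, f - g\<rangle> = 0" using assms by (simp add: K_diff cinner_diff_left)
  then show ?thesis by (simp add: cinner_eq_zero_iff)
qed

subsection \<open>The projection\<close>

lemma proj_eqI:
  assumes "g \<in> K" "\<And>h. h \<in> K \<Longrightarrow> \<langle>f, h\<rangle> = \<langle>g, h\<rangle>" shows "P f = g"
  unfolding orth_proj_def
proof (rule the_equality)
  show "g \<in> K \<and> (\<forall>h\<in>K. \<langle>f - g, h\<rangle> = 0)" using assms by (simp add: cinner_diff_left)
  show "g' = g" if "g' \<in> K \<and> (\<forall>h\<in>K. \<langle>f - g', h\<rangle> = 0)" for g'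
    using that assms by (intro K_eqI) (auto simp: cinner_diff_left)
qed

text \<open>\<open>riesz\<close> projects onto the analytic functions, and conjugating it with the
  unitary multiplication by \<open>u\<close> projects onto the subspace to be removed.\<close>

lemma proj_explicit: "P f = riesz f - u \<odot> riesz (conj_L2 u \<odot> f)" (is "_ = ?g")
  and proj_in_K [simp]: "P f \<in> K"
  and cinner_proj: "g \<in> K \<Longrightarrow> \<langle>P f, g\<rangle> = \<langle>f, g\<rangle>"
proof -
  have z: "coeff_L2 (f - riesz f) n = 0" if "n \<ge> 0" for n
    using that by (simp add: coeff_diff coeff_riesz)
  have "coeff_L2 (conj_L2 u \<odot> ?g) n = 0" if "n \<ge> 0" for n
  proof -
    have "u \<odot> trig n \<in> analytic_L2"
      using that by (intro analytic_mult u_analytic analytic_trig) auto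
    then have "\<langle>f - riesz f, u \<odot> trig n\<rangle> = 0"
      using z by (rule cinner_analytic_zero)
    then have "coeff_L2 (conj_L2 u \<odot> (f - riesz f)) n = 0"
      by (simp add: coeff_L2_def cinner_u)
    moreover have "conj_L2 u \<odot> ?g = conj_L2 u \<odot> f - conj_L2 u \<odot> (f - riesz f) - riesz (conj_L2 u \<odot> f)"
      by (simp add: mult_diff_right)
    ultimately show ?thesis using that by (simp add: coeff_diff coeff_riesz)
  qed
  moreover have "?g \<in> analytic_L2"
    by (intro analytic_diff analytic_mult u_analytic) auto
  ultimately have g: "?g \<in> K" by (simp add: K_iff)
  have orth: "\<langle>f, h\<rangle> = \<langle>?g, h\<rangle>" if "h \<in> K" for h
  proof -
    have "\<langle>f - riesz f, h\<rangle> = 0" using K_analytic[OF that] z by (rule cinner_analytic_zero)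
    moreover have "\<langle>u \<odot> riesz (conj_L2 u \<odot> f), h\<rangle> = 0" using that by (intro K_orth') auto
    ultimately show ?thesis by (simp add: cinner_simps)
  qed
  show eq: "P f = ?g" by (rule proj_eqI[OF g orth])
  show "P f \<in> K" using eq g by simp
  show "\<langle>P f, g\<rangle> = \<langle>f, g\<rangle>" if "g \<in> K" for g using eq orth[OF that] by simp
qed

lemma proj_K: "f \<in> K \<Longrightarrow> P f = f"
  by (rule proj_eqI) auto

lemma proj_add: "P (f + g) = P f + P g"
  by (rule proj_eqI) (auto simp: K_intros cinner_simps cinner_proj)

lemma proj_diff: "P (f - g) = P f - P g"
  by (rule proj_eqI) (auto simp: K_intros cinner_simps cinner_proj)

lemma proj_scale: "P (c *\<^sub>C f) = c *\<^sub>C P f"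
  by (rule proj_eqI) (auto simp: K_intros cinner_simps cinner_proj)

lemma norm_proj_le: "norm (P f) \<le> norm f"
proof -
  have "\<langle>f, P f\<rangle> = of_real ((norm (P f))\<^sup>2)"
    using cinner_proj[of "P f" f] by (simp add: cinner_same)
  then have "(norm (P f))\<^sup>2 = cmod \<langle>f, P f\<rangle>" by (simp only: norm_of_real abs_power2)
  also have "\<dots> \<le> norm f * norm (P f)" by (rule cinner_Cauchy_Schwarz)
  finally have "norm (P f) * norm (P f) \<le> norm f * norm (P f)" by (simp add: power2_eq_square)
  then show ?thesis by (cases "P f = 0") (auto simp: mult_le_cancel_right)
qed

lemma bounded_linear_proj: "bounded_linear P"
  by (rule bounded_linear_intro[of _ 1]) (auto simp: proj_add proj_scale scaleR_L2_def norm_proj_le)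

lemma analytic_decomp:
  assumes "f \<in> analytic_L2"
  obtains h where "h \<in> analytic_L2" "f = P f + u \<odot> h"
proof
  have "riesz f = f" using assms by (intro coeff_eqI) (auto simp: coeff_riesz analytic_L2_def)
  then show "f = P f + u \<odot> riesz (conj_L2 u \<odot> f)" by (simp add: proj_explicit)
qed simp

subsection \<open>The conjugation\<close>

lemma C_eq: "C f = u \<odot> (trig (- 1) \<odot> conj_L2 f)"
  by (simp add: model_conj_def circle_var_trig conj_trig mult_assoc)

lemma C_eq': "C f = trig (- 1) \<odot> conj_L2 (conj_L2 u \<odot> f)"
  unfolding C_eq by (simp add: conj_mult mult_assoc[symmetric] mult_commute[of u])

lemma rep_C: "AE z in circle_measure. rep_L2 (C f) z = rep_L2 u z * cnj z * cnj (rep_L2 f z)"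
  using rep_mult[OF disjI1[OF u_bounded], of "trig (- 1) \<odot> conj_L2 f"]
    rep_mult[OF disjI1[OF bounded_L2_trig], of "-1" "conj_L2 f"] rep_trig[of "-1"] rep_conj[of f]
    AE_circle_norm
  unfolding C_eq
proof eventually_elim
  case (elim z)
  moreover have "z powi - 1 = cnj z" using sphere_power_int[of z 1] elim by simp
  ultimately show ?case by simp
qed

lemma C_add: "C (f + g) = C f + C g"
  and C_diff: "C (f - g) = C f - C g"
  and C_scale: "C (c *\<^sub>C f) = cnj c *\<^sub>C C f"
  by (simp_all add: C_eq conj_add conj_diff conj_scale mult_add_right mult_diff_right mult_scale_right)

lemma C_C [simp]: "C (C f) = f"
  using rep_C[of f] rep_C[of "C f"] AE_u AE_circle_norm
proof (intro L2_eqI, eventually_elim)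
  case (elim z)
  have "rep_L2 u z * cnj (rep_L2 u z) = 1" "z * cnj z = 1"
    using elim complex_norm_square[of "rep_L2 u z"] complex_norm_square[of z] by simp_all
  moreover have "rep_L2 (C (C f)) z = (rep_L2 u z * cnj (rep_L2 u z)) * (z * cnj z) * rep_L2 f z"
    using elim by (simp add: mult_ac)
  ultimately show ?case by simp
qed

text \<open>The conjugation interchanges the two conditions of \<open>K_iff\<close>: conjugation
  followed by the factor \<open>trig (- 1)\<close> exchanges negative and non-negative
  frequencies.\<close>

lemma C_in_K: "f \<in> K \<Longrightarrow> C f \<in> K"
proof -
  assume f: "f \<in> K"
  have "C f \<in> analytic_L2"
    using f unfolding analytic_L2_def C_eq' by (auto simp: coeff_mult_trig coeff_conj K_iff)
  moreover have "conj_L2 u \<odot> C f = trig (- 1) \<odot> conj_L2 f" by (simp add: C_eq)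
  then have "\<forall>n\<ge>0. coeff_L2 (conj_L2 u \<odot> C f) n = 0"
    using K_analytic[OF f] by (auto simp: coeff_mult_trig coeff_conj analytic_L2_def)
  ultimately show "C f \<in> K" by (simp add: K_iff)
qed

lemma cinner_C_C: "\<langle>C f, C g\<rangle> = \<langle>g, f\<rangle>"
proof -
  have "\<langle>C f, C g\<rangle> = \<langle>trig (- 1) \<odot> conj_L2 f, trig (- 1) \<odot> conj_L2 g\<rangle>"
    unfolding C_eq by (simp add: cinner_u)
  also have "\<dots> = \<langle>conj_L2 f, conj_L2 g\<rangle>"
    by (simp add: cinner_mult_left conj_trig mult_trig_mult_trig)
  finally show ?thesis by (simp add: cinner_conj_conj)
qed

lemma norm_C [simp]: "norm (C f) = norm f"
  by (simp add: norm_eq_sqrt_inner inner_L2_def cinner_C_C)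

lemma tendsto_C: "(X \<longlongrightarrow> a) F \<Longrightarrow> ((\<lambda>t. C (X t)) \<longlongrightarrow> C a) F"
  unfolding C_eq by (intro tendsto_mult_L2 tendsto_conj_L2) auto

lemma bounded_C: "bounded_L2 f \<Longrightarrow> bounded_L2 (C f)"
  unfolding C_eq by (intro bounded_L2_intros) auto

lemma C_shift: "C (trig 1 \<odot> f) = trig (- 1) \<odot> C f"
  unfolding C_eq'
  by (simp add: mult_commute[of "trig 1"] mult_assoc[symmetric] conj_mult conj_trig)
     (simp add: mult_commute[of _ "trig (- 1)"])

subsection \<open>The compressed shift and its adjoint\<close>

lemma S_eq_proj: "S f = P (trig 1 \<odot> f)"
  by (simp add: compressed_shift_def circle_var_trig)

lemma S_in_K [simp]: "S f \<in> K"
  by (simp add: S_eq_proj)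

lemma S_add: "S (f + g) = S f + S g"
  and S_diff: "S (f - g) = S f - S g"
  and S_scale: "S (c *\<^sub>C f) = c *\<^sub>C S f"
  by (simp_all add: S_eq_proj mult_add_right mult_diff_right mult_scale_right proj_add proj_diff proj_scale)

text \<open>For \<open>f\<close> in the model space \<open>conj_L2 u \<odot> f\<close> has
  frequencies at most -1. The shift moves only the one at -1 to a forbidden place, so a single
  multiple of \<open>u\<close> has to be removed.\<close>

lemma S_eq:
  assumes "f \<in> K"
  shows "S f = trig 1 \<odot> f - coeff_L2 (conj_L2 u \<odot> f) (- 1) *\<^sub>C u" (is "_ = ?g")
  unfolding S_eq_proj
proof (rule proj_eqI)
  have "conj_L2 u \<odot> (trig 1 \<odot> f) = trig 1 \<odot> (conj_L2 u \<odot> f)"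
    by (simp add: mult_assoc[symmetric] mult_commute[of "conj_L2 u"])
  then have "conj_L2 u \<odot> ?g = trig 1 \<odot> (conj_L2 u \<odot> f) - coeff_L2 (conj_L2 u \<odot> f) (- 1) *\<^sub>C trig 0"
    by (simp add: mult_diff_right mult_scale_right conj_u_mult_u)
  then have "\<forall>n\<ge>0. coeff_L2 (conj_L2 u \<odot> ?g) n = 0"
    using assms by (auto simp: coeff_simps coeff_mult_trig coeff_trig K_iff)
  moreover have "?g \<in> analytic_L2"
    by (intro analytic_diff analytic_shift analytic_scale u_analytic K_analytic assms)
  ultimately show "?g \<in> K" by (simp add: K_iff)
  show "\<langle>trig 1 \<odot> f, h\<rangle> = \<langle>?g, h\<rangle>" if "h \<in> K" for h
    using K_orth_u[OF that] by (simp add: cinner_simps)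
qed

lemma C_u: "C u = trig (- 1)"
  unfolding C_eq' by (simp add: conj_u_mult_u conj_trig)

lemma R_eq:
  assumes "f \<in> K"
  shows "R f = trig (- 1) \<odot> (f - coeff_L2 f 0 *\<^sub>C trig 0)"
proof -
  have "conj_L2 u \<odot> C f = trig (- 1) \<odot> conj_L2 f" by (simp add: C_eq)
  then have "coeff_L2 (conj_L2 u \<odot> C f) (- 1) = cnj (coeff_L2 f 0)"
    by (simp add: coeff_mult_trig coeff_conj)
  then have "S (C f) = trig 1 \<odot> C f - cnj (coeff_L2 f 0) *\<^sub>C u"
    using S_eq[OF C_in_K[OF assms]] by simp
  then show ?thesis
    by (simp add: C_diff C_shift C_scale C_u mult_diff_right mult_scale_right)
qed

lemma R_in_K: "R f \<in> K"
  by (simp add: C_in_K)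

lemma R_add: "R (f + g) = R f + R g"
  and R_scale: "R (c *\<^sub>C f) = c *\<^sub>C R f"
  by (simp_all add: C_add S_add C_diff S_diff C_scale S_scale)

lemma cinner_S:
  assumes "f \<in> K" "g \<in> K" shows "\<langle>S f, g\<rangle> = \<langle>f, R g\<rangle>"
proof -
  have "\<langle>f, trig (- 1)\<rangle> = 0"
    using K_analytic[OF assms(1)] by (simp add: analytic_L2_def coeff_L2_def)
  then have "\<langle>f, R g\<rangle> = \<langle>f, trig (- 1) \<odot> g\<rangle>"
    using assms by (simp add: R_eq mult_diff_right mult_scale_right cinner_simps)
  also have "\<dots> = \<langle>trig 1 \<odot> f, g\<rangle>" by (simp add: cinner_mult_left conj_trig)
  also have "\<dots> = \<langle>S f, g\<rangle>" using assms by (simp add: S_eq_proj cinner_proj)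
  finally show ?thesis by simp
qed

lemma cinner_R: "f \<in> K \<Longrightarrow> g \<in> K \<Longrightarrow> \<langle>R f, g\<rangle> = \<langle>f, S g\<rangle>"
  using cinner_S[of g f] by (metis cinner_commute)

text \<open>The value of \<open>u\<close> at the origin. With it \<open>k0\<close> below becomes
  \<open>1 - cnj (u 0) u\<close>, the projection of the constant 1
  (\<open>proj_one\<close>).\<close>

definition u0 :: complex where "u0 = coeff_L2 u 0"
definition k0 :: L2 where "k0 = trig 0 - cnj u0 *\<^sub>C u"

lemma k0_in_K [simp]: "k0 \<in> K"
proof -
  have "conj_L2 u \<odot> k0 = conj_L2 u - cnj u0 *\<^sub>C trig 0"
    by (simp add: k0_def mult_diff_right mult_scale_right conj_u_mult_u)
  moreover have "k0 \<in> analytic_L2"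
    unfolding k0_def by (intro analytic_diff analytic_scale u_analytic analytic_trig) simp
  ultimately show ?thesis
    using u_analytic by (auto simp: K_iff coeff_simps coeff_conj coeff_trig u0_def analytic_L2_def)
qed

lemma k0_Hinf: "k0 \<in> Hinf"
  unfolding k0_def by (intro Hinf_diff Hinf_one Hinf_scale u_Hinf)

lemma cinner_k0: "f \<in> K \<Longrightarrow> \<langle>f, k0\<rangle> = coeff_L2 f 0"
  by (simp add: k0_def cinner_simps K_orth_u coeff_L2_def)

lemma proj_one: "P (trig 0) = k0"
  by (rule proj_eqI) (auto simp: k0_def[THEN arg_cong, of "\<lambda>x. cinner_L2 x _"] cinner_simps K_orth_u)

lemma k0_k0: "\<langle>k0, k0\<rangle> = 1 - cnj u0 * u0"
  by (simp add: cinner_k0) (simp add: k0_def coeff_simps coeff_trig u0_def)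

text \<open>Shifting back and forth loses only the constant term \<open>coeff_L2 f 0\<close>, and
  the projection turns the constant 1 into \<open>k0\<close>. All displacement formulas stem from
  this rank-one defect.\<close>

lemma S_R:
  assumes "f \<in> K" shows "S (R f) = f - \<langle>f, k0\<rangle> *\<^sub>C k0"
proof -
  have "trig 1 \<odot> R f = f - coeff_L2 f 0 *\<^sub>C trig 0"
    using assms by (simp add: R_eq mult_trig_mult_trig)
  then show ?thesis
    using assms by (simp add: S_eq_proj proj_diff proj_scale proj_one proj_K cinner_k0)
qed

lemma R_S:
  assumes "f \<in> K" shows "R (S f) = f - \<langle>f, C k0\<rangle> *\<^sub>C C k0"
proof -
  have "R (S f) = C (S (R (C f)))" by simp
  also have "\<dots> = f - cnj \<langle>C f, k0\<rangle> *\<^sub>C C k0"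
    using S_R[OF C_in_K[OF assms]] by (simp add: C_diff C_scale)
  also have "cnj \<langle>C f, k0\<rangle> = \<langle>f, C k0\<rangle>"
    using cinner_C_C[of f "C k0"] by (simp add: cinner_commute)
  finally show ?thesis .
qed

text \<open>\<open>C k0\<close> is the backward shift of \<open>u\<close>, so the shift gives
  \<open>u - u0\<close>; here \<open>u\<close> projects to 0 and the constant to a multiple of
  \<open>k0\<close>.\<close>

lemma S_C_k0: "S (C k0) = - u0 *\<^sub>C k0"
proof -
  have "C (trig 0) = u \<odot> trig (- 1)" by (simp add: C_eq conj_trig)
  then have "trig 1 \<odot> C k0 = u - u0 *\<^sub>C trig 0"
    by (simp add: k0_def C_diff C_scale C_u mult_diff_right mult_scale_right mult_trig_trig
        mult_commute[of u] mult_trig_mult_trig)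
  moreover have "P u = 0"
    by (rule proj_eqI) (auto simp: K_zero K_orth_u)
  ultimately show ?thesis
    by (simp add: S_eq_proj proj_diff proj_scale proj_one scaleC_minus_left)
qed

lemma R_power_in_K: "f \<in> K \<Longrightarrow> (R ^^ n) f \<in> K"
  by (cases n) (auto simp: C_in_K)

lemma R_power_eq:
  assumes "f \<in> K" shows "(R ^^ n) f = trig (- int n) \<odot> (f - psum f n)"
proof (induction n)
  case 0
  then show ?case by (simp add: psum_def)
next
  case (Suc n)
  have "(R ^^ Suc n) f = R ((R ^^ n) f)" by simp
  also have "\<dots> = trig (- 1) \<odot> ((R ^^ n) f - coeff_L2 ((R ^^ n) f) 0 *\<^sub>C trig 0)"
    by (rule R_eq[OF R_power_in_K[OF assms]])
  also have "coeff_L2 ((R ^^ n) f) 0 = coeff_L2 f (int n)"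
    by (simp add: Suc.IH coeff_mult_trig coeff_diff coeff_psum)
  also have "trig (- 1) \<odot> ((R ^^ n) f - coeff_L2 f (int n) *\<^sub>C trig 0) =
      trig (- int (Suc n)) \<odot> (f - psum f n) - coeff_L2 f (int n) *\<^sub>C trig (- 1)"
    by (simp add: Suc.IH mult_diff_right mult_scale_right mult_trig_mult_trig)
  also have "trig (- 1) = trig (- int (Suc n)) \<odot> trig (int n)"
    by (simp add: mult_trig_trig)
  also have "trig (- int (Suc n)) \<odot> (f - psum f n) -
        coeff_L2 f (int n) *\<^sub>C (trig (- int (Suc n)) \<odot> trig (int n)) =
      trig (- int (Suc n)) \<odot> (f - (psum f n + coeff_L2 f (int n) *\<^sub>C trig (int n)))"
    by (simp add: mult_diff_right mult_add_right mult_scale_right del: of_nat_Suc)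
  also have "psum f n + coeff_L2 f (int n) *\<^sub>C trig (int n) = psum f (Suc n)"
    by (simp add: psum_def)
  finally show ?case .
qed

lemma norm_trig_mult: "norm (trig n \<odot> f) = norm f"
  by (simp add: norm_eq_sqrt_inner inner_L2_def cinner_mult_left conj_trig mult_trig_mult_trig)

text \<open>Up to multiplication by a unimodular function, \<open>R ^^ n\<close> removes the first
  \<open>n\<close> terms of the Fourier series, which leaves its tail.\<close>

lemma R_power_tendsto_zero:
  assumes "f \<in> K" shows "(\<lambda>n. (R ^^ n) f) \<longlonglongrightarrow> 0"
proof (rule tendsto_norm_zero_cancel)
  have "(\<lambda>n. norm (f - psum f n)) \<longlonglongrightarrow> norm (f - f)"
    by (intro tendsto_intros psum_tendsto K_analytic assms)
  then show "(\<lambda>n. norm ((R ^^ n) f)) \<longlonglongrightarrow> 0"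
    using assms by (simp add: R_power_eq norm_trig_mult)
qed

subsection \<open>A dense set of bounded functions\<close>

text \<open>A symbol acts directly only on \<open>K \<inter> Hinf\<close>. Asking the same of
  \<open>C f\<close> makes the domain invariant under the conjugation, and it is still dense
  (\<open>D_dense\<close>).\<close>

definition D :: "L2 set" where "D = {f \<in> K \<inter> Hinf. C f \<in> Hinf}"

lemma D_add: "f \<in> D \<Longrightarrow> g \<in> D \<Longrightarrow> f + g \<in> D"
  and D_scale: "f \<in> D \<Longrightarrow> c *\<^sub>C f \<in> D"
  by (simp_all add: D_def K_intros Hinf_add Hinf_scale C_add C_scale)

lemma D_zero: "0 \<in> D"
  using D_scale[of _ 0] k0_in_K k0_Hinf K_zero Hinf_scale[OF k0_Hinf, of 0] C_scale[of 0 0]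
  by (simp add: D_def)

lemma D_sum: "(\<And>i. i \<in> I \<Longrightarrow> f i \<in> D) \<Longrightarrow> (\<Sum>i\<in>I. f i) \<in> D"
  by (induction I rule: infinite_finite_induct) (auto simp: D_add D_zero)

lemma R_Hinf: "f \<in> K \<Longrightarrow> f \<in> Hinf \<Longrightarrow> R f \<in> Hinf"
  using R_eq Hinf_backward_shift by simp

lemma D_S:
  assumes "f \<in> D" shows "S f \<in> D"
proof -
  have "S f \<in> Hinf"
    using assms unfolding D_def by (auto simp: S_eq intro!: Hinf_diff Hinf_shift Hinf_scale u_Hinf)
  moreover have "C (S f) \<in> Hinf"
    using R_Hinf[of "C f"] assms by (simp add: D_def C_in_K)
  ultimately show ?thesis by (simp add: D_def)
qed

lemma k0_in_D: "k0 \<in> D"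
proof -
  have "C k0 = trig (- 1) \<odot> (u - u0 *\<^sub>C trig 0)"
    by (simp add: k0_def C_diff C_scale C_u mult_diff_right mult_scale_right)
       (simp add: C_eq conj_trig mult_commute)
  then show ?thesis
    using Hinf_backward_shift[OF u_Hinf] k0_Hinf by (simp add: D_def u0_def)
qed

text \<open>\<open>P (trig (int n))\<close> is \<open>S\<close> applied \<open>n\<close> times to
  \<open>k0\<close>, and \<open>D\<close> contains \<open>k0\<close> and is invariant under
  \<open>S\<close>.\<close>

lemma proj_trig_in_D: "P (trig (int n)) \<in> D"
proof (induction n)
  case 0
  then show ?case by (simp add: proj_one k0_in_D)
next
  case (Suc n)
  have "P (trig (int (Suc n))) = S (P (trig (int n)))"
  proof (rule proj_eqI)
    fix h assume h: "h \<in> K"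
    have "\<langle>S (P (trig (int n))), h\<rangle> = \<langle>trig (int n), R h\<rangle>"
      using h by (simp add: cinner_S cinner_proj R_in_K)
    also have "\<dots> = \<langle>trig (int n), trig (- 1) \<odot> h\<rangle>"
      using h by (simp add: R_eq mult_diff_right mult_scale_right cinner_simps cinner_trig_trig)
    also have "\<dots> = \<langle>trig 1 \<odot> trig (int n), h\<rangle>" by (simp add: cinner_mult_left conj_trig)
    finally show "\<langle>trig (int (Suc n)), h\<rangle> = \<langle>S (P (trig (int n))), h\<rangle>"
      by (simp add: mult_trig_trig)
  qed simp
  then show ?case using D_S[OF Suc.IH] by simp
qed

lemma D_dense:
  assumes "f \<in> K"
  obtains X where "\<And>n::nat. X n \<in> D" "X \<longlonglongrightarrow> f"
proof
  have "P (psum f N) = (\<Sum>k<N. coeff_L2 f (int k) *\<^sub>C P (trig (int k)))" for N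
    unfolding psum_def linear_sum[OF bounded_linear.linear[OF bounded_linear_proj]]
    by (simp add: proj_scale)
  then show "P (psum f N) \<in> D" for N by (simp add: D_sum D_scale proj_trig_in_D)
  show "(\<lambda>N. P (psum f N)) \<longlonglongrightarrow> f"
    using bounded_linear.tendsto[OF bounded_linear_proj psum_tendsto[OF K_analytic[OF assms]]]
    by (simp add: proj_K assms)
qed

section \<open>Truncated Toeplitz operators\<close>

lemma coeff_mult_analytic_0:
  assumes f: "f \<in> analytic_L2" "bounded_L2 f" and x: "x \<in> analytic_L2"
  shows "coeff_L2 (f \<odot> x) 0 = coeff_L2 f 0 * coeff_L2 x 0"
proof -
  define w where "w = trig (- 1) \<odot> (x - coeff_L2 x 0 *\<^sub>C trig 0)"
  have "w \<in> analytic_L2"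
    using x by (auto simp: w_def analytic_L2_def coeff_mult_trig coeff_simps coeff_trig)
  then have "f \<odot> w \<in> analytic_L2" by (intro analytic_mult f)
  moreover have "x = coeff_L2 x 0 *\<^sub>C trig 0 + trig 1 \<odot> w"
    by (simp add: w_def mult_trig_mult_trig)
  then have "f \<odot> x = coeff_L2 x 0 *\<^sub>C f + f \<odot> (trig 1 \<odot> w)"
    using f by (metis mult_add_right mult_scale_right mult_trig_0(2))
  moreover have "f \<odot> (trig 1 \<odot> w) = trig 1 \<odot> (f \<odot> w)"
    using f by (simp add: mult_assoc[symmetric] mult_commute[of f])
  ultimately show ?thesis
    by (simp add: coeff_simps coeff_mult_trig analytic_L2_def)
qed

lemma cinner_conj_analytic:
  assumes "y \<in> analytic_L2" "g \<in> analytic_L2"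
  shows "\<langle>conj_L2 y, g\<rangle> = cnj (coeff_L2 y 0) * cnj (coeff_L2 g 0)"
proof -
  have "\<langle>conj_L2 y - cnj (coeff_L2 y 0) *\<^sub>C trig 0, g\<rangle> = 0"
    using assms by (intro cinner_analytic_zero)
      (auto simp: coeff_simps coeff_conj coeff_trig analytic_L2_def)
  moreover have "\<langle>trig 0, g\<rangle> = cnj (coeff_L2 g 0)" by (simp add: coeff_L2_def cinner_commute)
  ultimately show ?thesis by (simp add: cinner_simps)
qed

lemma R_bounded: "f \<in> K \<Longrightarrow> bounded_L2 f \<Longrightarrow> bounded_L2 (R f)"
  by (simp add: R_eq bounded_L2_intros)

lemma R_power_bounded: "f \<in> K \<Longrightarrow> bounded_L2 f \<Longrightarrow> bounded_L2 ((R ^^ n) f)"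
  by (induction n) (auto intro!: R_bounded R_power_in_K)

lemma cinner_mult_trig_trig:
  assumes "bounded_L2 f"
  shows "\<langle>x \<odot> (trig n \<odot> f), trig n \<odot> g\<rangle> = \<langle>x \<odot> f, g\<rangle>"
proof -
  have "x \<odot> (trig n \<odot> f) = trig n \<odot> (x \<odot> f)"
    using assms by (simp add: mult_assoc[symmetric] mult_commute[of x])
  then show ?thesis by (simp add: cinner_mult_left conj_trig mult_trig_mult_trig)
qed

text \<open>\<open>R f\<close> and \<open>R g\<close> are \<open>f\<close> and \<open>g\<close>
  without their constant terms, times \<open>trig (- 1)\<close>. This factor cancels in the inner
  product, and expanding the constant terms leaves exactly the rank-two correction.\<close>

lemma symbol_displacement:
  assumes x: "x \<in> K" and y: "y \<in> K" and f: "f \<in> K" "bounded_L2 f" and g: "g \<in> K"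
  shows "\<langle>(x + conj_L2 y) \<odot> R f, R g\<rangle> = \<langle>(x + conj_L2 y) \<odot> f, g\<rangle>
    - (\<langle>f, k0\<rangle> * \<langle>x, g\<rangle> + \<langle>f, y\<rangle> * \<langle>k0, g\<rangle>)"
proof -
  let ?p = "x + conj_L2 y" and ?f0 = "coeff_L2 f 0" and ?g0 = "coeff_L2 g 0"
  note an = x[THEN K_analytic] y[THEN K_analytic] f(1)[THEN K_analytic] g[THEN K_analytic]
  have bd: "bounded_L2 (f - ?f0 *\<^sub>C trig 0)" using f by (simp add: bounded_L2_intros)
  have "\<langle>?p \<odot> R f, R g\<rangle> = \<langle>?p \<odot> (f - ?f0 *\<^sub>C trig 0), g - ?g0 *\<^sub>C trig 0\<rangle>"
    unfolding R_eq[OF f(1)] R_eq[OF g] by (rule cinner_mult_trig_trig[OF bd])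
  also have "?p \<odot> (f - ?f0 *\<^sub>C trig 0) = ?p \<odot> f - ?f0 *\<^sub>C ?p"
    using f by (simp add: mult_diff_right mult_scale_right bounded_L2_scale)
  also have "\<langle>?p \<odot> f - ?f0 *\<^sub>C ?p, g - ?g0 *\<^sub>C trig 0\<rangle> =
      \<langle>?p \<odot> f, g\<rangle> - cnj ?g0 * coeff_L2 (?p \<odot> f) 0 - ?f0 * \<langle>?p, g\<rangle> + ?f0 * cnj ?g0 * coeff_L2 ?p 0"
    by (simp add: cinner_simps coeff_L2_def algebra_simps)
  also have "coeff_L2 (?p \<odot> f) 0 = coeff_L2 x 0 * ?f0 + \<langle>f, y\<rangle>"
  proof -
    have "?p \<odot> f = f \<odot> x + conj_L2 y \<odot> f"
      using f by (simp add: mult_add_left mult_commute[of f])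
    then show ?thesis
      using f an by (simp add: coeff_add coeff_mult_analytic_0 coeff_mult_conj)
  qed
  also have "\<langle>?p, g\<rangle> = \<langle>x, g\<rangle> + cnj (coeff_L2 y 0) * cnj ?g0"
    using an by (simp add: cinner_simps cinner_conj_analytic)
  also have "coeff_L2 ?p 0 = coeff_L2 x 0 + cnj (coeff_L2 y 0)"
    by (simp add: coeff_add coeff_conj)
  finally have "\<langle>?p \<odot> R f, R g\<rangle> = \<langle>?p \<odot> f, g\<rangle> - (?f0 * \<langle>x, g\<rangle> + \<langle>f, y\<rangle> * cnj ?g0)"
    by (simp add: algebra_simps)
  moreover have "\<langle>k0, g\<rangle> = cnj ?g0" using cinner_k0[OF g] by (metis cinner_commute)
  ultimately show ?thesis using cinner_k0[OF f(1)] by simp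
qed

text \<open>Here \<open>R\<close> is the adjoint \<open>S*\<close>.\<close>

definition displacement :: "(L2 \<Rightarrow> L2) \<Rightarrow> L2 \<Rightarrow> L2 \<Rightarrow> bool" where
  "displacement T x y \<longleftrightarrow>
     (\<forall>f\<in>K. T f - S (T (R f)) = \<langle>f, k0\<rangle> *\<^sub>C x + \<langle>f, y\<rangle> *\<^sub>C k0)"

lemma operator_tendsto:
  assumes T: "bounded_operator_on K T" and X: "\<And>n::nat. X n \<in> K" "f \<in> K" "X \<longlonglongrightarrow> f"
  shows "(\<lambda>n. T (X n)) \<longlonglongrightarrow> T f"
proof -
  obtain c where c: "\<And>f. f \<in> K \<Longrightarrow> norm (T f) \<le> c * norm f"
    using T unfolding bounded_operator_on_def by blast
  have add: "T (f + g) = T f + T g" if "f \<in> K" "g \<in> K" for f g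
    using T that unfolding bounded_operator_on_def by blast
  have diff: "T (X n) - T f = T (X n - f)" for n
    using add[of "X n - f" f] X by (simp add: K_diff)
  have "(\<lambda>n. c * norm (X n - f)) \<longlonglongrightarrow> c * norm (f - f)"
    by (intro tendsto_intros X)
  then have "(\<lambda>n. c * norm (X n - f)) \<longlonglongrightarrow> 0" by simp
  then have "(\<lambda>n. T (X n) - T f) \<longlonglongrightarrow> 0"
    by (rule Lim_null_comparison[rotated]) (use c X in \<open>auto simp: diff K_diff\<close>)
  then show ?thesis by (rule LIM_zero_cancel)
qed

lemma norm_S_le: "norm (S f) \<le> norm f"
  unfolding S_eq_proj using norm_proj_le[of "trig 1 \<odot> f"] by (simp add: norm_trig_mult)

lemma bounded_operator_S: "bounded_operator_on K S"
  unfolding bounded_operator_on_def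
  by (auto simp: S_add S_scale intro!: exI[of _ 1] norm_S_le)

lemma bounded_operator_R: "bounded_operator_on K R"
  unfolding bounded_operator_on_def
  using norm_S_le[of "C _"] by (auto simp: R_in_K R_add R_scale intro!: exI[of _ 1] order_trans[OF norm_S_le])

lemma operator_in_K: "bounded_operator_on K T \<Longrightarrow> f \<in> K \<Longrightarrow> T f \<in> K"
  and operator_add: "bounded_operator_on K T \<Longrightarrow> f \<in> K \<Longrightarrow> g \<in> K \<Longrightarrow> T (f + g) = T f + T g"
  and operator_scale: "bounded_operator_on K T \<Longrightarrow> f \<in> K \<Longrightarrow> T (c *\<^sub>C f) = c *\<^sub>C T f"
  unfolding bounded_operator_on_def by blast+

lemma operator_diff:
  assumes "bounded_operator_on K T" "f \<in> K" "g \<in> K" shows "T (f - g) = T f - T g"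
  using operator_add[OF assms(1), of "f - g" g] assms by (simp add: K_diff)

lemma TTO_cinner:
  assumes "is_TTO u \<phi> A" "f \<in> K" "f \<in> Hinf" "g \<in> K"
  shows "\<langle>A f, g\<rangle> = \<langle>\<phi> \<odot> f, g\<rangle>"
  using assms by (simp add: is_TTO_def cinner_proj)

lemma D_subset: "f \<in> D \<Longrightarrow> f \<in> K" "f \<in> D \<Longrightarrow> f \<in> Hinf" "f \<in> D \<Longrightarrow> C f \<in> D"
  by (auto simp: D_def C_in_K)

text \<open>On \<open>D\<close> the operator is given by its symbol and
  \<open>symbol_displacement\<close> applies; both sides are continuous in \<open>f\<close>, and
  \<open>D\<close> is dense.\<close>

lemma TTO_imp_displacement:
  assumes A: "is_TTO u (x + conj_L2 y) A" and x: "x \<in> K" and y: "y \<in> K"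
  shows "displacement A x y"
proof -
  have op: "bounded_operator_on K A" using A by (simp add: is_TTO_def)
  note inK = operator_in_K[OF op]
  have D: "A f - S (A (R f)) = \<langle>f, k0\<rangle> *\<^sub>C x + \<langle>f, y\<rangle> *\<^sub>C k0" if "f \<in> D" for f
  proof (rule K_eqI)
    note f = D_subset[OF that]
    show "A f - S (A (R f)) \<in> K" using f by (simp add: K_intros inK)
    show "\<langle>f, k0\<rangle> *\<^sub>C x + \<langle>f, y\<rangle> *\<^sub>C k0 \<in> K" using x by (simp add: K_intros)
    fix g assume g: "g \<in> K"
    have "\<langle>S (A (R f)), g\<rangle> = \<langle>A (R f), R g\<rangle>"
      using g by (intro cinner_S inK R_in_K)
    also have "\<dots> = \<langle>(x + conj_L2 y) \<odot> R f, R g\<rangle>"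
      using f by (intro TTO_cinner[OF A] R_in_K R_Hinf)
    finally show "\<langle>A f - S (A (R f)), g\<rangle> = \<langle>\<langle>f, k0\<rangle> *\<^sub>C x + \<langle>f, y\<rangle> *\<^sub>C k0, g\<rangle>"
      using symbol_displacement[OF x y f(1) Hinf_bounded[OF f(2)] g] TTO_cinner[OF A f(1,2) g]
      by (simp add: cinner_simps)
  qed
  show ?thesis unfolding displacement_def
  proof
    fix f assume f: "f \<in> K"
    then obtain X where X: "\<And>n::nat. X n \<in> D" "X \<longlonglongrightarrow> f" using D_dense by blast
    have XK: "\<And>n. X n \<in> K" using X(1) D_subset by blast
    have "(\<lambda>n. A (X n) - S (A (R (X n)))) \<longlonglongrightarrow> A f - S (A (R f))"
      by (intro tendsto_diff operator_tendsto[OF op] operator_tendsto[OF bounded_operator_S]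
          operator_tendsto[OF bounded_operator_R] X XK f inK R_in_K)
    moreover have "(\<lambda>n. \<langle>X n, k0\<rangle> *\<^sub>C x + \<langle>X n, y\<rangle> *\<^sub>C k0) \<longlonglongrightarrow> \<langle>f, k0\<rangle> *\<^sub>C x + \<langle>f, y\<rangle> *\<^sub>C k0"
    proof -
      have "bounded_linear (\<lambda>c. c *\<^sub>C z)" for z
        by (rule bounded_linear_intro[of _ "norm z"])
           (simp_all add: scaleC_simps scaleR_L2_def norm_scaleC scaleR_conv_of_real)
      note lim = bounded_linear.tendsto[OF this]
      show ?thesis by (intro tendsto_add lim tendsto_cinner X tendsto_const)
    qed
    ultimately show "A f - S (A (R f)) = \<langle>f, k0\<rangle> *\<^sub>C x + \<langle>f, y\<rangle> *\<^sub>C k0"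
      using D[OF X(1)] LIMSEQ_unique by simp
  qed
qed

section \<open>From the displacement identity back to the symbol\<close>

lemma cinner_psum_zero:
  assumes "\<And>k. k < int n \<Longrightarrow> coeff_L2 w k = 0"
  shows "\<langle>w, psum g n\<rangle> = 0"
proof -
  have "\<langle>psum g n, w\<rangle> = 0"
    unfolding psum_def cinner_sum_left
  proof (intro sum.neutral ballI)
    fix k assume "k \<in> {..<n}"
    then have "\<langle>w, trig (int k)\<rangle> = 0" using assms[of "int k"] by (simp add: coeff_L2_def)
    then have "\<langle>trig (int k), w\<rangle> = 0" by (metis cinner_commute complex_cnj_zero)
    then show "\<langle>coeff_L2 g (int k) *\<^sub>C trig (int k), w\<rangle> = 0" by (simp add: cinner_simps)
  qed
  then show ?thesis by (metis cinner_commute complex_cnj_zero)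
qed

lemma bounded_psum: "bounded_L2 (psum f n)"
  unfolding psum_def by (intro bounded_L2_intros) auto

text \<open>The tail of \<open>f\<close> is \<open>trig (int n)\<close> times a bounded analytic
  function, so a product with an analytic function starts at frequency \<open>n\<close>.\<close>

lemma coeff_mult_tail:
  assumes x: "x \<in> analytic_L2" and f: "f \<in> analytic_L2" "bounded_L2 f" and k: "k < int n"
  shows "coeff_L2 (x \<odot> (f - psum f n)) k = 0"
proof -
  define t where "t = trig (- int n) \<odot> (f - psum f n)"
  have t: "t \<in> analytic_L2" "bounded_L2 t"
    using f by (auto simp: t_def analytic_L2_def coeff_mult_trig coeff_diff coeff_psum
        intro!: bounded_L2_intros bounded_psum)
  have "f - psum f n = trig (int n) \<odot> t" by (simp add: t_def mult_trig_mult_trig)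
  then have "x \<odot> (f - psum f n) = trig (int n) \<odot> (x \<odot> t)"
    using t by (simp add: mult_assoc[symmetric] mult_commute[of x])
  then show ?thesis
    using analytic_mult(2)[OF t x] k by (simp add: coeff_mult_trig analytic_L2_def)
qed

text \<open>The symbol is unbounded, so norm convergence of both arguments is not enough. In the
  analytic part, however, the product with the tail of \<open>f\<close> has no frequencies below
  \<open>n\<close>, so the tail of \<open>g\<close> may be replaced by \<open>g\<close> itself;
  \<open>x\<close> then moves to the fixed bounded function \<open>g\<close>, and only the tail of
  \<open>f\<close> varies. The coanalytic part is treated with the roles exchanged.\<close>

lemma symbol_R_power_tendsto_zero:
  assumes x: "x \<in> K" and y: "y \<in> K" and f: "f \<in> K" "bounded_L2 f" and g: "g \<in> K" "bounded_L2 g"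
  shows "(\<lambda>n. \<langle>(x + conj_L2 y) \<odot> (R ^^ n) f, (R ^^ n) g\<rangle>) \<longlonglongrightarrow> 0"
proof -
  define F where "F n = f - psum f n" for n
  define G where "G n = g - psum g n" for n
  note an = x[THEN K_analytic] y[THEN K_analytic] f(1)[THEN K_analytic] g(1)[THEN K_analytic]
  have bd: "bounded_L2 (F n)" "bounded_L2 (G n)" for n
    using f g by (auto simp: F_def G_def intro!: bounded_L2_intros bounded_psum)
  have F: "F \<longlonglongrightarrow> 0" and G: "G \<longlonglongrightarrow> 0"
    using tendsto_diff[OF tendsto_const psum_tendsto[OF an(3)], of f]
      tendsto_diff[OF tendsto_const psum_tendsto[OF an(4)], of g] by (simp_all add: F_def[abs_def] G_def[abs_def])
  have eq: "\<langle>(x + conj_L2 y) \<odot> (R ^^ n) f, (R ^^ n) g\<rangle> =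
      \<langle>F n, conj_L2 x \<odot> g\<rangle> + \<langle>conj_L2 y \<odot> f, G n\<rangle>" for n
  proof -
    have "\<langle>(x + conj_L2 y) \<odot> (R ^^ n) f, (R ^^ n) g\<rangle> = \<langle>(x + conj_L2 y) \<odot> F n, G n\<rangle>"
      unfolding R_power_eq[OF f(1)] R_power_eq[OF g(1)] F_def[symmetric] G_def[symmetric]
      by (rule cinner_mult_trig_trig[OF bd(1)])
    also have "\<dots> = \<langle>x \<odot> F n, G n\<rangle> + \<langle>conj_L2 y \<odot> F n, G n\<rangle>"
      using bd by (simp add: mult_add_left cinner_add_left)
    also have "\<langle>x \<odot> F n, G n\<rangle> = \<langle>x \<odot> F n, g\<rangle>"
    proof -
      have "\<langle>x \<odot> F n, psum g n\<rangle> = 0"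
        unfolding F_def using an f by (intro cinner_psum_zero coeff_mult_tail)
      then show ?thesis by (simp add: G_def cinner_simps)
    qed
    also have "\<dots> = \<langle>F n, conj_L2 x \<odot> g\<rangle>" using bd g by (intro cinner_mult_left) auto
    also have "\<langle>conj_L2 y \<odot> F n, G n\<rangle> = \<langle>F n, y \<odot> G n\<rangle>"
      using cinner_mult_left[of "conj_L2 y" "F n" "G n"] bd by simp
    also have "\<dots> = \<langle>f, y \<odot> G n\<rangle>"
    proof -
      have "\<langle>y \<odot> G n, psum f n\<rangle> = 0"
        unfolding G_def using an g by (intro cinner_psum_zero coeff_mult_tail)
      then have "\<langle>psum f n, y \<odot> G n\<rangle> = 0" by (metis cinner_commute complex_cnj_zero)
      then show ?thesis by (simp add: F_def cinner_simps)
    qed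
    also have "\<dots> = \<langle>conj_L2 y \<odot> f, G n\<rangle>"
      using cinner_mult_left[of "conj_L2 y" f "G n"] bd f by simp
    finally show ?thesis .
  qed
  have "(\<lambda>n. \<langle>F n, conj_L2 x \<odot> g\<rangle> + \<langle>conj_L2 y \<odot> f, G n\<rangle>) \<longlonglongrightarrow>
      \<langle>0, conj_L2 x \<odot> g\<rangle> + \<langle>conj_L2 y \<odot> f, 0\<rangle>"
    by (intro tendsto_add tendsto_cinner F G tendsto_const)
  then show ?thesis unfolding eq by simp
qed

text \<open>The displacement identity is iterated along \<open>R\<^sup>n f\<close>, which tends to zero; since the symbol is
  only square integrable, this works at first only against bounded functions.\<close>

lemma displacement_imp_TTO:
  assumes T: "bounded_operator_on K T" and d: "displacement T x y" and x: "x \<in> K" and y: "y \<in> K"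
  shows "is_TTO u (x + conj_L2 y) T"
proof -
  let ?p = "x + conj_L2 y"
  note inK = operator_in_K[OF T]
  obtain c where c: "\<And>f. f \<in> K \<Longrightarrow> norm (T f) \<le> c * norm f"
    using T unfolding bounded_operator_on_def by blast
  \<comment> \<open>The operator and its candidate symbol have the same displacement, so the
    difference of their forms does not change when \<open>R\<close> is applied to both
    arguments.\<close>
  have step: "\<langle>T f, g\<rangle> - \<langle>?p \<odot> f, g\<rangle> = \<langle>T (R f), R g\<rangle> - \<langle>?p \<odot> R f, R g\<rangle>"
    if f: "f \<in> K" "bounded_L2 f" and g: "g \<in> K" for f g
  proof -
    have "T f - S (T (R f)) = \<langle>f, k0\<rangle> *\<^sub>C x + \<langle>f, y\<rangle> *\<^sub>C k0"
      using d f unfolding displacement_def by blast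
    from arg_cong[OF this, of "\<lambda>v. \<langle>v, g\<rangle>"]
    have "\<langle>T f, g\<rangle> - \<langle>S (T (R f)), g\<rangle> = \<langle>f, k0\<rangle> * \<langle>x, g\<rangle> + \<langle>f, y\<rangle> * \<langle>k0, g\<rangle>"
      by (simp add: cinner_simps)
    moreover have "\<langle>S (T (R f)), g\<rangle> = \<langle>T (R f), R g\<rangle>"
      using g by (intro cinner_S inK R_in_K)
    ultimately show ?thesis
      using symbol_displacement[OF x y f g] by (simp add: algebra_simps)
  qed
  have bdd: "\<langle>T f, g\<rangle> = \<langle>?p \<odot> f, g\<rangle>"
    if f: "f \<in> K" "bounded_L2 f" and g: "g \<in> K" "bounded_L2 g" for f g
  proof -
    have it: "\<langle>T f, g\<rangle> - \<langle>?p \<odot> f, g\<rangle> = \<langle>T ((R ^^ n) f), (R ^^ n) g\<rangle> - \<langle>?p \<odot> (R ^^ n) f, (R ^^ n) g\<rangle>" for n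
    proof (induction n)
      case (Suc n)
      then show ?case
        using step[OF R_power_in_K[OF f(1)] R_power_bounded[OF f] R_power_in_K[OF g(1)], of n n] by simp
    qed simp
    have "(\<lambda>n. T ((R ^^ n) f)) \<longlonglongrightarrow> T 0"
      by (intro operator_tendsto[OF T] R_power_in_K f K_zero R_power_tendsto_zero)
    then have "(\<lambda>n. \<langle>T ((R ^^ n) f), (R ^^ n) g\<rangle>) \<longlonglongrightarrow> \<langle>T 0, 0\<rangle>"
      by (intro tendsto_cinner R_power_tendsto_zero g)
    from tendsto_diff[OF this symbol_R_power_tendsto_zero[OF x y f g]]
    have "(\<lambda>n. \<langle>T f, g\<rangle> - \<langle>?p \<odot> f, g\<rangle>) \<longlonglongrightarrow> 0" by (simp add: it[symmetric])
    then show ?thesis by (simp add: LIMSEQ_const_iff)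
  qed
  have "T f = P (?p \<odot> f)" if f: "f \<in> K" "f \<in> Hinf" for f
  proof (rule K_eqI[OF inK[OF f(1)] proj_in_K])
    fix g assume g: "g \<in> K"
    then obtain X where X: "\<And>n::nat. X n \<in> D" "X \<longlonglongrightarrow> g" using D_dense by blast
    have eq: "\<langle>T f, X n\<rangle> = \<langle>?p \<odot> f, X n\<rangle>" for n
      using X(1)[of n] f by (intro bdd) (auto simp: D_def Hinf_bounded)
    have "(\<lambda>n. \<langle>T f, X n\<rangle>) \<longlonglongrightarrow> \<langle>T f, g\<rangle>" "(\<lambda>n. \<langle>?p \<odot> f, X n\<rangle>) \<longlonglongrightarrow> \<langle>?p \<odot> f, g\<rangle>"
      by (intro tendsto_cinner tendsto_const X)+
    then show "\<langle>T f, g\<rangle> = \<langle>P (?p \<odot> f), g\<rangle>"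
      using eq LIMSEQ_unique cinner_proj[OF g] by simp
  qed
  then show ?thesis using T by (simp add: is_TTO_def)
qed

subsection \<open>Normal forms of symbols\<close>

lemma TTO_cong:
  assumes "is_TTO u \<phi> A" "\<And>f. f \<in> K \<Longrightarrow> f \<in> Hinf \<Longrightarrow> P (\<phi> \<odot> f) = P (\<psi> \<odot> f)"
  shows "is_TTO u \<psi> A"
  using assms by (auto simp: is_TTO_def)

lemma proj_u_mult_zero:
  assumes "h \<in> analytic_L2" "f \<in> K" "f \<in> Hinf"
  shows "P ((u \<odot> h) \<odot> f) = 0"
proof (rule proj_eqI[OF K_zero])
  fix g assume g: "g \<in> K"
  have "(u \<odot> h) \<odot> f = u \<odot> (h \<odot> f)"
    using assms by (intro mult_assoc) (auto simp: Hinf_bounded)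
  moreover have "h \<odot> f \<in> analytic_L2"
    using assms by (intro analytic_mult) (auto simp: Hinf_bounded Hinf_analytic)
  ultimately show "\<langle>(u \<odot> h) \<odot> f, g\<rangle> = \<langle>0, g\<rangle>" using K_orth'[OF g] by simp
qed

text \<open>\<open>conj_L2 u \<odot> f\<close> is the conjugate of
  \<open>trig 1 \<odot> C f\<close>. The product is thus the conjugate of an analytic function
  vanishing at the origin, which is orthogonal to all analytic functions.\<close>

lemma proj_conj_u_mult_zero:
  assumes h: "h \<in> analytic_L2" and f: "f \<in> K" "f \<in> Hinf"
  shows "P (conj_L2 (u \<odot> h) \<odot> f) = 0"
proof (rule proj_eqI[OF K_zero])
  fix g assume g: "g \<in> K"
  have b: "bounded_L2 f" "bounded_L2 (C f)" using f by (auto simp: Hinf_bounded bounded_C)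
  have an: "h \<odot> C f \<in> analytic_L2"
    using h b f by (intro analytic_mult) (auto simp: K_analytic C_in_K)
  have "conj_L2 u \<odot> f = conj_L2 (trig 1 \<odot> C f)"
    by (simp add: C_eq' mult_trig_mult_trig)
  moreover have "conj_L2 (u \<odot> h) \<odot> f = conj_L2 h \<odot> (conj_L2 u \<odot> f)"
    using b by (simp add: mult_commute[of u h] conj_mult mult_assoc)
  ultimately have "conj_L2 (u \<odot> h) \<odot> f = conj_L2 h \<odot> conj_L2 (trig 1 \<odot> C f)" by simp
  also have "\<dots> = conj_L2 (h \<odot> (trig 1 \<odot> C f))"
    using b by (simp add: conj_mult bounded_L2_mult)
  also have "h \<odot> (trig 1 \<odot> C f) = trig 1 \<odot> (h \<odot> C f)"
    using b by (simp add: mult_assoc[symmetric] mult_commute[of h "trig 1"])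
  finally have "\<langle>conj_L2 (u \<odot> h) \<odot> f, g\<rangle> = \<langle>conj_L2 (trig 1 \<odot> (h \<odot> C f)), g\<rangle>" by simp
  also have "\<dots> = 0"
    using an by (intro cinner_analytic_zero[OF K_analytic[OF g]])
      (auto simp: coeff_conj coeff_mult_trig analytic_L2_def)
  finally show "\<langle>conj_L2 (u \<odot> h) \<odot> f, g\<rangle> = \<langle>0, g\<rangle>" by simp
qed

lemma TTO_conj_analytic_symbol:
  assumes A: "is_TTO u (\<psi> + conj_L2 h) A" and h: "h \<in> analytic_L2"
  shows "is_TTO u (\<psi> + conj_L2 (P h)) A"
proof (rule TTO_cong[OF A])
  fix f assume f: "f \<in> K" "f \<in> Hinf"
  obtain b where b: "b \<in> analytic_L2" "h = P h + u \<odot> b" using analytic_decomp[OF h] by blast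
  have "\<psi> + conj_L2 h = (\<psi> + conj_L2 (P h)) + conj_L2 (u \<odot> b)"
    using arg_cong[OF b(2), of conj_L2] by (simp add: conj_add)
  then show "P ((\<psi> + conj_L2 h) \<odot> f) = P ((\<psi> + conj_L2 (P h)) \<odot> f)"
    using proj_conj_u_mult_zero[OF b(1) f] Hinf_bounded[OF f(2)]
    by (simp add: mult_add_left proj_add)
qed

lemma TTO_analytic_symbol:
  assumes A: "is_TTO u (\<psi> + h) A" and h: "h \<in> analytic_L2"
  shows "is_TTO u (\<psi> + P h) A"
proof (rule TTO_cong[OF A])
  fix f assume f: "f \<in> K" "f \<in> Hinf"
  obtain b where b: "b \<in> analytic_L2" "h = P h + u \<odot> b" using analytic_decomp[OF h] by blast
  have "\<psi> + h = (\<psi> + P h) + u \<odot> b"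
    using b(2) by simp
  then have "(\<psi> + h) \<odot> f = ((\<psi> + P h) + u \<odot> b) \<odot> f" by (rule arg_cong)
  also have "\<dots> = (\<psi> + P h) \<odot> f + (u \<odot> b) \<odot> f"
    using Hinf_bounded[OF f(2)] by (intro mult_add_left) simp
  finally show "P ((\<psi> + h) \<odot> f) = P ((\<psi> + P h) \<odot> f)"
    using proj_u_mult_zero[OF b(1) f] by (simp add: proj_add)
qed

text \<open>Split the symbol into its analytic and coanalytic parts and reduce each modulo multiples
  of \<open>u\<close> or their conjugates, which induce the zero operator.\<close>

lemma TTO_symbol_exists:
  assumes "is_TTO u \<phi> A"
  obtains x y where "x \<in> K" "y \<in> K" "is_TTO u (x + conj_L2 y) A"
proof
  define h where "h = conj_L2 (\<phi> - riesz \<phi>)"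
  have "h \<in> analytic_L2"
    by (auto simp: h_def analytic_L2_def coeff_conj coeff_diff coeff_riesz)
  moreover have "\<phi> = riesz \<phi> + conj_L2 h" by (simp add: h_def)
  ultimately have "is_TTO u (riesz \<phi> + conj_L2 (P h)) A"
    using assms TTO_conj_analytic_symbol by metis
  then show "is_TTO u (P (riesz \<phi>) + conj_L2 (P h)) A"
    using TTO_analytic_symbol[of "conj_L2 (P h)" "riesz \<phi>"] by (simp add: add.commute)
qed simp_all

text \<open>\<open>k0\<close> differs from the constant 1 by a multiple of \<open>u\<close>, and the
  symbol \<open>u\<close> induces the zero operator.\<close>

lemma TTO_k0_symbol: "is_TTO u (\<psi> + c *\<^sub>C k0) A \<longleftrightarrow> is_TTO u (\<psi> + to_L2 (\<lambda>_. c)) A"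
proof -
  have "P ((\<psi> + c *\<^sub>C k0) \<odot> f) = P ((\<psi> + to_L2 (\<lambda>_. c)) \<odot> f)" if f: "f \<in> K" "f \<in> Hinf" for f
  proof -
    have "P (u \<odot> f) = 0"
      using proj_u_mult_zero[of "trig 0" f] f by (simp add: analytic_trig)
    then show ?thesis
      using Hinf_bounded[OF f(2)]
      by (simp add: mult_add_left mult_scale_left mult_diff_left k0_def to_L2_const proj_add proj_scale
          proj_diff bounded_L2_intros)
  qed
  then show ?thesis using TTO_cong by metis
qed

subsection \<open>Complex symmetry\<close>

text \<open>Since \<open>u\<close> and \<open>z\<close> are unimodular,
  \<open>\<phi> f cnj g\<close> and \<open>\<phi> (C g) cnj (C f)\<close> are the same function on
  the circle. This uses the symbol on \<open>f\<close> and on \<open>C g\<close>, hence the choice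
  of \<open>D\<close>.\<close>

lemma TTO_symmetric:
  assumes A: "is_TTO u \<phi> A" and f: "f \<in> K" and g: "g \<in> K"
  shows "\<langle>A f, g\<rangle> = \<langle>A (C g), C f\<rangle>"
proof -
  have op: "bounded_operator_on K A" using A by (simp add: is_TTO_def)
  have D: "\<langle>A f, g\<rangle> = \<langle>A (C g), C f\<rangle>" if f: "f \<in> D" and g: "g \<in> D" for f g
  proof -
    have b: "bounded_L2 f" "bounded_L2 (C g)"
      using f g by (auto simp: D_def Hinf_bounded)
    have "AE z in circle_measure. rep_L2 (\<phi> \<odot> f) z * cnj (rep_L2 g z) =
        rep_L2 (\<phi> \<odot> C g) z * cnj (rep_L2 (C f) z)"
      using rep_mult[OF disjI2[OF b(1)], of \<phi>] rep_mult[OF disjI2[OF b(2)], of \<phi>] rep_C[of f]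
        rep_C[of g] AE_u AE_circle_norm
    proof eventually_elim
      case (elim z)
      have 1: "rep_L2 u z * cnj (rep_L2 u z) = 1" "z * cnj z = 1"
        using elim complex_norm_square[of "rep_L2 u z"] complex_norm_square[of z] by simp_all
      have "rep_L2 (\<phi> \<odot> C g) z * cnj (rep_L2 (C f) z) =
          (rep_L2 u z * cnj (rep_L2 u z)) * (z * cnj z) * (rep_L2 \<phi> z * rep_L2 f z * cnj (rep_L2 g z))"
        using elim(2-4) by (simp add: mult_ac)
      then show ?case using elim(1) by (simp add: 1)
    qed
    then have "\<langle>\<phi> \<odot> f, g\<rangle> = \<langle>\<phi> \<odot> C g, C f\<rangle>"
      unfolding cinner_rep by (intro integral_cong_AE) measurable
    then show ?thesis
      using TTO_cinner[OF A] D_subset f g by simp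
  qed
  obtain X where X: "\<And>n::nat. X n \<in> D" "X \<longlonglongrightarrow> f" using D_dense[OF f] by blast
  obtain Y where Y: "\<And>n::nat. Y n \<in> D" "Y \<longlonglongrightarrow> g" using D_dense[OF g] by blast
  have K: "\<And>n. X n \<in> K" "\<And>n. Y n \<in> K" using X(1) Y(1) D_subset by blast+
  have "(\<lambda>n. \<langle>A (X n), Y n\<rangle>) \<longlonglongrightarrow> \<langle>A f, g\<rangle>"
    by (intro tendsto_cinner operator_tendsto[OF op] X Y K f)
  moreover have "(\<lambda>n. \<langle>A (C (Y n)), C (X n)\<rangle>) \<longlonglongrightarrow> \<langle>A (C g), C f\<rangle>"
    by (intro tendsto_cinner operator_tendsto[OF op] tendsto_C X Y K f g C_in_K)
  ultimately show ?thesis using D[OF X(1) Y(1)] LIMSEQ_unique by simp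
qed

lemma TTO_adjoint:
  assumes "is_TTO u \<phi> A" "f \<in> K" "g \<in> K"
  shows "\<langle>A f, g\<rangle> = \<langle>f, C (A (C g))\<rangle>"
  using TTO_symmetric[OF assms] cinner_C_C[of "C (A (C g))" f] by simp

end

section \<open>Commuting truncated Toeplitz operators\<close>

text \<open>The symmetric square has no zero divisors of degree one. The choice
  \<open>g = a\<close>, paired with \<open>a\<close>, shows that \<open>e\<close> is orthogonal to
  \<open>a\<close>; then only the term with \<open>e\<close> survives.\<close>

lemma symmetric_rank_one_zero:
  assumes "\<And>g. g \<in> V \<Longrightarrow> \<langle>e, g\<rangle> *\<^sub>C a + \<langle>a, g\<rangle> *\<^sub>C e = 0" "a \<in> V" "a \<noteq> 0"
  shows "e = 0"
proof -
  have aa: "\<langle>a, a\<rangle> \<noteq> 0" using assms(3) by (simp add: cinner_eq_zero_iff)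
  have eq: "\<langle>e, a\<rangle> *\<^sub>C a + \<langle>a, a\<rangle> *\<^sub>C e = 0" using assms by blast
  from arg_cong[OF this, of "\<lambda>v. \<langle>v, a\<rangle>"] have "\<langle>e, a\<rangle> * \<langle>a, a\<rangle> + \<langle>a, a\<rangle> * \<langle>e, a\<rangle> = 0"
    by (simp add: cinner_simps)
  then have "\<langle>e, a\<rangle> = 0" using aa by (simp add: mult.commute)
  with eq have "\<langle>a, a\<rangle> *\<^sub>C e = 0" by simp
  then have "inverse \<langle>a, a\<rangle> *\<^sub>C \<langle>a, a\<rangle> *\<^sub>C e = 0" by simp
  then show ?thesis using aa by (simp add: scaleC_scaleC)
qed

text \<open>The hypothesis says \<open>a \<cdot> d = b \<cdot> c\<close> in the symmetric square, where linear
  factors are unique up to scalars.\<close>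

lemma symmetric_product_cases:
  assumes add: "\<And>f g. f \<in> V \<Longrightarrow> g \<in> V \<Longrightarrow> f - g \<in> V" and scale: "\<And>c f. f \<in> V \<Longrightarrow> c *\<^sub>C f \<in> V"
    and V: "a \<in> V" "b \<in> V"
    and eq: "\<And>g. g \<in> V \<Longrightarrow>
      \<langle>d, g\<rangle> *\<^sub>C a + \<langle>a, g\<rangle> *\<^sub>C d = \<langle>c, g\<rangle> *\<^sub>C b + \<langle>b, g\<rangle> *\<^sub>C c"
  obtains (zero_ab) "a = 0" "b = 0"
    | (prop_ac) \<alpha> where "c = \<alpha> *\<^sub>C a" "d = \<alpha> *\<^sub>C b"
    | (prop_ab) l where "a = l *\<^sub>C b" "c = l *\<^sub>C d"
    | (zero_bd) "b = 0" "d = 0"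
proof (cases "a = 0")
  case a: True
  show ?thesis
  proof (cases "b = 0")
    case False
    \<comment> \<open>Only \<open>b \<cdot> c = 0\<close> remains; the outcome is the third
      alternative with \<open>l = 0\<close>.\<close>
    have "c = 0"
      by (rule symmetric_rank_one_zero[OF _ V(2) False]) (use eq a in simp)
    then show ?thesis using prop_ab[of 0] a by simp
  qed (use zero_ab a in blast)
next
  case a: False
  have aa: "\<langle>a, a\<rangle> \<noteq> 0" using a by (simp add: cinner_eq_zero_iff)
  define t where "t = \<langle>b, a\<rangle> / \<langle>a, a\<rangle>"
  \<comment> \<open>The component of \<open>b\<close> orthogonal to \<open>a\<close>. If it
    vanishes, \<open>b\<close> is a multiple of \<open>a\<close> and the factor \<open>a\<close> can
    be cancelled; otherwise it serves as the test vector that removes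
    \<open>\<langle>a, g\<rangle>\<close>.\<close>
  define g0 where "g0 = b - t *\<^sub>C a"
  have g0V: "g0 \<in> V" unfolding g0_def by (intro add scale V)
  have "\<langle>g0, a\<rangle> = 0" using aa by (simp add: g0_def t_def cinner_simps)
  then have ag0: "\<langle>a, g0\<rangle> = 0" by (metis cinner_commute complex_cnj_zero)
  show ?thesis
  proof (cases "g0 = 0")
    case True
    then have b: "b = t *\<^sub>C a" by (simp add: g0_def)
    have "d - t *\<^sub>C c = 0"
    proof (rule symmetric_rank_one_zero[OF _ V(1) a])
      fix g assume "g \<in> V"
      from eq[OF this] show "\<langle>d - t *\<^sub>C c, g\<rangle> *\<^sub>C a + \<langle>a, g\<rangle> *\<^sub>C (d - t *\<^sub>C c) = 0"
        unfolding b by (simp add: cinner_simps scaleC_simps algebra_simps)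
    qed
    then have d: "d = t *\<^sub>C c" by simp
    show ?thesis
    proof (cases "t = 0")
      case True
      then show ?thesis using b d zero_bd by simp
    next
      case False
      then show ?thesis using prop_ab[of "inverse t"] b d by (simp add: scaleC_scaleC)
    qed
  next
    case False
    then have gg: "\<langle>g0, g0\<rangle> \<noteq> 0" by (simp add: cinner_eq_zero_iff)
    have bg: "\<langle>b, g0\<rangle> = \<langle>g0, g0\<rangle>"
      using ag0 arg_cong[OF g0_def, of "\<lambda>v. \<langle>v, g0\<rangle>"] by (simp add: cinner_simps)
    have e0: "\<langle>d, g0\<rangle> *\<^sub>C a = \<langle>c, g0\<rangle> *\<^sub>C b + \<langle>b, g0\<rangle> *\<^sub>C c"
      using eq[OF g0V] ag0 by simp
    \<comment> \<open>Pairing with \<open>g0\<close> once more removes the left-hand side and forces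
      \<open>c\<close> to be orthogonal to \<open>g0\<close>; the previous identity then makes
      \<open>c\<close> a multiple of \<open>a\<close>.\<close>
    from arg_cong[OF this, of "\<lambda>v. \<langle>v, g0\<rangle>"]
    have "0 = \<langle>c, g0\<rangle> * \<langle>b, g0\<rangle> + \<langle>b, g0\<rangle> * \<langle>c, g0\<rangle>" by (simp add: cinner_simps ag0)
    then have "\<langle>c, g0\<rangle> = 0" using gg bg by (simp add: mult.commute)
    with e0 have "\<langle>d, g0\<rangle> *\<^sub>C a = \<langle>b, g0\<rangle> *\<^sub>C c" by simp
    then have "inverse \<langle>b, g0\<rangle> *\<^sub>C \<langle>d, g0\<rangle> *\<^sub>C a = inverse \<langle>b, g0\<rangle> *\<^sub>C \<langle>b, g0\<rangle> *\<^sub>C c" by simp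
    then have "c = (inverse \<langle>b, g0\<rangle> * \<langle>d, g0\<rangle>) *\<^sub>C a" using gg bg by (simp add: scaleC_scaleC)
    then obtain r where c: "c = r *\<^sub>C a" by blast
    have "d - r *\<^sub>C b = 0"
    proof (rule symmetric_rank_one_zero[OF _ V(1) a])
      fix g assume "g \<in> V"
      from eq[OF this] show "\<langle>d - r *\<^sub>C b, g\<rangle> *\<^sub>C a + \<langle>a, g\<rangle> *\<^sub>C (d - r *\<^sub>C b) = 0"
        unfolding c by (simp add: cinner_simps scaleC_simps algebra_simps)
    qed
    then show ?thesis using prop_ac[of r] c by simp
  qed
qed

section \<open>The antilinear map \<open>W\<close> on the complement of \<open>k0\<close>\<close>

context model
begin

text \<open>The map applied to \<open>\<phi>\<close> in the symbols that define the finite Sedlock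
  classes.\<close>

abbreviation W :: "L2 \<Rightarrow> L2" where "W f \<equiv> S (C f)"

text \<open>A concrete copy of \<open>K / k0\<close>: on these vectors every term of the form
  \<open>x \<otimes> k0\<close> or \<open>k0 \<otimes> y\<close> tests to zero.\<close>

definition V :: "L2 set" where "V = {g \<in> K. \<langle>g, k0\<rangle> = 0}"

lemma V_K: "g \<in> V \<Longrightarrow> g \<in> K" and V_k0: "g \<in> V \<Longrightarrow> \<langle>g, k0\<rangle> = 0" "g \<in> V \<Longrightarrow> \<langle>k0, g\<rangle> = 0"
  by (auto simp: V_def) (metis cinner_commute complex_cnj_zero)

lemma V_diff: "f \<in> V \<Longrightarrow> g \<in> V \<Longrightarrow> f - g \<in> V" and V_add: "f \<in> V \<Longrightarrow> g \<in> V \<Longrightarrow> f + g \<in> V"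
  and V_scale: "f \<in> V \<Longrightarrow> c *\<^sub>C f \<in> V"
  by (auto simp: V_def K_intros cinner_simps)

lemma C_minus: "C (- f) = - C f" and S_minus: "S (- f) = - S f"
  by (simp_all add: uminus_L2 C_scale S_scale)

lemma R_k0: "R k0 = (- cnj u0) *\<^sub>C C k0"
  by (simp add: S_C_k0 C_scale)

lemma W_add: "W (f + g) = W f + W g"
  and W_scale: "W (c *\<^sub>C f) = cnj c *\<^sub>C W f"
  by (simp_all add: C_add S_add C_diff S_diff C_scale S_scale)

lemma W_W: "f \<in> K \<Longrightarrow> W (W f) = f - \<langle>f, k0\<rangle> *\<^sub>C k0"
  by (rule S_R)

lemma cinner_W:
  assumes "f \<in> K" "g \<in> K" shows "\<langle>W f, g\<rangle> = \<langle>W g, f\<rangle>"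
proof -
  have "\<langle>W f, g\<rangle> = \<langle>C f, R g\<rangle>" using assms by (intro cinner_S C_in_K)
  also have "\<dots> = \<langle>W g, f\<rangle>" by (rule cinner_C_C)
  finally show ?thesis .
qed

lemma W_V: "g \<in> V \<Longrightarrow> W g \<in> V"
  using cinner_W[of g k0] V_k0(2)[of g] V_K[of g] by (simp add: V_def S_C_k0 cinner_simps)

lemma cinner_W_W: "g \<in> V \<Longrightarrow> v \<in> K \<Longrightarrow> \<langle>W g, W v\<rangle> = \<langle>v, g\<rangle>"
  using cinner_W[of g "W v"] by (simp add: V_K W_W cinner_simps V_k0)

text \<open>If \<open>k0 = 0\<close>, then \<open>S (R f) = f\<close>, so the adjoint
  \<open>R\<close> is isometric; but its powers tend to zero. This disposes of the degenerate case
  in which division by the norm of \<open>k0\<close> is impossible.\<close>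

lemma K_trivial:
  assumes "k0 = 0" "f \<in> K" shows "f = 0"
proof -
  have "norm (R f) = norm f" if "f \<in> K" for f
  proof -
    have "\<langle>R f, R f\<rangle> = \<langle>f, f\<rangle>"
      using cinner_S[OF R_in_K that, of f] S_R[OF that] assms(1) by simp
    then show ?thesis by (simp only: norm_eq_sqrt_inner inner_L2_def)
  qed
  then have "norm ((R ^^ n) f) = norm f" for n
    using R_power_in_K[OF assms(2)] by (induction n) auto
  then show ?thesis
    using tendsto_norm[OF R_power_tendsto_zero[OF assms(2)]] by (simp add: LIMSEQ_const_iff)
qed

text \<open>The pair \<open>x\<close>, \<open>y\<close> stands for the symbol \<open>x + conj y\<close>.\<close>

definition symbol_op :: "(L2 \<Rightarrow> L2) \<Rightarrow> L2 \<Rightarrow> L2 \<Rightarrow> bool" where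
  "symbol_op A x y \<longleftrightarrow> bounded_operator_on K A \<and>
     (\<forall>f\<in>K. \<forall>g\<in>K. \<langle>A f, g\<rangle> = \<langle>f, C (A (C g))\<rangle>) \<and> x \<in> K \<and> y \<in> K \<and> displacement A x y"

lemma symbol_opI:
  assumes "is_TTO u (x + conj_L2 y) A" "x \<in> K" "y \<in> K" shows "symbol_op A x y"
  using assms TTO_adjoint[OF assms(1)] TTO_imp_displacement[OF assms]
  by (auto simp: symbol_op_def is_TTO_def)

context
  fixes A x y assumes A: "symbol_op A x y"
begin

lemma symbol_op_bounded: "bounded_operator_on K A"
  and symbol_op_K: "x \<in> K" "y \<in> K"
  and symbol_op_adjoint: "f \<in> K \<Longrightarrow> g \<in> K \<Longrightarrow> \<langle>A f, g\<rangle> = \<langle>f, C (A (C g))\<rangle>"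
  and symbol_op_displacement: "f \<in> K \<Longrightarrow> A f - S (A (R f)) = \<langle>f, k0\<rangle> *\<^sub>C x + \<langle>f, y\<rangle> *\<^sub>C k0"
  using A by (auto simp: symbol_op_def displacement_def)

lemmas symbol_op_linear = operator_in_K[OF symbol_op_bounded] operator_add[OF symbol_op_bounded]
  operator_scale[OF symbol_op_bounded] operator_diff[OF symbol_op_bounded]

lemma symbol_op_adjoint_K: "f \<in> K \<Longrightarrow> C (A (C f)) \<in> K"
  by (intro C_in_K symbol_op_linear(1))

text \<open>\<open>C A C\<close> is the adjoint of \<open>A\<close>, and taking adjoints in the
  displacement identity exchanges \<open>x\<close> and \<open>y\<close>. Facts about
  \<open>A\<close> thereby transfer to its adjoint.\<close>

lemma symbol_op_conj: "symbol_op (\<lambda>f. C (A (C f))) y x"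
  unfolding symbol_op_def
proof (intro conjI ballI)
  obtain c where c: "\<And>f. f \<in> K \<Longrightarrow> norm (A f) \<le> c * norm f"
    using symbol_op_bounded unfolding bounded_operator_on_def by blast
  show "bounded_operator_on K (\<lambda>f. C (A (C f)))"
    unfolding bounded_operator_on_def
    using c[OF C_in_K] by (auto simp: C_in_K symbol_op_linear C_add C_scale intro!: exI[of _ c])
  show "\<langle>C (A (C f)), g\<rangle> = \<langle>f, C (C (A (C (C g))))\<rangle>" if "f \<in> K" "g \<in> K" for f g
    using symbol_op_adjoint[OF that(2,1)] by (metis C_C cinner_commute)
  show "displacement (\<lambda>f. C (A (C f))) y x"
    unfolding displacement_def
  proof
    fix f assume f: "f \<in> K"
    show "C (A (C f)) - S (C (A (C (R f)))) = \<langle>f, k0\<rangle> *\<^sub>C y + \<langle>f, x\<rangle> *\<^sub>C k0"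
    proof (rule K_eqI)
      fix g assume g: "g \<in> K"
      have adj: "\<langle>C (A (C f)), g\<rangle> = \<langle>f, A g\<rangle>" if "f \<in> K" "g \<in> K" for f g
        using symbol_op_adjoint[OF that(2,1)] by (metis cinner_commute)
      have "\<langle>S (C (A (C (R f)))), g\<rangle> = \<langle>C (A (C (R f))), R g\<rangle>"
        using g by (intro cinner_S symbol_op_adjoint_K R_in_K)
      also have "\<dots> = \<langle>R f, A (R g)\<rangle>" by (intro adj R_in_K)
      also have "\<dots> = \<langle>f, S (A (R g))\<rangle>"
        using f by (intro cinner_R symbol_op_linear(1) R_in_K)
      finally have "\<langle>C (A (C f)) - S (C (A (C (R f)))), g\<rangle> = \<langle>f, A g - S (A (R g))\<rangle>"
        using adj[OF f g] by (simp add: cinner_simps)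
      also have "\<dots> = \<langle>k0, g\<rangle> * \<langle>f, x\<rangle> + \<langle>y, g\<rangle> * \<langle>f, k0\<rangle>"
        using symbol_op_displacement[OF g] by (simp add: cinner_simps cinner_commute)
      finally show "\<langle>C (A (C f)) - S (C (A (C (R f)))), g\<rangle> = \<langle>\<langle>f, k0\<rangle> *\<^sub>C y + \<langle>f, x\<rangle> *\<^sub>C k0, g\<rangle>"
        by (simp add: cinner_simps algebra_simps)
    qed (use f symbol_op_K in \<open>simp_all add: K_intros symbol_op_adjoint_K del: C_C\<close>)
  qed
qed (rule symbol_op_K)+

end

text \<open>The displacement identities of \<open>A\<close> and of its adjoint, both evaluated at
  \<open>k0\<close>, are two linear equations for the two unknown inner products. Their determinant
  is \<open>1 - cnj u0 * u0\<close>, the squared norm of \<open>k0\<close>.\<close>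

lemma symbol_op_k0:
  assumes A: "symbol_op A x y" and g: "g \<in> V" and k0: "k0 \<noteq> 0"
  shows "\<langle>A k0, g\<rangle> = \<langle>x, g\<rangle> - cnj u0 * \<langle>W y, g\<rangle>"
    and "\<langle>S (A (C k0)), g\<rangle> = \<langle>W y, g\<rangle> - u0 * \<langle>x, g\<rangle>"
proof -
  define \<kappa> where "\<kappa> = 1 - cnj u0 * u0"
  have kk: "\<langle>k0, k0\<rangle> = \<kappa>" by (simp add: k0_k0 \<kappa>_def)
  then have \<kappa>: "\<kappa> \<noteq> 0" using k0 by (metis cinner_eq_zero_iff)
  note lin = symbol_op_linear[OF A]
  have "A k0 - S (A (R k0)) = \<kappa> *\<^sub>C x + \<langle>k0, y\<rangle> *\<^sub>C k0"
    using symbol_op_displacement[OF A k0_in_K] kk by simp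
  also have "A (R k0) = (- cnj u0) *\<^sub>C A (C k0)"
    unfolding R_k0 by (rule lin) (simp add: C_in_K)
  finally have "A k0 + cnj u0 *\<^sub>C S (A (C k0)) = \<kappa> *\<^sub>C x + \<langle>k0, y\<rangle> *\<^sub>C k0"
    by (simp add: S_scale S_minus scaleC_simps)
  from arg_cong[OF this, of "\<lambda>v. \<langle>v, g\<rangle>"]
  have 1: "\<langle>A k0, g\<rangle> + cnj u0 * \<langle>S (A (C k0)), g\<rangle> = \<kappa> * \<langle>x, g\<rangle>"
    using V_k0[OF g] by (simp add: cinner_simps)
  have "C (A (C k0)) - S (C (A (C (R k0)))) = \<kappa> *\<^sub>C y + \<langle>k0, x\<rangle> *\<^sub>C k0"
    using symbol_op_displacement[OF symbol_op_conj[OF A] k0_in_K] kk by simp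
  also have "C (R k0) = (- u0) *\<^sub>C k0" by (simp add: S_C_k0)
  also have "A ((- u0) *\<^sub>C k0) = (- u0) *\<^sub>C A k0" by (rule lin) simp
  finally have "C (A (C k0)) + cnj u0 *\<^sub>C W (A k0) = \<kappa> *\<^sub>C y + \<langle>k0, x\<rangle> *\<^sub>C k0"
    by (simp add: C_scale S_scale C_minus S_minus scaleC_simps)
  \<comment> \<open>\<open>W\<close> turns \<open>C (A (C k0))\<close> into
    \<open>S (A (C k0))\<close>, so that both equations involve the same unknowns.\<close>
  from arg_cong[OF this, of W]
  have "S (A (C k0)) + u0 *\<^sub>C (A k0 - \<langle>A k0, k0\<rangle> *\<^sub>C k0) = cnj \<kappa> *\<^sub>C W y + cnj \<langle>k0, x\<rangle> *\<^sub>C W k0"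
    by (simp only: W_add W_scale W_W[OF lin(1)[OF k0_in_K]] C_C complex_cnj_cnj)
  from arg_cong[OF this, of "\<lambda>v. \<langle>v, g\<rangle>"]
  have 2: "\<langle>S (A (C k0)), g\<rangle> + u0 * \<langle>A k0, g\<rangle> = \<kappa> * \<langle>W y, g\<rangle>"
    using V_k0[OF g] by (simp add: cinner_simps S_C_k0 \<kappa>_def mult.commute)
  have "\<kappa> * \<langle>A k0, g\<rangle> = \<kappa> * (\<langle>x, g\<rangle> - cnj u0 * \<langle>W y, g\<rangle>)"
    using 1 2 unfolding \<kappa>_def by algebra
  then show "\<langle>A k0, g\<rangle> = \<langle>x, g\<rangle> - cnj u0 * \<langle>W y, g\<rangle>" using \<kappa> by simp
  have "\<kappa> * \<langle>S (A (C k0)), g\<rangle> = \<kappa> * (\<langle>W y, g\<rangle> - u0 * \<langle>x, g\<rangle>)"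
    using 1 2 unfolding \<kappa>_def by algebra
  then show "\<langle>S (A (C k0)), g\<rangle> = \<langle>W y, g\<rangle> - u0 * \<langle>x, g\<rangle>" using \<kappa> by simp
qed

text \<open>\<open>S\<close> is isometric up to the rank-one defect along \<open>C k0\<close>
  computed in \<open>R_S\<close>.\<close>

lemma cinner_S_S:
  assumes "f \<in> K" "g \<in> K"
  shows "\<langle>f, g\<rangle> = \<langle>S f, S g\<rangle> + \<langle>f, C k0\<rangle> * \<langle>C k0, g\<rangle>"
  using cinner_S[OF assms(1) S_in_K, of g] R_S[OF assms(2)]
  by (simp add: cinner_simps cinner_commute)

text \<open>Write the form of \<open>S A B R\<close> as the inner product of \<open>B (R h)\<close>
  with the adjoint of \<open>A\<close> applied to \<open>R g\<close>. The isometry defect of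
  \<open>S\<close> separates the two factors: each becomes a displacement known from the pair, and
  the boundary terms at \<open>k0\<close> and \<open>C k0\<close> are supplied by
  \<open>symbol_op_k0\<close>.\<close>

lemma product_displacement:
  assumes A: "symbol_op A x y" and B: "symbol_op B v w" and h: "h \<in> V" and g: "g \<in> V"
  shows "\<langle>A (B h) - S (A (B (R h))), g\<rangle> = \<langle>h, w\<rangle> * \<langle>x, g\<rangle> - \<langle>h, W v\<rangle> * \<langle>W y, g\<rangle>"
proof (cases "k0 = 0")
  case True
  then have "h = 0" "g = 0" using K_trivial V_K h g by blast+
  then show ?thesis by simp
next
  case k0: False
  let ?A = "\<lambda>f. C (A (C f))" and ?B = "\<lambda>f. C (B (C f))"
  note hK = V_K[OF h] and gK = V_K[OF g]
  have Aa: "\<langle>f, ?A g\<rangle> = \<langle>A f, g\<rangle>" if "f \<in> K" "g \<in> K" for f g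
    using symbol_op_adjoint[OF A that] by simp
  have Ba: "\<langle>B f, g\<rangle> = \<langle>f, ?B g\<rangle>" if "f \<in> K" "g \<in> K" for f g
    using symbol_op_adjoint[OF B that] by simp
  note AK = symbol_op_linear(1)[OF A] and BK = symbol_op_linear(1)[OF B]
    and A'K = symbol_op_adjoint_K[OF A] and B'K = symbol_op_adjoint_K[OF B]
  have SB: "S (B (R h)) = B h - \<langle>h, w\<rangle> *\<^sub>C k0"
    using symbol_op_displacement[OF B hK] V_k0[OF h] by (simp add: diff_eq_eq)
  have SA: "S (?A (R g)) = ?A g - \<langle>g, x\<rangle> *\<^sub>C k0"
    using symbol_op_displacement[OF symbol_op_conj[OF A] gK] V_k0[OF g] by (simp add: diff_eq_eq)
  have k1: "\<langle>B h, k0\<rangle> = \<langle>h, w\<rangle> - u0 * \<langle>h, W v\<rangle>"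
  proof -
    have "\<langle>B h, k0\<rangle> = cnj \<langle>?B k0, h\<rangle>" using Ba[OF hK k0_in_K] by (simp add: cinner_commute)
    also have "\<dots> = cnj (\<langle>w, h\<rangle> - cnj u0 * \<langle>W v, h\<rangle>)"
      using symbol_op_k0(1)[OF symbol_op_conj[OF B] h k0] by simp
    finally show ?thesis by (simp add: cinner_commute)
  qed
  have k2: "\<langle>B (R h), C k0\<rangle> = \<langle>h, W v\<rangle> - cnj u0 * \<langle>h, w\<rangle>"
  proof -
    have "\<langle>B (R h), C k0\<rangle> = \<langle>R h, ?B (C k0)\<rangle>" by (intro Ba R_in_K C_in_K k0_in_K)
    also have "\<dots> = \<langle>h, S (?B (C k0))\<rangle>" by (intro cinner_R hK B'K C_in_K k0_in_K)
    also have "\<dots> = cnj \<langle>S (?B (C k0)), h\<rangle>" by (simp add: cinner_commute)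
    also have "\<dots> = cnj (\<langle>W v, h\<rangle> - u0 * \<langle>w, h\<rangle>)"
      using symbol_op_k0(2)[OF symbol_op_conj[OF B] h k0] by simp
    finally show ?thesis by (simp add: cinner_commute)
  qed
  have k3: "\<langle>C k0, ?A (R g)\<rangle> = \<langle>W y, g\<rangle> - u0 * \<langle>x, g\<rangle>"
  proof -
    have "\<langle>C k0, ?A (R g)\<rangle> = \<langle>A (C k0), R g\<rangle>" by (intro Aa C_in_K R_in_K k0_in_K)
    also have "\<dots> = \<langle>S (A (C k0)), g\<rangle>"
      by (intro cinner_S[symmetric] AK C_in_K gK k0_in_K)
    finally show ?thesis using symbol_op_k0(2)[OF A g k0] by simp
  qed
  have k4: "\<langle>k0, ?A g\<rangle> = \<langle>x, g\<rangle> - cnj u0 * \<langle>W y, g\<rangle>"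
    using Aa[OF k0_in_K gK] symbol_op_k0(1)[OF A g k0] by simp
  have k5: "\<langle>B h, ?A g\<rangle> = \<langle>A (B h), g\<rangle>" by (intro Aa BK hK gK)
  have "\<langle>S (A (B (R h))), g\<rangle> = \<langle>A (B (R h)), R g\<rangle>"
    by (intro cinner_S AK BK R_in_K gK)
  also have "\<dots> = \<langle>B (R h), ?A (R g)\<rangle>" by (intro Aa[symmetric] BK R_in_K)
  also have "\<dots> = \<langle>S (B (R h)), S (?A (R g))\<rangle> + \<langle>B (R h), C k0\<rangle> * \<langle>C k0, ?A (R g)\<rangle>"
    by (intro cinner_S_S BK A'K R_in_K)
  also have "\<langle>S (B (R h)), S (?A (R g))\<rangle> = \<langle>B h, ?A g\<rangle> - \<langle>x, g\<rangle> * \<langle>B h, k0\<rangle>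
      - \<langle>h, w\<rangle> * \<langle>k0, ?A g\<rangle> + \<langle>h, w\<rangle> * \<langle>x, g\<rangle> * \<langle>k0, k0\<rangle>"
    unfolding SA SB by (simp add: cinner_simps cinner_commute algebra_simps)
  finally show ?thesis
    \<comment> \<open>All terms with \<open>u0\<close> cancel because
      \<open>\<langle>k0, k0\<rangle>\<close> equals \<open>1 - cnj u0 * u0\<close>.\<close>
    unfolding k1 k2 k3 k4 k5 k0_k0 cinner_diff_left by (simp add: algebra_simps)
qed

text \<open>An operator whose compression to \<open>V\<close> vanishes maps \<open>V\<close> into
  multiples of \<open>k0\<close>. It is therefore determined by the functional
  \<open>\<langle>Q f, k0\<rangle>\<close> and the single vector \<open>Q k0\<close>.\<close>

lemma displacement_of_weak:
  assumes T: "bounded_operator_on K T" and k0: "k0 \<noteq> 0"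
    and adj: "\<And>f g. f \<in> K \<Longrightarrow> g \<in> K \<Longrightarrow> \<langle>T f, g\<rangle> = \<langle>f, T' g\<rangle>"
    and T': "\<And>g. g \<in> K \<Longrightarrow> T' g \<in> K"
    and weak: "\<And>h g. h \<in> V \<Longrightarrow> g \<in> V \<Longrightarrow> \<langle>T h - S (T (R h)), g\<rangle> = 0"
  shows "\<exists>p\<in>K. \<exists>q\<in>K. displacement T p q"
proof -
  define Q where "Q f = T f - S (T (R f))" for f
  \<comment> \<open>The vector representing the functional \<open>\<langle>Q f, k0\<rangle>\<close>,
    obtained by moving \<open>Q\<close> to its adjoint.\<close>
  define q where "q = T' k0 - S (T' (R k0))"
  define \<kappa> where "\<kappa> = \<langle>k0, k0\<rangle>"
  have \<kappa>: "\<kappa> \<noteq> 0" using k0 by (simp add: \<kappa>_def cinner_eq_zero_iff)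
  note lin = operator_in_K[OF T] operator_add[OF T] operator_scale[OF T] operator_diff[OF T]
  have QK: "Q f \<in> K" if "f \<in> K" for f using that by (simp add: Q_def K_intros lin)
  have qK: "q \<in> K" by (simp add: q_def K_intros T')
  have Qlin: "Q (f + c *\<^sub>C g) = Q f + c *\<^sub>C Q g" if "f \<in> K" "g \<in> K" for f g c
    using that by (simp add: Q_def K_intros lin R_add R_scale R_in_K S_add S_scale scaleC_simps del: C_C)
  have Qk: "\<langle>Q f, k0\<rangle> = \<langle>f, q\<rangle>" if f: "f \<in> K" for f
  proof -
    have "\<langle>S (T (R f)), k0\<rangle> = \<langle>T (R f), R k0\<rangle>" by (intro cinner_S lin R_in_K k0_in_K)
    also have "\<dots> = \<langle>R f, T' (R k0)\<rangle>" by (intro adj R_in_K)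
    also have "\<dots> = \<langle>f, S (T' (R k0))\<rangle>" by (intro cinner_R f T' R_in_K)
    finally show ?thesis using adj[OF f k0_in_K] by (simp add: Q_def q_def cinner_simps)
  qed
  have QV: "Q h = (\<langle>h, q\<rangle> / \<kappa>) *\<^sub>C k0" if h: "h \<in> V" for h
  proof -
    define e where "e = Q h - (\<langle>h, q\<rangle> / \<kappa>) *\<^sub>C k0"
    have "\<langle>e, k0\<rangle> = 0" using Qk[OF V_K[OF h]] \<kappa> by (simp add: e_def cinner_simps \<kappa>_def)
    then have eV: "e \<in> V" using QK[OF V_K[OF h]] by (simp add: V_def e_def K_intros)
    have "\<langle>e, e\<rangle> = \<langle>Q h, e\<rangle> - (\<langle>h, q\<rangle> / \<kappa>) * \<langle>k0, e\<rangle>"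
      using arg_cong[OF e_def, of "\<lambda>v. \<langle>v, e\<rangle>"] by (simp add: cinner_simps)
    also have "\<dots> = 0" using weak[OF h eV] V_k0[OF eV] by (simp add: Q_def)
    finally show ?thesis by (simp add: cinner_eq_zero_iff e_def)
  qed
  \<comment> \<open>The part along \<open>k0\<close> is already produced by the term with
    \<open>q\<close> at \<open>f = k0\<close>, so it is subtracted here. The factor
    \<open>\<kappa>\<close> appears since \<open>k0\<close> is not normalised.\<close>
  define p where "p = inverse \<kappa> *\<^sub>C Q k0 - (\<langle>k0, q\<rangle> / (\<kappa> * \<kappa>)) *\<^sub>C k0"
  have "displacement T p (cnj (inverse \<kappa>) *\<^sub>C q)"
    unfolding displacement_def
  proof
    fix f assume f: "f \<in> K"
    define t where "t = \<langle>f, k0\<rangle> / \<kappa>"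
    define h where "h = f - t *\<^sub>C k0"
    have hV: "h \<in> V" using f \<kappa> by (simp add: h_def V_def K_intros cinner_simps t_def \<kappa>_def)
    have "Q f = Q (h + t *\<^sub>C k0)" by (simp add: h_def)
    also have "\<dots> = (\<langle>h, q\<rangle> / \<kappa>) *\<^sub>C k0 + t *\<^sub>C Q k0"
      using Qlin[OF V_K[OF hV] k0_in_K] QV[OF hV] by simp
    also have "\<langle>h, q\<rangle> = \<langle>f, q\<rangle> - t * \<langle>k0, q\<rangle>" by (simp add: h_def cinner_simps)
    finally show "T f - S (T (R f)) = \<langle>f, k0\<rangle> *\<^sub>C p + \<langle>f, cnj (inverse \<kappa>) *\<^sub>C q\<rangle> *\<^sub>C k0"
      unfolding Q_def[symmetric] p_def t_def
      by (simp add: scaleC_simps cinner_simps divide_inverse algebra_simps)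
  qed
  moreover have "p \<in> K" by (simp add: p_def K_intros QK)
  ultimately show ?thesis using K_scale[OF qK] by blast
qed

subsection \<open>The commutator\<close>

definition commutator :: "(L2 \<Rightarrow> L2) \<Rightarrow> (L2 \<Rightarrow> L2) \<Rightarrow> L2 \<Rightarrow> L2" where
  "commutator A B f = A (B f) - B (A f)"

context
  fixes A B x y v w
  assumes A: "symbol_op A x y" and B: "symbol_op B v w"
begin

lemma commutator_bounded: "bounded_operator_on K (commutator A B)"
proof -
  obtain a where a: "\<And>f. f \<in> K \<Longrightarrow> norm (A f) \<le> a * norm f"
    using symbol_op_bounded[OF A] unfolding bounded_operator_on_def by blast
  obtain b where b: "\<And>f. f \<in> K \<Longrightarrow> norm (B f) \<le> b * norm f"
    using symbol_op_bounded[OF B] unfolding bounded_operator_on_def by blast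
  note lin = symbol_op_linear[OF A] symbol_op_linear[OF B]
  have "norm (commutator A B f) \<le> (\<bar>a\<bar> * \<bar>b\<bar> + \<bar>b\<bar> * \<bar>a\<bar>) * norm f" if f: "f \<in> K" for f
  proof -
    have a': "norm (A f) \<le> \<bar>a\<bar> * norm f" if "f \<in> K" for f
      using order_trans[OF a[OF that] mult_right_mono[OF abs_ge_self norm_ge_zero]] .
    have b': "norm (B f) \<le> \<bar>b\<bar> * norm f" if "f \<in> K" for f
      using order_trans[OF b[OF that] mult_right_mono[OF abs_ge_self norm_ge_zero]] .
    have "norm (A (B f)) \<le> \<bar>a\<bar> * norm (B f)" using f by (intro a' lin)
    also have "\<dots> \<le> \<bar>a\<bar> * (\<bar>b\<bar> * norm f)" using f by (intro mult_left_mono b') auto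
    finally have 1: "norm (A (B f)) \<le> \<bar>a\<bar> * \<bar>b\<bar> * norm f" by simp
    have "norm (B (A f)) \<le> \<bar>b\<bar> * norm (A f)" using f by (intro b' lin)
    also have "\<dots> \<le> \<bar>b\<bar> * (\<bar>a\<bar> * norm f)" using f by (intro mult_left_mono a') auto
    finally have 2: "norm (B (A f)) \<le> \<bar>b\<bar> * \<bar>a\<bar> * norm f" by simp
    show ?thesis
      unfolding commutator_def using norm_triangle_ineq4[of "A (B f)" "B (A f)"] 1 2
      by (simp add: algebra_simps)
  qed
  then show ?thesis
    unfolding bounded_operator_on_def
    by (auto simp: commutator_def lin K_intros scaleC_simps)
qed

lemma commutator_K: "f \<in> K \<Longrightarrow> commutator A B f \<in> K"
  by (rule operator_in_K[OF commutator_bounded])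

lemma commutator_adjoint:
  assumes f: "f \<in> K" and g: "g \<in> K"
  shows "\<langle>commutator A B f, g\<rangle> = \<langle>f, - C (commutator A B (C g))\<rangle>"
proof -
  note K = symbol_op_linear(1)[OF A] symbol_op_linear(1)[OF B] C_in_K
  have "\<langle>A (B f), g\<rangle> = \<langle>B f, C (A (C g))\<rangle>" using f g by (intro symbol_op_adjoint[OF A] K)
  also have "\<dots> = \<langle>f, C (B (C (C (A (C g)))))\<rangle>" using f g by (intro symbol_op_adjoint[OF B] K)
  finally have 1: "\<langle>A (B f), g\<rangle> = \<langle>f, C (B (A (C g)))\<rangle>" by simp
  have "\<langle>B (A f), g\<rangle> = \<langle>A f, C (B (C g))\<rangle>" using f g by (intro symbol_op_adjoint[OF B] K)
  also have "\<dots> = \<langle>f, C (A (C (C (B (C g)))))\<rangle>" using f g by (intro symbol_op_adjoint[OF A] K)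
  finally have 2: "\<langle>B (A f), g\<rangle> = \<langle>f, C (A (B (C g)))\<rangle>" by simp
  show ?thesis using 1 2 by (simp add: commutator_def C_diff cinner_simps)
qed

lemma commutator_TTO_iff: "commutator A B \<in> TTO u \<longleftrightarrow> (\<forall>f\<in>K. commutator A B f = 0)"
proof
  assume "commutator A B \<in> TTO u"
  then obtain \<phi> where T: "is_TTO u \<phi> (commutator A B)" by (auto simp: TTO_def)
  show "\<forall>f\<in>K. commutator A B f = 0"
  proof
    fix f assume f: "f \<in> K"
    have "\<langle>commutator A B f, g\<rangle> = 0" if g: "g \<in> K" for g
      using TTO_adjoint[OF T f g] commutator_adjoint[OF f g] by (simp add: cinner_simps)
    from this[OF commutator_K[OF f]] show "commutator A B f = 0"
      by (simp add: cinner_eq_zero_iff)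
  qed
next
  assume 0: "\<forall>f\<in>K. commutator A B f = 0"
  then have "displacement (commutator A B) 0 0"
    using operator_scale[OF bounded_operator_S K_zero, of 0] by (simp add: displacement_def R_in_K)
  from displacement_imp_TTO[OF commutator_bounded this K_zero K_zero]
  show "commutator A B \<in> TTO u" by (auto simp: TTO_def)
qed

lemma commutator_displacement:
  assumes h: "h \<in> V" and g: "g \<in> V"
  shows "\<langle>commutator A B h - S (commutator A B (R h)), g\<rangle> =
    \<langle>h, w\<rangle> * \<langle>x, g\<rangle> - \<langle>h, W v\<rangle> * \<langle>W y, g\<rangle> - \<langle>h, y\<rangle> * \<langle>v, g\<rangle> + \<langle>h, W x\<rangle> * \<langle>W w, g\<rangle>"
proof -
  have "commutator A B h - S (commutator A B (R h)) =
      (A (B h) - S (A (B (R h)))) - (B (A h) - S (B (A (R h))))"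
    by (simp add: commutator_def S_diff)
  then show ?thesis
    using product_displacement[OF A B h g] product_displacement[OF B A h g]
    by (simp only: cinner_diff_left[of "A (B h) - S (A (B (R h)))"]) (simp add: algebra_simps)
qed

lemma commutator_TTO_of_weak:
  assumes "\<And>h g. h \<in> V \<Longrightarrow> g \<in> V \<Longrightarrow>
    \<langle>h, w\<rangle> * \<langle>x, g\<rangle> - \<langle>h, W v\<rangle> * \<langle>W y, g\<rangle> - \<langle>h, y\<rangle> * \<langle>v, g\<rangle> + \<langle>h, W x\<rangle> * \<langle>W w, g\<rangle> = 0"
  shows "commutator A B \<in> TTO u"
proof (cases "k0 = 0")
  case True
  then show ?thesis unfolding commutator_TTO_iff using K_trivial commutator_K by blast
next
  case False
  have "\<exists>p\<in>K. \<exists>q\<in>K. displacement (commutator A B) p q"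
    by (rule displacement_of_weak[OF commutator_bounded False commutator_adjoint])
       (auto simp: commutator_displacement assms intro!: K_minus C_in_K commutator_K)
  then show ?thesis
    using displacement_imp_TTO[OF commutator_bounded] unfolding TTO_def by blast
qed

text \<open>Apply the commutator formula to \<open>W h\<close>. The symmetry of \<open>W\<close>
  turns \<open>\<langle>W h, w\<rangle>\<close> into \<open>\<langle>W w, h\<rangle>\<close> and
  \<open>\<langle>W h, W v\<rangle>\<close> into \<open>\<langle>v, h\<rangle>\<close>; the result
  is symmetric in \<open>h\<close> and \<open>g\<close>.\<close>

lemma commutator_zero_identity:
  assumes 0: "\<And>f. f \<in> K \<Longrightarrow> commutator A B f = 0" and h: "h \<in> V" and g: "g \<in> V"
  shows "\<langle>W w, h\<rangle> * \<langle>x, g\<rangle> - \<langle>v, h\<rangle> * \<langle>W y, g\<rangle> - \<langle>W y, h\<rangle> * \<langle>v, g\<rangle> + \<langle>x, h\<rangle> * \<langle>W w, g\<rangle> = 0"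
proof -
  note K = symbol_op_K[OF A] symbol_op_K[OF B] and hK = V_K[OF h]
  have "S (commutator A B (R (W h))) = 0"
    using 0[OF R_in_K, of "W h"] operator_scale[OF bounded_operator_S K_zero, of 0] by simp
  then have "\<langle>commutator A B (W h) - S (commutator A B (R (W h))), g\<rangle> = 0"
    using 0 by simp
  from this[unfolded commutator_displacement[OF W_V[OF h] g]]
  show ?thesis
    using K hK by (simp only: cinner_W_W[OF h] cinner_W[OF hK])
qed

end

text \<open>Here \<open>T = S T R\<close> with \<open>S\<close> a contraction, so the norm of
  \<open>T f\<close> is at most that of \<open>T\<close> on every iterate of \<open>f\<close> under
  \<open>R\<close>, and these tend to zero.\<close>

lemma zero_displacement:
  assumes T: "bounded_operator_on K T" and d: "displacement T 0 0" and f: "f \<in> K"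
  shows "T f = 0"
proof -
  have step: "norm (T f) \<le> norm (T (R f))" if "f \<in> K" for f
  proof -
    have "T f = S (T (R f))" using d that by (simp add: displacement_def)
    then show ?thesis by (metis norm_S_le)
  qed
  have le: "norm (T f) \<le> norm (T ((R ^^ n) f))" for n
  proof (induction n)
    case (Suc n)
    then show ?case using step[OF R_power_in_K[OF f], of n] by simp
  qed simp
  have "(\<lambda>n. T ((R ^^ n) f)) \<longlonglongrightarrow> T 0"
    by (intro operator_tendsto[OF T] R_power_in_K f K_zero R_power_tendsto_zero)
  then have "(\<lambda>n. norm (T ((R ^^ n) f))) \<longlonglongrightarrow> norm (T 0)" by (rule tendsto_norm)
  moreover have "T 0 = 0" using operator_scale[OF T K_zero, of 0] by simp
  ultimately have "norm (T f) \<le> 0"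
    using le by (intro LIMSEQ_le_const[where X = "\<lambda>n. norm (T ((R ^^ n) f))"]) auto
  then show ?thesis by simp
qed

lemma symbol_dependent:
  assumes A: "symbol_op A x y" and B: "symbol_op B v w"
    and x: "x = l *\<^sub>C v + s *\<^sub>C k0" and y: "y = cnj l *\<^sub>C w + r *\<^sub>C k0"
  obtains m where "\<And>f. f \<in> K \<Longrightarrow> A f = l *\<^sub>C B f + m *\<^sub>C f"
proof -
  \<comment> \<open>By \<open>S_R\<close> the operator \<open>m I\<close> has displacement
    \<open>m\<close> times \<open>k0 \<otimes> k0\<close>. The surplus \<open>s *\<^sub>C k0\<close>
    in \<open>x\<close> and \<open>r *\<^sub>C k0\<close> in \<open>y\<close> contribute
    \<open>s\<close> and \<open>cnj r\<close> to this multiple.\<close>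
  define m where "m = s + cnj r"
  define T where "T f = A f - l *\<^sub>C B f - m *\<^sub>C f" for f
  obtain a where a: "\<And>f. f \<in> K \<Longrightarrow> norm (A f) \<le> a * norm f"
    using symbol_op_bounded[OF A] unfolding bounded_operator_on_def by blast
  obtain b where b: "\<And>f. f \<in> K \<Longrightarrow> norm (B f) \<le> b * norm f"
    using symbol_op_bounded[OF B] unfolding bounded_operator_on_def by blast
  note lin = symbol_op_linear[OF A] symbol_op_linear[OF B]
  have "norm (T f) \<le> (a + cmod l * b + cmod m) * norm f" if "f \<in> K" for f
  proof -
    have "norm (T f) \<le> norm (A f) + cmod l * norm (B f) + cmod m * norm f"
      unfolding T_def using norm_triangle_ineq4[of "A f - l *\<^sub>C B f" "m *\<^sub>C f"]
        norm_triangle_ineq4[of "A f" "l *\<^sub>C B f"] by (simp add: norm_scaleC)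
    also have "\<dots> \<le> a * norm f + cmod l * (b * norm f) + cmod m * norm f"
      using a[OF that] b[OF that] by (intro add_mono mult_left_mono) auto
    finally show ?thesis by (simp add: algebra_simps)
  qed
  then have "bounded_operator_on K T"
    unfolding bounded_operator_on_def
    by (auto simp: T_def lin K_intros scaleC_simps mult.commute[of l] mult.commute[of m])
  moreover have "displacement T 0 0"
    unfolding displacement_def
  proof
    fix f assume f: "f \<in> K"
    have "T f - S (T (R f)) = (A f - S (A (R f))) - l *\<^sub>C (B f - S (B (R f))) - m *\<^sub>C (f - S (R f))"
      by (simp add: T_def S_diff S_scale scaleC_simps)
    also have "\<dots> = 0"
      unfolding symbol_op_displacement[OF A f] symbol_op_displacement[OF B f] S_R[OF f] x y m_def
      by (simp add: cinner_simps scaleC_simps algebra_simps)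
    finally show "T f - S (T (R f)) = \<langle>f, k0\<rangle> *\<^sub>C 0 + \<langle>f, 0\<rangle> *\<^sub>C k0" by simp
  qed
  ultimately have "T f = 0" if "f \<in> K" for f using zero_displacement that by blast
  then have "A f = l *\<^sub>C B f + m *\<^sub>C f" if "f \<in> K" for f using that by (simp add: T_def algebra_simps)
  then show ?thesis by (rule that)
qed

section \<open>Sedlock classes in terms of pairs\<close>

lemma eq_mod_k0_of_W:
  assumes "y \<in> K" "W y = z + s *\<^sub>C k0"
  obtains r where "y = W z + r *\<^sub>C k0"
proof -
  have "y - \<langle>y, k0\<rangle> *\<^sub>C k0 = W z + cnj s *\<^sub>C W k0"
    using W_W[OF assms(1)] by (simp only: assms(2) W_add W_scale)
  then have "y = W z + (\<langle>y, k0\<rangle> - cnj s * u0) *\<^sub>C k0"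
    by (simp add: S_C_k0 scaleC_simps algebra_simps)
  then show ?thesis by (rule that)
qed

text \<open>A multiple \<open>r\<close> of \<open>k0\<close> in the second entry acts like
  \<open>cnj r\<close> in the first, where \<open>k0\<close> may be exchanged for a constant symbol.
  The conjugate of \<open>\<alpha>\<close> enters because the second entry is conjugated in the
  symbol.\<close>

lemma sedlock_FiniteI:
  assumes A: "symbol_op A x y" and y: "y = cnj \<alpha> *\<^sub>C W x + r *\<^sub>C k0"
  shows "A \<in> sedlock_class u (Finite \<alpha>)"
proof -
  note K = symbol_op_K[OF A]
  have "displacement A (x + cnj r *\<^sub>C k0) (cnj \<alpha> *\<^sub>C W x)"
    unfolding displacement_def using symbol_op_displacement[OF A]
    by (simp add: y cinner_simps scaleC_simps algebra_simps)
  from displacement_imp_TTO[OF symbol_op_bounded[OF A] this]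
  have "is_TTO u ((x + \<alpha> *\<^sub>C conj_L2 (W x)) + cnj r *\<^sub>C k0) A"
    using K by (simp add: K_intros conj_scale add_ac)
  then have "is_TTO u (x + \<alpha> *\<^sub>C conj_L2 (W x) + to_L2 (\<lambda>_. cnj r)) A"
    unfolding TTO_k0_symbol .
  then show ?thesis using K(1) by (auto simp: TTO_def)
qed

lemma sedlock_InfinityI:
  assumes A: "symbol_op A x y" and x: "x = s *\<^sub>C k0"
  shows "A \<in> sedlock_class u Infinity"
proof -
  note K = symbol_op_K[OF A]
  have q: "y + cnj s *\<^sub>C k0 \<in> K" using K by (simp add: K_intros)
  have "displacement A 0 (y + cnj s *\<^sub>C k0)"
    unfolding displacement_def using symbol_op_displacement[OF A]
    by (simp add: x cinner_simps scaleC_simps algebra_simps)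
  from displacement_imp_TTO[OF symbol_op_bounded[OF A] this K_zero q]
  have "is_TTO u (conj_L2 (y + cnj s *\<^sub>C k0)) A" by simp
  then show ?thesis using K_analytic[OF q] by (auto simp: TTO_def H2_eq)
qed

lemma sedlock_FiniteD:
  assumes "A \<in> sedlock_class u (Finite \<alpha>)"
  obtains x c where "x \<in> K" "symbol_op A (x + c *\<^sub>C k0) (cnj \<alpha> *\<^sub>C W x)"
proof -
  obtain x c where x: "x \<in> K" and tto: "is_TTO u (x + \<alpha> *\<^sub>C conj_L2 (W x) + to_L2 (\<lambda>_. c)) A"
    using assms by auto
  have "is_TTO u ((x + \<alpha> *\<^sub>C conj_L2 (W x)) + c *\<^sub>C k0) A"
    unfolding TTO_k0_symbol by (rule tto)
  then have "is_TTO u ((x + c *\<^sub>C k0) + conj_L2 (cnj \<alpha> *\<^sub>C W x)) A"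
    by (simp add: conj_scale add_ac)
  from symbol_opI[OF this] that x show ?thesis by (simp add: K_intros)
qed

lemma sedlock_InfinityD:
  assumes "A \<in> sedlock_class u Infinity"
  obtains y where "symbol_op A 0 y"
proof -
  obtain \<phi> where "\<phi> \<in> analytic_L2" "is_TTO u (0 + conj_L2 \<phi>) A"
    using assms by (auto simp: H2_eq)
  then have "is_TTO u (0 + conj_L2 (P \<phi>)) A" by (intro TTO_conj_analytic_symbol)
  from symbol_opI[OF this K_zero] that show ?thesis by simp
qed

lemma sedlock_commutator:
  assumes "A \<in> sedlock_class u \<alpha>" "B \<in> sedlock_class u \<alpha>"
  shows "commutator A B \<in> TTO u"
proof (cases \<alpha>)
  case (Finite a)
  obtain x c where x: "x \<in> K" and A: "symbol_op A (x + c *\<^sub>C k0) (cnj a *\<^sub>C W x)"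
    using sedlock_FiniteD assms Finite by blast
  obtain v d where v: "v \<in> K" and B: "symbol_op B (v + d *\<^sub>C k0) (cnj a *\<^sub>C W v)"
    using sedlock_FiniteD assms Finite by blast
  show ?thesis
  proof (rule commutator_TTO_of_weak[OF A B])
    fix h g assume h: "h \<in> V" and g: "g \<in> V"
    \<comment> \<open>On \<open>V\<close> the relation
      \<open>W (cnj a *\<^sub>C W x) = a *\<^sub>C x\<close> holds modulo \<open>k0\<close>; the
      first two terms cancel, and so do the last two.\<close>
    show "\<langle>h, cnj a *\<^sub>C W v\<rangle> * \<langle>x + c *\<^sub>C k0, g\<rangle> -
       \<langle>h, W (v + d *\<^sub>C k0)\<rangle> * \<langle>W (cnj a *\<^sub>C W x), g\<rangle> -
       \<langle>h, cnj a *\<^sub>C W x\<rangle> * \<langle>v + d *\<^sub>C k0, g\<rangle> +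
       \<langle>h, W (x + c *\<^sub>C k0)\<rangle> * \<langle>W (cnj a *\<^sub>C W v), g\<rangle> = 0"
      unfolding W_add W_scale W_W[OF x] W_W[OF v] S_C_k0
      using V_k0[OF h] V_k0[OF g] by (simp add: cinner_simps)
  qed
next
  case Infinity
  obtain y where A: "symbol_op A 0 y" using sedlock_InfinityD assms Infinity by blast
  obtain w where B: "symbol_op B 0 w" using sedlock_InfinityD assms Infinity by blast
  have "W 0 = 0" using W_scale[of 0 0] by simp
  then show ?thesis by (intro commutator_TTO_of_weak[OF A B]) simp
qed

lemma commuting_cases:
  assumes A: "symbol_op A x y" and B: "symbol_op B v w"
    and 0: "\<And>f. f \<in> K \<Longrightarrow> commutator A B f = 0"
  shows "(\<exists>\<alpha>. A \<in> sedlock_class u \<alpha> \<and> B \<in> sedlock_class u \<alpha>) \<or>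
    (\<exists>l m. (\<forall>f\<in>K. A f = l *\<^sub>C B f + m *\<^sub>C f) \<or> (\<forall>f\<in>K. B f = l *\<^sub>C A f + m *\<^sub>C f))"
proof -
  \<comment> \<open>The orthogonal projection onto \<open>V\<close>; for \<open>k0 = 0\<close> it is
    the identity, since the subtracted multiple of \<open>k0\<close> is zero.\<close>
  define pr where "pr z = z - (\<langle>z, k0\<rangle> / \<langle>k0, k0\<rangle>) *\<^sub>C k0" for z
  note K = symbol_op_K[OF A] symbol_op_K[OF B]
  have prV: "pr z \<in> V" if "z \<in> K" for z
    using that by (cases "k0 = 0") (auto simp: pr_def V_def K_intros cinner_simps cinner_eq_zero_iff)
  have pr: "\<langle>pr z, g\<rangle> = \<langle>z, g\<rangle>" if "g \<in> V" for z g
    using V_k0[OF that] by (simp add: pr_def cinner_simps)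
  have pr_eq: "\<exists>s. z = z' + s *\<^sub>C k0" if "pr z = z' - t *\<^sub>C k0" for z z' t
  proof -
    have "z = z' + (\<langle>z, k0\<rangle> / \<langle>k0, k0\<rangle> - t) *\<^sub>C k0"
      using that by (simp add: pr_def scaleC_simps algebra_simps)
    then show ?thesis by blast
  qed
  have scale_pr: "c *\<^sub>C pr z = c *\<^sub>C z - (c * (\<langle>z, k0\<rangle> / \<langle>k0, k0\<rangle>)) *\<^sub>C k0" for c z
    by (simp add: pr_def scaleC_simps)
  have id: "\<langle>pr (W w), h\<rangle> *\<^sub>C pr x + \<langle>pr x, h\<rangle> *\<^sub>C pr (W w) =
      \<langle>pr (W y), h\<rangle> *\<^sub>C pr v + \<langle>pr v, h\<rangle> *\<^sub>C pr (W y)" if h: "h \<in> V" for h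
  proof -
    \<comment> \<open>The difference of both sides lies in \<open>V\<close>, and the scalar identity
      tested on \<open>g = e\<close> makes it orthogonal to itself.\<close>
    define e where "e = \<langle>pr (W w), h\<rangle> *\<^sub>C pr x + \<langle>pr x, h\<rangle> *\<^sub>C pr (W w)
      - (\<langle>pr (W y), h\<rangle> *\<^sub>C pr v + \<langle>pr v, h\<rangle> *\<^sub>C pr (W y))"
    have eV: "e \<in> V" unfolding e_def using K by (intro V_diff V_add V_scale prV S_in_K)
    have "\<langle>e, e\<rangle> = \<langle>W w, h\<rangle> * \<langle>x, e\<rangle> + \<langle>x, h\<rangle> * \<langle>W w, e\<rangle> - (\<langle>W y, h\<rangle> * \<langle>v, e\<rangle> + \<langle>v, h\<rangle> * \<langle>W y, e\<rangle>)"
      using arg_cong[OF e_def, of "\<lambda>z. \<langle>z, e\<rangle>"]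
      by (simp only: cinner_diff_left cinner_add_left cinner_scale_left pr[OF eV] pr[OF h])
    also have "\<dots> = 0"
      using commutator_zero_identity[OF A B 0 h eV] by (simp add: algebra_simps)
    finally show ?thesis by (simp add: cinner_eq_zero_iff e_def)
  qed
  show ?thesis
  \<comment> \<open>In the notation of the lemma \<open>a\<close>, \<open>b\<close>,
    \<open>d\<close>, \<open>c\<close> are the projections of \<open>x\<close>, \<open>v\<close>,
    \<open>W w\<close>, \<open>W y\<close>. The four cases yield in turn the class at infinity, a
    finite class, \<open>A\<close> affine in \<open>B\<close>, and \<open>B\<close> a multiple of
    the identity.\<close>
  proof (rule symmetric_product_cases[of V "pr x" "pr v" "pr (W w)" "pr (W y)"])
    show "pr x \<in> V" "pr v \<in> V" using K by (auto intro: prV)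
  next
    assume "pr x = 0" "pr v = 0"
    then obtain s t where "x = s *\<^sub>C k0" "v = t *\<^sub>C k0" by (auto simp: pr_def)
    then show ?thesis using sedlock_InfinityI A B by blast
  next
    fix \<alpha> assume c: "pr (W y) = \<alpha> *\<^sub>C pr x" and d: "pr (W w) = \<alpha> *\<^sub>C pr v"
    have *: "\<exists>r. y = cnj \<alpha> *\<^sub>C W x + r *\<^sub>C k0" if pry: "pr (W y) = \<alpha> *\<^sub>C pr x" and yK: "y \<in> K" for x y
    proof -
      obtain s where "W y = \<alpha> *\<^sub>C x + s *\<^sub>C k0" using pr_eq[OF pry[unfolded scale_pr]] by blast
      from eq_mod_k0_of_W[OF yK this] show ?thesis unfolding W_scale by blast
    qed
    show ?thesis using sedlock_FiniteI A B *[OF c K(2)] *[OF d K(4)] by blast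
  next
    fix l assume a: "pr x = l *\<^sub>C pr v" and c: "pr (W y) = l *\<^sub>C pr (W w)"
    obtain s where x: "x = l *\<^sub>C v + s *\<^sub>C k0" using pr_eq[OF a[unfolded scale_pr]] by blast
    obtain s' where "W y = l *\<^sub>C W w + s' *\<^sub>C k0" using pr_eq[OF c[unfolded scale_pr]] by blast
    from eq_mod_k0_of_W[OF K(2) this]
    obtain r where "y = cnj l *\<^sub>C (w - \<langle>w, k0\<rangle> *\<^sub>C k0) + r *\<^sub>C k0"
      unfolding W_scale W_W[OF K(4)] by blast
    then have "y = cnj l *\<^sub>C w + (r - cnj l * \<langle>w, k0\<rangle>) *\<^sub>C k0"
      by (simp add: scaleC_simps)
    from symbol_dependent[OF A B x this] show ?thesis by metis
  next
    assume b: "pr v = 0" and d: "pr (W w) = 0"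
    obtain t where v: "v = 0 *\<^sub>C x + t *\<^sub>C k0" using b by (auto simp: pr_def)
    have "W w = 0 + (\<langle>W w, k0\<rangle> / \<langle>k0, k0\<rangle>) *\<^sub>C k0" using d by (simp add: pr_def)
    from eq_mod_k0_of_W[OF K(4) this]
    obtain r where "w = W 0 + r *\<^sub>C k0" by blast
    then have "w = cnj 0 *\<^sub>C y + r *\<^sub>C k0" using W_scale[of 0 0] by simp
    from symbol_dependent[OF B A v this] show ?thesis by metis
  qed (auto simp: id V_diff V_scale)
qed

end

theorem theorem6p1:
  fixes u \<phi> \<psi> :: L2 and A B :: "L2 \<Rightarrow> L2"
  assumes "inner_function u"
    and "is_TTO u \<phi> A"
    and "is_TTO u \<psi> B"
  shows "((\<forall>f\<in>model_space u. A (B f) = B (A f)) \<longleftrightarrow> (\<lambda>f. A (B f) - B (A f)) \<in> TTO u) \<and>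
    ((\<lambda>f. A (B f) - B (A f)) \<in> TTO u \<longleftrightarrow>
      (\<exists>\<alpha>. A \<in> sedlock_class u \<alpha> \<and> B \<in> sedlock_class u \<alpha>) \<or>
      \<not> (\<forall>a b c :: complex.
            (\<forall>f\<in>model_space u. a *\<^sub>C f + b *\<^sub>C A f + c *\<^sub>C B f = 0) \<longrightarrow>
            a = 0 \<and> b = 0 \<and> c = 0))"
proof -
  interpret model u by standard (rule assms(1))
  obtain x y where "x \<in> K" "y \<in> K" "is_TTO u (x + conj_L2 y) A"
    using TTO_symbol_exists[OF assms(2)] by blast
  then have A: "symbol_op A x y" by (intro symbol_opI)
  obtain v w where "v \<in> K" "w \<in> K" "is_TTO u (v + conj_L2 w) B"
    using TTO_symbol_exists[OF assms(3)] by blast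
  then have B: "symbol_op B v w" by (intro symbol_opI)
  note lin = symbol_op_linear[OF A] symbol_op_linear[OF B]
  have comm: "(\<lambda>f. A (B f) - B (A f)) = commutator A B" by (simp add: commutator_def fun_eq_iff)
  have iff1: "(\<forall>f\<in>K. A (B f) = B (A f)) \<longleftrightarrow> commutator A B \<in> TTO u"
    unfolding commutator_TTO_iff[OF A B] by (simp add: commutator_def)
  let ?dep = "\<exists>a b c. (\<forall>f\<in>K. a *\<^sub>C f + b *\<^sub>C A f + c *\<^sub>C B f = 0) \<and> \<not> (a = 0 \<and> b = 0 \<and> c = 0)"
  have to_dep: ?dep if "\<forall>f\<in>K. A f = l *\<^sub>C B f + m *\<^sub>C f" for l m
    using that by (intro exI[of _ "- m"] exI[of _ 1] exI[of _ "- l"]) (simp add: scaleC_simps)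
  have to_dep': ?dep if "\<forall>f\<in>K. B f = l *\<^sub>C A f + m *\<^sub>C f" for l m
    using that by (intro exI[of _ "- m"] exI[of _ "- l"] exI[of _ 1]) (simp add: scaleC_simps)
  have from_dep: "A (B f) = B (A f)"
    if d: "\<forall>f\<in>K. a *\<^sub>C f + b *\<^sub>C A f + c *\<^sub>C B f = 0" and n: "\<not> (a = 0 \<and> b = 0 \<and> c = 0)"
      and f: "f \<in> K" for a b c f
  proof -
    have 1: "a *\<^sub>C A f + b *\<^sub>C A (A f) + c *\<^sub>C A (B f) = 0"
    proof -
      have "A (a *\<^sub>C f + b *\<^sub>C A f + c *\<^sub>C B f) = 0"
        using d f operator_scale[OF symbol_op_bounded[OF A] f, of 0] by simp
      then show ?thesis using f by (simp add: lin K_intros)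
    qed
    have 2: "a *\<^sub>C A f + b *\<^sub>C A (A f) + c *\<^sub>C B (A f) = 0" using d f lin by simp
    have 3: "a *\<^sub>C B f + b *\<^sub>C B (A f) + c *\<^sub>C B (B f) = 0"
    proof -
      have "B (a *\<^sub>C f + b *\<^sub>C A f + c *\<^sub>C B f) = 0"
        using d f operator_scale[OF symbol_op_bounded[OF B] f, of 0] by simp
      then show ?thesis using f by (simp add: lin K_intros)
    qed
    have 4: "a *\<^sub>C B f + b *\<^sub>C A (B f) + c *\<^sub>C B (B f) = 0" using d f lin by simp
    have cancel: "z = 0" if "k *\<^sub>C z = 0" "k \<noteq> 0" for k z
    proof -
      have "(inverse k * k) *\<^sub>C z = 0"
        unfolding scaleC_scaleC[symmetric] that(1) by simp
      then show ?thesis using that(2) by simp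
    qed
    \<comment> \<open>\<open>A\<close> applied to the relation at \<open>f\<close> is compared with
      the relation at \<open>A f\<close>: they differ only in the term with \<open>c\<close>. With
      \<open>B\<close> in place of \<open>A\<close> only the term with \<open>b\<close>
      differs.\<close>
    have "c *\<^sub>C (A (B f) - B (A f)) = 0" using 1 2 by (simp add: scaleC_simps) (metis add_left_cancel)
    moreover have "b *\<^sub>C (A (B f) - B (A f)) = 0" using 3 4
      by (simp add: scaleC_simps) (metis add_left_cancel add_right_cancel)
    \<comment> \<open>If \<open>b\<close> and \<open>c\<close> vanish, the relation says that
      \<open>a\<close> annihilates the model space, in particular the value of the
      commutator.\<close>
    moreover have "a *\<^sub>C (A (B f) - B (A f)) = 0" if "b = 0" "c = 0"
      using d that f lin by (simp add: K_intros)
    ultimately show ?thesis using n cancel by (metis right_minus_eq)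
  qed
  have iff2: "commutator A B \<in> TTO u \<longleftrightarrow>
      (\<exists>\<alpha>. A \<in> sedlock_class u \<alpha> \<and> B \<in> sedlock_class u \<alpha>) \<or> ?dep"
  proof
    assume "commutator A B \<in> TTO u"
    then have "\<And>f. f \<in> K \<Longrightarrow> commutator A B f = 0" using commutator_TTO_iff[OF A B] by blast
    from commuting_cases[OF A B this] to_dep to_dep'
    show "(\<exists>\<alpha>. A \<in> sedlock_class u \<alpha> \<and> B \<in> sedlock_class u \<alpha>) \<or> ?dep" by blast
  next
    assume "(\<exists>\<alpha>. A \<in> sedlock_class u \<alpha> \<and> B \<in> sedlock_class u \<alpha>) \<or> ?dep"
    then show "commutator A B \<in> TTO u"
    proof
      assume ?dep
      then show ?thesis using from_dep iff1 by blast
    qed (use sedlock_commutator in blast)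
  qed
  show ?thesis unfolding comm using iff1 iff2 by blast
qed

end
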